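(* Let $0<s<1$. The operator $\mathbf{T}$ given by $$\mathbf{T}g=\Big(\sum_{j\in\mathbb{Z}}\langle g,h^j_i\rangle h^j_i:\ i\ge 0\Big),\qquad g\in L^2(\mathbb{R}^+),$$ is an $\ell^2$-valued Calderón–Zygmund operator in $(\mathbb{R}^+,\delta,\text{Lebesgue measure})$. Moreover, for every $1<p<\infty$ there is a constant $C_p$ such that $$\big\|\,|\boldsymbol{\nabla}^s_{dy}u|_{\ell^2}\,\big\|_{L^p(\mathbb{R}^+)}\le C_p\,\big\|(-\Delta)^{s/2}_{dy}u\big\|_{L^p(\mathbb{R}^+)}$$ for every $u\in\mathcal{S}(\mathscr{H})$.
   Context: $\mathbb{R}^+=[0,\infty)$ with Lebesgue measure; $\mathbb{Z}^+$ is the set of nonnegative integers and $\ell^2=\ell^2(\mathbb{Z}^+)$ (real sequences), with norm $|\cdot|_{\ell^2}$ and inner product $\langle\cdot,\cdot\rangle_{\ell^2}$. All functions are real valued or $\ell^2$ valued. Dyadic intervals: for $j\in\mathbb{Z}$, $k\in\mathbb{Z}^+$, $I^j_k=[k2^{-j},(k+1)2^{-j})$; $\mathcal{D}=\{I^j_k: j\in\mathbb{Z},k\ge0\}$. For $x\ne y$ in $\mathbb{R}^+$, $I(x,y)$ is the smallest interval in $\mathcal{D}$ containing both $x$ and $y$; $\delta(x,y)=|I(x,y)|$ (its length) and $\delta(x,x)=0$. $\delta$ is an (ultra)metric on $\mathbb{R}^+$. $\triangle$ denotes the diagonal of $\mathbb{R}^+\times\mathbb{R}^+$. Haar system: $h^0_0=\mathcal{X}_{[0,1/2)}-\mathcal{X}_{[1/2,1)}$,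 $h^j_k(x)=2^{j/2}h^0_0(2^jx-k)$, which is supported in $I^j_k$. $\mathscr{H}=\{h^j_k: j\in\mathbb{Z},k\ge0\}$ is an orthonormal basis of $L^2(\mathbb{R}^+)$; $I(h)$ denotes the dyadic interval supporting $h\in\mathscr{H}$; $\mathcal{S}(\mathscr{H})$ is the linear span (finite linear combinations) of $\mathscr{H}$; $\langle f,h\rangle=\int_{\mathbb{R}^+}fh\,dx$. Operators, for $f\in\mathcal{S}(\mathscr{H})$ and $i\ge0$: the dyadic fractional Laplacian is $(-\Delta)^{s/2}_{dy}f=\sum_{h\in\mathscr{H}}|I(h)|^{-s}\langle f,h\rangle h$; the $i$-th partial dyadic derivative of order $s$ is $D^s_{(i)}f=\sum_{j\in\mathbb{Z}}2^{sj}\langle f,h^j_i\rangle h^j_i$; the gradient is $\boldsymbol{\nabla}^s_{dy}f=(D^s_{(i)}f:\ i\ge0)$. $\ell^2$-valued Calderón–Zygmund operator on $(\mathbb{R}^+,\delta,\text{Lebesgue measure})$: a bounded linear operator $\mathbf{T}:L^2(\mathbb{R}^+)\to L^2(\mathbb{R}^+,\ell^2)$ (the target with norm $\|\,|\cdot|_{\ell^2}\|_{L^2(\mathbb{R}^+)}$) for which there exists a kernel $\mathbf{K}\in L^1_{loc}(\mathbb{R}^+\times\mathbb{R}^+\setminus\triangle,\ell^2)$ such that: (i) there exists $C_0>0$ with $|\mathbf{K}(x,y)|_{\ell^2}\le \frac{C_0}{\delta(x,y)}$ for $x\neq y$; (ii) there exist $C_1>0$ and $\gamma>0$ such that (ii.a)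 $|\mathbf{K}(x',y)-\mathbf{K}(x,y)|_{\ell^2}\le C_1\frac{\delta(x',x)}{\delta(x,y)^{1+\gamma}}$ when $2\delta(x',x)\le\delta(x,y)$ (with $x\ne y$), (ii.b) $|\mathbf{K}(x,y')-\mathbf{K}(x,y)|_{\ell^2}\le C_1\frac{\delta(y,y')}{\delta(x,y)^{1+\gamma}}$ when $2\delta(y,y')\le\delta(x,y)$ (with $x\ne y$); (iii) there exist a dense subspace $S$ of $L^2(\mathbb{R}^+)$ and a dense subspace $\boldsymbol{S}$ of $L^2(\mathbb{R}^+,\ell^2)$ such that $$\langle\mathbf{T}\varphi,\boldsymbol{\psi}\rangle=\iint_{\mathbb{R}^+\times\mathbb{R}^+}\langle\mathbf{K}(x,y)\varphi(y),\boldsymbol{\psi}(x)\rangle_{\ell^2}\,dx\,dy$$ for every $\varphi\in S$ and every $\boldsymbol{\psi}\in\boldsymbol{S}$ with $\delta(\operatorname{supp}\varphi,\operatorname{supp}\boldsymbol{\psi})>0$, where $\langle\mathbf{T}\varphi,\boldsymbol{\psi}\rangle$ is the inner product of $L^2(\mathbb{R}^+,\ell^2)$, supports are taken in the metric space $(\mathbb{R}^+,\delta)$ and $\delta(A,B)=\inf\{\delta(a,b):a\in A,b\in B\}$. *)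

theory Defs
  imports "HOL-Analysis.Analysis"
begin

abbreviation rplus :: "real measure" where
  "rplus \<equiv> lebesgue_on {0..}"


subsection \<open>The sequence space \<open>\<ell>\<^sup>2\<close>\<close>

definition l2 :: "(nat \<Rightarrow> real) set" where
  "l2 = {a. summable (\<lambda>i. (a i)\<^sup>2)}"

definition l2_inner :: "(nat \<Rightarrow> real) \<Rightarrow> (nat \<Rightarrow> real) \<Rightarrow> real" where
  "l2_inner a b = (\<Sum>i. a i * b i)"

definition l2_norm :: "(nat \<Rightarrow> real) \<Rightarrow> real" where
  "l2_norm a = sqrt (\<Sum>i. (a i)\<^sup>2)"


subsection \<open>Lebesgue spaces on the half line\<close>

text \<open>
  Elements of the Lebesgue spaces are represented by functions, and equality of elements by
  equality almost everywhere. Only the values on \<open>{0..}\<close> matter. Since \<open>\<ell>\<^sup>2\<close> is separable,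
  measurability of an \<open>\<ell>\<^sup>2\<close>-valued function is measurability of its components (Pettis).
\<close>

definition Lp :: "real \<Rightarrow> (real \<Rightarrow> real) set" where
  "Lp p = {f \<in> borel_measurable rplus. integrable rplus (\<lambda>x. \<bar>f x\<bar> powr p)}"

definition Lp_norm :: "real \<Rightarrow> (real \<Rightarrow> real) \<Rightarrow> real" where
  "Lp_norm p f = (LINT x|rplus. \<bar>f x\<bar> powr p) powr (1 / p)"

definition Lp_l2 :: "real \<Rightarrow> (real \<Rightarrow> nat \<Rightarrow> real) set" where
  "Lp_l2 p = {F. (\<forall>i. (\<lambda>x. F x i) \<in> borel_measurable rplus) \<and> (AE x in rplus. F x \<in> l2)
                 \<and> (\<lambda>x. l2_norm (F x)) \<in> Lp p}"

definition Lp_l2_norm :: "real \<Rightarrow> (real \<Rightarrow> nat \<Rightarrow> real) \<Rightarrow> real" where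
  "Lp_l2_norm p F = Lp_norm p (\<lambda>x. l2_norm (F x))"

definition L2_inner :: "(real \<Rightarrow> real) \<Rightarrow> (real \<Rightarrow> real) \<Rightarrow> real" where
  "L2_inner f g = (LINT x|rplus. f x * g x)"

definition L2_l2_inner :: "(real \<Rightarrow> nat \<Rightarrow> real) \<Rightarrow> (real \<Rightarrow> nat \<Rightarrow> real) \<Rightarrow> real" where
  "L2_l2_inner F G = (LINT x|rplus. l2_inner (F x) (G x))"

definition dense_subspace_L2 :: "(real \<Rightarrow> real) set \<Rightarrow> bool" where
  "dense_subspace_L2 S \<longleftrightarrow>
     S \<subseteq> Lp 2 \<and> (\<lambda>x. 0) \<in> S \<and>
     (\<forall>f\<in>S. \<forall>g\<in>S. \<forall>a b. (\<lambda>x. a * f x + b * g x) \<in> S) \<and>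
     (\<forall>f\<in>Lp 2. \<forall>e>0. \<exists>g\<in>S. Lp_norm 2 (\<lambda>x. f x - g x) < e)"

definition dense_subspace_L2_l2 :: "(real \<Rightarrow> nat \<Rightarrow> real) set \<Rightarrow> bool" where
  "dense_subspace_L2_l2 S \<longleftrightarrow>
     S \<subseteq> Lp_l2 2 \<and> (\<lambda>x i. 0) \<in> S \<and>
     (\<forall>F\<in>S. \<forall>G\<in>S. \<forall>a b. (\<lambda>x i. a * F x i + b * G x i) \<in> S) \<and>
     (\<forall>F\<in>Lp_l2 2. \<forall>e>0. \<exists>G\<in>S. Lp_l2_norm 2 (\<lambda>x i. F x i - G x i) < e)"

text \<open>Unconditional convergence in \<open>L\<^sup>2\<close> of the series of the \<open>f j\<close> to \<open>F\<close>.\<close>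

definition has_L2_sum :: "('i \<Rightarrow> real \<Rightarrow> real) \<Rightarrow> (real \<Rightarrow> real) \<Rightarrow> bool" where
  "has_L2_sum f F \<longleftrightarrow>
     (\<forall>j. f j \<in> Lp 2) \<and> F \<in> Lp 2 \<and>
     ((\<lambda>J. Lp_norm 2 (\<lambda>x. (\<Sum>j\<in>J. f j x) - F x)) \<longlongrightarrow> 0) (finite_subsets_at_top UNIV)"

definition L2_sum :: "('i \<Rightarrow> real \<Rightarrow> real) \<Rightarrow> real \<Rightarrow> real" where
  "L2_sum f = (SOME F. has_L2_sum f F)"


subsection \<open>The dyadic metric\<close>

definition dyadic_interval :: "int \<Rightarrow> nat \<Rightarrow> real set" where
  "dyadic_interval j k = {real k * 2 powi (- j) ..< (real k + 1) * 2 powi (- j)}"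

definition dyadic_intervals :: "real set set" where
  "dyadic_intervals = {dyadic_interval j k | j k. True}"

definition dyadic_hull :: "real \<Rightarrow> real \<Rightarrow> real set" where
  "dyadic_hull x y = (THE I. I \<in> dyadic_intervals \<and> x \<in> I \<and> y \<in> I \<and>
                        (\<forall>J\<in>dyadic_intervals. x \<in> J \<and> y \<in> J \<longrightarrow> I \<subseteq> J))"

text \<open>Meaningful for nonnegative arguments only.\<close>

definition dyadic_dist :: "real \<Rightarrow> real \<Rightarrow> real" where
  "dyadic_dist x y = (if x = y then 0 else measure lebesgue (dyadic_hull x y))"

text \<open>
  The support of an element of \<open>L\<^sup>2\<close> has to be independent of the representative: it is
  the complement of the largest set, open for the dyadic metric, on which the function vanishes
  almost everywhere.
\<close>

definition dyadic_supp :: "(real \<Rightarrow> real) \<Rightarrow> real set" where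
  "dyadic_supp f = {x\<in>{0..}. \<forall>r>0. \<not> (AE y in rplus. dyadic_dist x y < r \<longrightarrow> f y = 0)}"

text \<open>Extended real valued, so that the distance to the empty set is infinite.\<close>

definition dyadic_setdist :: "real set \<Rightarrow> real set \<Rightarrow> ennreal" where
  "dyadic_setdist A B = (INF a\<in>A. INF b\<in>B. ennreal (dyadic_dist a b))"


subsection \<open>Haar system and dyadic differential operators\<close>

definition haar0 :: "real \<Rightarrow> real" where
  "haar0 x = indicator {0..<1/2} x - indicator {1/2..<1} x"

definition haar :: "int \<Rightarrow> nat \<Rightarrow> real \<Rightarrow> real" where
  "haar j k x = 2 powr (of_int j / 2) * haar0 (2 powi j * x - real k)"

definition haar_span :: "(real \<Rightarrow> real) set" where
  "haar_span = {(\<lambda>x. \<Sum>(j,k)\<in>A. c j k * haar j k x) | A c. finite A}"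

text \<open>On \<open>haar_span\<close> only finitely many terms of the following two sums are nonzero.\<close>

definition dyadic_frac_laplacian :: "real \<Rightarrow> (real \<Rightarrow> real) \<Rightarrow> real \<Rightarrow> real" where
  "dyadic_frac_laplacian s f x =
     (\<Sum>\<^sub>\<infinity>(j,k)\<in>UNIV. measure lebesgue (dyadic_interval j k) powr (- s)
        * L2_inner f (haar j k) * haar j k x)"

definition dyadic_partial :: "real \<Rightarrow> nat \<Rightarrow> (real \<Rightarrow> real) \<Rightarrow> real \<Rightarrow> real" where
  "dyadic_partial s i f x =
     (\<Sum>\<^sub>\<infinity>j\<in>UNIV. 2 powr (s * of_int j) * L2_inner f (haar j i) * haar j i x)"

definition dyadic_gradient :: "real \<Rightarrow> (real \<Rightarrow> real) \<Rightarrow> real \<Rightarrow> nat \<Rightarrow> real" where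
  "dyadic_gradient s f x = (\<lambda>i. dyadic_partial s i f x)"

definition haar_row_series :: "(real \<Rightarrow> real) \<Rightarrow> nat \<Rightarrow> int \<Rightarrow> real \<Rightarrow> real" where
  "haar_row_series g i j x = L2_inner g (haar j i) * haar j i x"

definition haar_row_operator :: "(real \<Rightarrow> real) \<Rightarrow> real \<Rightarrow> nat \<Rightarrow> real" where
  "haar_row_operator g x = (\<lambda>i. L2_sum (haar_row_series g i) x)"


subsection \<open>Calderon-Zygmund operators\<close>

text \<open>
  Almost everywhere equal arguments have almost everywhere equal images: this
  follows from linearity and boundedness.
\<close>

definition bounded_linear_L2_l2 :: "((real \<Rightarrow> real) \<Rightarrow> real \<Rightarrow> nat \<Rightarrow> real) \<Rightarrow> bool" where
  "bounded_linear_L2_l2 T \<longleftrightarrow>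
     (\<forall>f\<in>Lp 2. T f \<in> Lp_l2 2) \<and>
     (\<forall>f\<in>Lp 2. \<forall>g\<in>Lp 2. \<forall>a b.
        AE x in rplus. T (\<lambda>y. a * f y + b * g y) x = (\<lambda>i. a * T f x i + b * T g x i)) \<and>
     (\<exists>B. \<forall>f\<in>Lp 2. Lp_l2_norm 2 (T f) \<le> B * Lp_norm 2 f)"

text \<open>Local integrability is integrability on the compact subsets of the domain.\<close>

definition L1_loc_off_diagonal :: "(real \<Rightarrow> real \<Rightarrow> nat \<Rightarrow> real) \<Rightarrow> bool" where
  "L1_loc_off_diagonal K \<longleftrightarrow>
     (let \<Omega> = {(x, y). 0 \<le> x \<and> 0 \<le> y \<and> x \<noteq> y} in
       (\<forall>i. (\<lambda>(x, y). K x y i) \<in> borel_measurable (lebesgue_on \<Omega>)) \<and>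
       (AE (x, y) in lebesgue_on \<Omega>. K x y \<in> l2) \<and>
       (\<forall>C. compact C \<and> C \<subseteq> \<Omega> \<longrightarrow>
          integrable (lebesgue_on C) (\<lambda>(x, y). l2_norm (K x y))))"

definition l2_cz_kernel :: "(real \<Rightarrow> real \<Rightarrow> nat \<Rightarrow> real) \<Rightarrow> bool" where
  "l2_cz_kernel K \<longleftrightarrow>
     L1_loc_off_diagonal K \<and>
     (\<forall>x\<ge>0. \<forall>y\<ge>0. x \<noteq> y \<longrightarrow> K x y \<in> l2) \<and>
     (\<exists>C0>0. \<forall>x\<ge>0. \<forall>y\<ge>0. x \<noteq> y \<longrightarrow> l2_norm (K x y) \<le> C0 / dyadic_dist x y) \<and>
     (\<exists>C1>0. \<exists>\<gamma>>0.
        (\<forall>x\<ge>0. \<forall>x'\<ge>0. \<forall>y\<ge>0. x \<noteq> y \<and> 2 * dyadic_dist x' x \<le> dyadic_dist x y \<longrightarrow>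
           l2_norm (\<lambda>i. K x' y i - K x y i)
             \<le> C1 * (dyadic_dist x' x / dyadic_dist x y powr (1 + \<gamma>))) \<and>
        (\<forall>x\<ge>0. \<forall>y\<ge>0. \<forall>y'\<ge>0. x \<noteq> y \<and> 2 * dyadic_dist y y' \<le> dyadic_dist x y \<longrightarrow>
           l2_norm (\<lambda>i. K x y' i - K x y i)
             \<le> C1 * (dyadic_dist y y' / dyadic_dist x y powr (1 + \<gamma>))))"

definition represented_off_diagonal ::
    "((real \<Rightarrow> real) \<Rightarrow> real \<Rightarrow> nat \<Rightarrow> real) \<Rightarrow> (real \<Rightarrow> real \<Rightarrow> nat \<Rightarrow> real) \<Rightarrow> bool" where
  "represented_off_diagonal T K \<longleftrightarrow>
     (\<exists>S V. dense_subspace_L2 S \<and> dense_subspace_L2_l2 V \<and>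
        (\<forall>\<phi>\<in>S. \<forall>\<psi>\<in>V.
           dyadic_setdist (dyadic_supp \<phi>) (dyadic_supp (\<lambda>x. l2_norm (\<psi> x))) > 0 \<longrightarrow>
           has_bochner_integral (lebesgue_on ({0..} \<times> {0..}))
             (\<lambda>(x, y). l2_inner (\<lambda>i. K x y i * \<phi> y) (\<psi> x)) (L2_l2_inner (T \<phi>) \<psi>)))"

definition l2_calderon_zygmund :: "((real \<Rightarrow> real) \<Rightarrow> real \<Rightarrow> nat \<Rightarrow> real) \<Rightarrow> bool" where
  "l2_calderon_zygmund T \<longleftrightarrow>
     bounded_linear_L2_l2 T \<and> (\<exists>K. l2_cz_kernel K \<and> represented_off_diagonal T K)"

end

theory Submission
  imports Defs
begin

text \<open>
  On \<open>haar_span\<close> the gradient of \<open>u\<close> is the row operator applied to \<open>f = (-\<Delta>)\<^sup>s\<^sup>/\<^sup>2 u\<close>, because both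
  multiply the Haar coefficients by \<open>2\<^sup>s\<^sup>j\<close>. A point lies in at most one interval of each row \<open>i \<ge> 1\<close>,
  so the rows \<open>i \<ge> 1\<close> contribute at most the square function \<open>q = \<Sum> c\<^sup>2 h\<^sup>2\<close> of \<open>f\<close>, while row 0 sums to
  a function \<open>y\<close>. Both are controlled by Bellman functions \<open>W (f, y, q)\<close>: adding a Haar function of the
  finest scale moves the state by \<open>(\<plusminus>d, 0, d\<^sup>2)\<close>, or by \<open>(\<plusminus>d, \<plusminus>d, d\<^sup>2)\<close> with \<open>f = y\<close> if the function
  belongs to row 0, on the two halves of its support. Hence \<open>\<integral> W \<le> 0\<close> whenever \<open>W\<close> is midpoint concave
  along these jumps and \<open>W (0, 0, 0) = 0\<close>. The choices \<open>\<bar>y\<bar>\<^sup>p - \<bar>f\<bar>\<^sup>p\<close>, \<open>(f\<^sup>2 + q)\<^sup>r - C \<bar>f\<bar>\<^sup>p\<close> for \<open>p \<le> 2\<close>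
  and \<open>q\<^sup>r - r f\<^sup>2 q\<^sup>r\<^sup>-\<^sup>1\<close> for \<open>p > 2\<close>, where \<open>r = p / 2\<close>, give the \<open>L\<^sup>p\<close> inequality without any appeal to
  Calderon-Zygmund theory.

  The operator itself is bounded on \<open>L\<^sup>2\<close> by Bessel's inequality. Its kernel is \<open>\<Sum>\<^sub>j h\<^sup>j\<^sub>i(x) h\<^sup>j\<^sub>i(y)\<close>;
  only the scales \<open>2\<^sup>-\<^sup>j \<ge> \<delta>(x, y)\<close> contribute, which gives the size bound by a geometric series, and
  the kernel does not change when \<open>x\<close> moves by at most \<open>\<delta>(x, y) / 2\<close>, so both smoothness conditions
  hold with left hand side 0.
\<close>

subsection \<open>Dyadic scales and the Haar functions\<close>

text \<open>Position of the level-\<open>j\<close> dyadic interval containing \<open>x\<close>.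
  Replacing intervals by this integer turns nesting into division by 2; negative points get negative
  positions and so lie in no \<open>dyadic_interval\<close>.\<close>

definition dyadic_index :: "int \<Rightarrow> real \<Rightarrow> int" where
  "dyadic_index j x = \<lfloor>2 powi j * x\<rfloor>"

lemma dyadic_interval_iff: "x \<in> dyadic_interval j k \<longleftrightarrow> dyadic_index j x = int k"
proof -
  have p: "(2::real) powi j > 0" by simp
  have "x \<in> dyadic_interval j k \<longleftrightarrow> real k \<le> 2 powi j * x \<and> 2 powi j * x < real k + 1"
    using p by (simp add: dyadic_interval_def power_int_minus field_simps)
  then show ?thesis
    by (simp add: dyadic_index_def floor_eq_iff)
qed

lemma dyadic_index_nonneg: "0 \<le> x \<Longrightarrow> 0 \<le> dyadic_index j x"
  by (simp add: dyadic_index_def)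

lemma dyadic_index_neg: "x < 0 \<Longrightarrow> dyadic_index j x < 0"
  by (simp add: dyadic_index_def mult_pos_neg)

lemma dyadic_index_div_2: "dyadic_index j x = dyadic_index (j + 1) x div 2"
proof -
  have "2 powi j * x = (2 powi (j + 1) * x) / real_of_int 2"
    by (simp add: power_int_add)
  then show ?thesis
    unfolding dyadic_index_def by (metis floor_divide_real_eq_div zero_le_numeral)
qed

lemma dyadic_index_eq_mono:
  assumes "dyadic_index j x = dyadic_index j y" and "i \<le> j"
  shows "dyadic_index i x = dyadic_index i y"
  using assms(2,1)
proof (induction rule: int_le_induct)
  case (step i)
  then show ?case
    using dyadic_index_div_2[of "i - 1"] by simp
qed

lemma haar0_eq:
  "haar0 x = (if \<lfloor>2 * x\<rfloor> = 0 then 1 else if \<lfloor>2 * x\<rfloor> = 1 then - 1 else 0)"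
proof -
  have "\<lfloor>2 * x\<rfloor> = 0 \<longleftrightarrow> x \<in> {0..<1/2}" "\<lfloor>2 * x\<rfloor> = 1 \<longleftrightarrow> x \<in> {1/2..<1}"
    by (auto simp: floor_eq_iff)
  then show ?thesis
    by (auto simp: haar0_def)
qed

text \<open>The two halves of the support are the dyadic intervals of level \<open>j + 1\<close> at
  positions \<open>2 * k\<close> and \<open>2 * k + 1\<close>, so the value is read off one level
  finer.\<close>

lemma haar_eq:
  "haar j k x = 2 powr (of_int j / 2) *
     (if dyadic_index (j + 1) x = 2 * int k then 1
      else if dyadic_index (j + 1) x = 2 * int k + 1 then - 1 else 0)"
proof -
  have "\<lfloor>2 * (2 powi j * x - real k)\<rfloor> = dyadic_index (j + 1) x - 2 * int k"
  proof -
    have "2 * (2 powi j * x - real k) = 2 powi (j + 1) * x - of_int (2 * int k)"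
      by (simp add: power_int_add algebra_simps)
    then show ?thesis
      unfolding dyadic_index_def by (metis floor_diff_of_int)
  qed
  then show ?thesis
    by (simp add: haar_def haar0_eq)
qed

lemma powr_half_square: "(2 powr (of_int j / 2))\<^sup>2 = (2::real) powi j"
  by (simp add: power2_eq_square powr_add[symmetric] powr_real_of_int')

lemma haar_square: "(haar j k x)\<^sup>2 = (if dyadic_index j x = int k then 2 powi j else 0)"
proof -
  have "dyadic_index j x = int k \<longleftrightarrow>
      dyadic_index (j + 1) x = 2 * int k \<or> dyadic_index (j + 1) x = 2 * int k + 1"
    using dyadic_index_div_2[of j x] by presburger
  then show ?thesis
    by (auto simp: haar_eq power_mult_distrib powr_half_square)
qed

lemma haar_eq_0: "dyadic_index j x \<noteq> int k \<Longrightarrow> haar j k x = 0"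
  using haar_square[of j k x] by simp

lemma haar_cong: "dyadic_index (j + 1) x = dyadic_index (j + 1) y \<Longrightarrow> haar j k x = haar j k y"
  by (simp add: haar_eq)

lemma abs_haar: "\<bar>haar j k x\<bar> = (if dyadic_index j x = int k then 2 powr (of_int j / 2) else 0)"
proof -
  have "\<bar>haar j k x\<bar> = sqrt ((haar j k x)\<^sup>2)"
    by simp
  also have "\<dots> = (if dyadic_index j x = int k then sqrt ((2 powr (of_int j / 2))\<^sup>2) else 0)"
    by (simp add: haar_square powr_half_square del: real_sqrt_abs)
  finally show ?thesis
    by simp
qed

text \<open>For nonnegative \<open>x\<close> the position is nondecreasing in the scale, so a
  repeated value \<open>k\<close> already repeats at two consecutive scales; then
  \<open>k = k div 2\<close>, which excludes \<open>0 < k\<close>. This makes the supports within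
  any row other than row 0 pairwise disjoint.\<close>

lemma dyadic_index_unique_scale:
  assumes "dyadic_index i x = k" "dyadic_index j x = k" "0 < k"
  shows "i = j"
proof -
  have *: False if "dyadic_index i x = k" "dyadic_index j x = k" "i < j" for i j
  proof -
    have "dyadic_index (i + 1) x = k"
    proof -
      have x: "0 \<le> x"
        using that(1) assms(3) dyadic_index_neg[of x i] by force
      have "(2::real) powi i \<le> 2 powi (i+1)" "(2::real) powi (i+1) \<le> 2 powi j"
        using that(3) by (auto intro!: power_int_increasing)
      then have "dyadic_index i x \<le> dyadic_index (i + 1) x" "dyadic_index (i + 1) x \<le> dyadic_index j x"
        unfolding dyadic_index_def using x by (auto intro!: floor_mono mult_right_mono)
      then show ?thesis
        using that by simp
    qed
    then show False
      using dyadic_index_div_2[of i x] that(1) assms(3) by auto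
  qed
  show ?thesis
    using *[OF assms(1,2)] *[OF assms(2,1)] by (meson linorder_cases)
qed

section \<open>Measurability and interval lengths\<close>

lemma borel_measurable_dyadic_index [measurable]: "dyadic_index j \<in> borel \<rightarrow>\<^sub>M count_space UNIV"
  unfolding dyadic_index_def by measurable

lemma borel_measurable_haar [measurable]: "haar j k \<in> borel_measurable borel"
  unfolding haar_eq by measurable

lemma borel_measurable_lebesgue_on:
  fixes f :: "'a::euclidean_space \<Rightarrow> real"
  shows "f \<in> borel_measurable borel \<Longrightarrow> f \<in> borel_measurable (lebesgue_on S)"
  by (simp add: measurable_completion measurable_restrict_space1)

lemma measure_dyadic_interval: "measure lebesgue (dyadic_interval j k) = 2 powi (- j)"
proof -
  have "(real k + 1) * 2 powi (- j) = real k * 2 powi (- j) + 2 powi (- j)"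
    by (simp add: algebra_simps)
  then show ?thesis
    by (simp add: dyadic_interval_def)
qed

subsection \<open>The dyadic metric\<close>

lemma dyadic_index_separates:
  assumes "x \<noteq> y"
  shows "\<exists>j. dyadic_index j x \<noteq> dyadic_index j y"
proof -
  obtain n where "1 / \<bar>x - y\<bar> < 2 ^ n"
    using real_arch_pow[of 2 "1 / \<bar>x - y\<bar>"] by auto
  then have n: "1 < 2 ^ n * \<bar>x - y\<bar>"
    using assms by (simp add: field_simps)
  have "dyadic_index (int n) x \<noteq> dyadic_index (int n) y"
  proof
    assume "dyadic_index (int n) x = dyadic_index (int n) y"
    then have "\<bar>2 ^ n * x - 2 ^ n * y\<bar> < 1"
      unfolding dyadic_index_def power_int_of_nat by linarith
    moreover have "\<bar>2 ^ n * x - 2 ^ n * y\<bar> = 2 ^ n * \<bar>x - y\<bar>"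
      by (simp add: abs_mult flip: right_diff_distrib)
    ultimately show False using n by simp
  qed
  then show ?thesis by blast
qed

lemma dyadic_index_eventually_0:
  assumes "0 \<le> x"
  shows "\<exists>j. \<forall>i\<le>j. dyadic_index i x = 0"
proof -
  obtain n where n: "x < 2 ^ n"
    using real_arch_pow[of 2 x] by auto
  have "dyadic_index i x = 0" if "i \<le> - int n" for i
  proof -
    have "2 powi i * x \<le> 2 powi (- int n) * x"
      using assms that by (intro mult_right_mono power_int_increasing) auto
    also have "\<dots> < 1"
      using n by (simp add: power_int_minus field_simps)
    finally show ?thesis
      using assms by (auto simp: dyadic_index_def floor_eq_iff)
  qed
  then show ?thesis by blast
qed

text \<open>The scales at which \<open>x\<close> and \<open>y\<close> share an interval form a set
  that is closed under coarsening, nonempty because both positions are 0 at coarse scales, and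
  bounded above because the points are eventually separated. \<open>J\<close> is its
  maximum.\<close>

lemma dyadic_index_common_scale:
  assumes "0 \<le> x" "0 \<le> y" "x \<noteq> y"
  obtains J where "\<And>j. dyadic_index j x = dyadic_index j y \<longleftrightarrow> j \<le> J"
proof -
  let ?P = "\<lambda>j. dyadic_index j x = dyadic_index j y"
  obtain a b where a: "\<forall>i\<le>a. dyadic_index i x = 0" and b: "\<forall>i\<le>b. dyadic_index i y = 0"
    using dyadic_index_eventually_0 assms by meson
  obtain m where m: "\<not> ?P m"
    using dyadic_index_separates[OF assms(3)] by blast
  have P0: "?P (min a b)"
    using a b by simp
  have bd: "j < m" if "?P j" for j
    using m dyadic_index_eq_mono[OF that, of m] by linarith
  define J where "J = Max {j \<in> {min a b..m}. ?P j}"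
  have J: "J \<in> {j \<in> {min a b..m}. ?P j}"
    unfolding J_def by (rule Max_in) (use P0 bd[OF P0] in \<open>auto intro: finite_subset[of _ "{min a b..m}"] exI[of _ "min a b"]\<close>)
  have "j \<le> J" if "?P j" for j
  proof (cases "min a b \<le> j")
    case True
    then show ?thesis
      unfolding J_def using that bd[OF that]
      by (intro Max_ge) (auto intro: finite_subset[of _ "{min a b..m}"])
  qed (use J in auto)
  then show ?thesis
    using J dyadic_index_eq_mono that by blast
qed

lemma dyadic_interval_mono:
  assumes "x \<in> dyadic_interval i k" "x \<in> dyadic_interval j l" "i \<le> j"
  shows "dyadic_interval j l \<subseteq> dyadic_interval i k"
  using assms dyadic_index_eq_mono unfolding dyadic_interval_iff subset_iff by metis

text \<open>A dyadic interval containing both points has level at most \<open>J\<close>, hence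
  contains the level-\<open>J\<close> interval around \<open>x\<close> by nesting. The latter is
  therefore the hull.\<close>

lemma dyadic_dist_eq:
  assumes "0 \<le> x" "0 \<le> y" "x \<noteq> y"
    and J: "\<And>j. dyadic_index j x = dyadic_index j y \<longleftrightarrow> j \<le> J"
  shows "dyadic_dist x y = 2 powi (- J)"
proof -
  define I where "I = dyadic_interval J (nat (dyadic_index J x))"
  have I: "I \<in> dyadic_intervals" "x \<in> I" "y \<in> I"
    using assms(1) dyadic_index_nonneg[of x J] J[of J]
    by (auto simp: I_def dyadic_intervals_def dyadic_interval_iff)
  have min: "I \<subseteq> K" if "K \<in> dyadic_intervals" "x \<in> K" "y \<in> K" for K
  proof -
    obtain i k where K: "K = dyadic_interval i k"
      using \<open>K \<in> dyadic_intervals\<close> by (auto simp: dyadic_intervals_def)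
    then have "i \<le> J"
      using that(2,3) J[of i] by (simp add: dyadic_interval_iff)
    then show ?thesis
      using dyadic_interval_mono[of x] that(2) I(2) unfolding K I_def by blast
  qed
  have "dyadic_hull x y = I"
    unfolding dyadic_hull_def by (rule the_equality) (use I min in blast)+
  then show ?thesis
    using assms(3) by (simp add: dyadic_dist_def I_def measure_dyadic_interval)
qed

lemma dyadic_dist_scale:
  assumes "0 \<le> x" "0 \<le> y" "x \<noteq> y"
  obtains J where "dyadic_dist x y = 2 powi (- J)"
    and "\<forall>j. dyadic_index j x = dyadic_index j y \<longleftrightarrow> j \<le> J"
proof -
  obtain J where J: "\<And>j. dyadic_index j x = dyadic_index j y \<longleftrightarrow> j \<le> J"
    using dyadic_index_common_scale[OF assms] by blast
  then show ?thesis
    using that[of J] dyadic_dist_eq[OF assms J] by simp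
qed

lemma dyadic_dist_pos: "0 \<le> x \<Longrightarrow> 0 \<le> y \<Longrightarrow> x \<noteq> y \<Longrightarrow> 0 < dyadic_dist x y"
  by (rule dyadic_dist_scale[of x y]) auto

lemma dyadic_dist_le:
  assumes "0 \<le> x" "0 \<le> y" "dyadic_index j x = dyadic_index j y"
  shows "dyadic_dist x y \<le> 2 powi (- j)"
proof (cases "x = y")
  case False
  obtain J where "dyadic_dist x y = 2 powi (- J)" "\<forall>j. dyadic_index j x = dyadic_index j y \<longleftrightarrow> j \<le> J"
    by (rule dyadic_dist_scale[OF assms(1,2) False])
  moreover from this(2) assms(3) have "j \<le> J"
    by blast
  ultimately show ?thesis
    by (simp add: power_int_increasing)
qed (simp add: dyadic_dist_def)

text \<open>This comparison with the Euclidean metric later bounds the kernel on compact sets that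
  avoid the diagonal.\<close>

lemma abs_diff_le_dyadic_dist:
  assumes "0 \<le> x" "0 \<le> y"
  shows "\<bar>x - y\<bar> \<le> dyadic_dist x y"
proof (cases "x = y")
  case False
  obtain J where J: "dyadic_dist x y = 2 powi (- J)"
      "\<forall>j. dyadic_index j x = dyadic_index j y \<longleftrightarrow> j \<le> J"
    by (rule dyadic_dist_scale[OF assms False])
  then have "dyadic_index J x = dyadic_index J y"
    by blast
  then have "\<bar>2 powi J * x - 2 powi J * y\<bar> < 1"
    unfolding dyadic_index_def by linarith
  moreover have "\<bar>2 powi J * x - 2 powi J * y\<bar> = 2 powi J * \<bar>x - y\<bar>"
    by (simp add: abs_mult flip: right_diff_distrib)
  ultimately show ?thesis
    unfolding J(1) by (simp add: power_int_minus field_simps)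
qed (simp add: dyadic_dist_def)

subsection \<open>Bellman functions of finite Haar sums\<close>

lemma has_integral_dyadic_indicator:
  "has_bochner_integral rplus (indicator (dyadic_interval j k) :: real \<Rightarrow> real) (2 powi (- j))"
proof -
  have sub: "dyadic_interval j k \<subseteq> {0..}"
  proof
    fix x assume "x \<in> dyadic_interval j k"
    then show "x \<in> {0..}"
      using dyadic_index_neg[of x j] by (cases "x < 0") (auto simp: dyadic_interval_iff)
  qed
  have "dyadic_interval j k \<in> sets rplus"
    using sub by (auto simp: sets_restrict_space_iff) (simp add: dyadic_interval_def)
  moreover have "emeasure rplus (dyadic_interval j k) = ennreal (2 powi (- j))"
  proof -
    have "emeasure rplus (dyadic_interval j k) = emeasure lebesgue (dyadic_interval j k)"
      using sub by (simp add: emeasure_restrict_space)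
    also have "\<dots> = ennreal (measure lebesgue (dyadic_interval j k))"
      by (rule emeasure_eq_ennreal_measure) (simp add: dyadic_interval_def)
    finally show ?thesis
      by (simp add: measure_dyadic_interval)
  qed
  ultimately show ?thesis
    using has_bochner_integral_real_indicator[of "dyadic_interval j k" rplus]
    by (simp add: measure_def)
qed

definition haar_sum :: "(int \<Rightarrow> nat \<Rightarrow> real) \<Rightarrow> (int \<times> nat) set \<Rightarrow> real \<Rightarrow> real" where
  "haar_sum c A x = (\<Sum>(j, k)\<in>A. c j k * haar j k x)"

definition haar_row :: "(int \<Rightarrow> nat \<Rightarrow> real) \<Rightarrow> (int \<times> nat) set \<Rightarrow> nat \<Rightarrow> real \<Rightarrow> real" where
  "haar_row c A i x = (\<Sum>(j, k)\<in>A. if k = i then c j k * haar j k x else 0)"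

definition haar_square_sum :: "(int \<Rightarrow> nat \<Rightarrow> real) \<Rightarrow> (int \<times> nat) set \<Rightarrow> real \<Rightarrow> real" where
  "haar_square_sum c A x = (\<Sum>(j, k)\<in>A. (c j k * haar j k x)\<^sup>2)"

text \<open>Leaving \<open>W\<close> arbitrary lets the same lemmas serve the Bellman functions and,
  for \<open>W\<close> depending on one argument only, the integrability of each component.\<close>

definition haar_state ::
    "(real \<Rightarrow> real \<Rightarrow> real \<Rightarrow> real) \<Rightarrow> (int \<Rightarrow> nat \<Rightarrow> real) \<Rightarrow> (int \<times> nat) set \<Rightarrow> real \<Rightarrow> real" where
  "haar_state W c A x = W (haar_sum c A x) (haar_row c A 0 x) (haar_square_sum c A x)"

text \<open>
  No scale in \<open>A\<close> is finer than \<open>j\<close>, so the state of \<open>A\<close> is constant, equal to \<open>(a, b, q)\<close>, on the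
  support of \<open>haar j k\<close>; for \<open>k = 0\<close> that support meets only intervals of row 0, whence \<open>a = b\<close>.
\<close>

lemma haar_state_insert:
  assumes A: "finite A" "(j, k) \<notin> A" "\<forall>a\<in>A. fst a \<le> j"
  shows "\<exists>a b q. (k = 0 \<longrightarrow> a = b) \<and> 0 \<le> q \<and> (\<forall>W x. haar_state W c (insert (j, k) A) x = haar_state W c A x
      + indicator (dyadic_interval (j + 1) (2 * k)) x *
          (W (a + c j k * 2 powr (of_int j / 2))
             (if k = 0 then b + c j k * 2 powr (of_int j / 2) else b)
             (q + (c j k * 2 powr (of_int j / 2))\<^sup>2) - W a b q)
      + indicator (dyadic_interval (j + 1) (2 * k + 1)) x *
          (W (a - c j k * 2 powr (of_int j / 2))
             (if k = 0 then b - c j k * 2 powr (of_int j / 2) else b)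
             (q + (c j k * 2 powr (of_int j / 2))\<^sup>2) - W a b q))"
proof -
  \<comment> \<open>The left endpoint of the support is the sample point: the witnesses
    \<open>a\<close>, \<open>b\<close>, \<open>q\<close> are the three sums evaluated there.\<close>
  define x0 where "x0 = real k * 2 powi (- j)"
  have x0: "dyadic_index j x0 = int k"
  proof -
    have "2 powi j * x0 = real k"
      by (simp add: x0_def power_int_minus)
    then show ?thesis
      by (simp add: dyadic_index_def)
  qed
  \<comment> \<open>A member of \<open>A\<close> at the same scale lives on another interval and
    vanishes at both points; one at a coarser scale depends only on the position at a level not
    exceeding \<open>j\<close>.\<close>
  have const: "haar i l x = haar i l x0"
    if "(i, l) \<in> A" "dyadic_index j x = int k" for i l x
  proof (cases "i = j")
    case True
    then have "l \<noteq> k"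
      using that A by auto
    then show ?thesis
      using x0 that True by (simp add: haar_eq_0)
  next
    case False
    then have "i + 1 \<le> j"
      using A that by force
    then show ?thesis
      using dyadic_index_eq_mono[of j x x0] x0 that by (intro haar_cong) auto
  qed
  show ?thesis
  proof (intro exI conjI allI impI)
    show "haar_sum c A x0 = haar_row c A 0 x0" if "k = 0"
      unfolding haar_sum_def haar_row_def
    proof (intro sum.cong refl, clarify)
      fix i l assume "(i, l) \<in> A"
      \<comment> \<open>For \<open>k = 0\<close> the sample point is 0, whose position is 0 at every
        scale, so only members of row 0 can be nonzero there.\<close>
      have "dyadic_index j x0 = dyadic_index j 0"
        using x0 that by (simp add: dyadic_index_def)
      then have "dyadic_index i x0 = 0"
        using dyadic_index_eq_mono[of j x0 0 i] bspec[OF A(3) \<open>(i, l) \<in> A\<close>] by (simp add: dyadic_index_def)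
      then show "c i l * haar i l x0 = (if l = 0 then c i l * haar i l x0 else 0)"
        by (simp add: haar_eq_0)
    qed
    show "0 \<le> haar_square_sum c A x0"
      by (auto simp: haar_square_sum_def intro!: sum_nonneg)
    fix W x
    have *: "haar_state W c (insert (j, k) A) x =
      W (haar_sum c A x + c j k * haar j k x)
        (if k = 0 then haar_row c A 0 x + c j k * haar j k x else haar_row c A 0 x)
        (haar_square_sum c A x + (c j k * haar j k x)\<^sup>2)"
      using A(1,2)
      by (simp add: haar_state_def haar_sum_def haar_row_def haar_square_sum_def add.commute)
    show "haar_state W c (insert (j, k) A) x = haar_state W c A x
      + indicator (dyadic_interval (j + 1) (2 * k)) x *
          (W (haar_sum c A x0 + c j k * 2 powr (of_int j / 2))
             (if k = 0 then haar_row c A 0 x0 + c j k * 2 powr (of_int j / 2) else haar_row c A 0 x0)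
             (haar_square_sum c A x0 + (c j k * 2 powr (of_int j / 2))\<^sup>2)
             - W (haar_sum c A x0) (haar_row c A 0 x0) (haar_square_sum c A x0))
      + indicator (dyadic_interval (j + 1) (2 * k + 1)) x *
          (W (haar_sum c A x0 - c j k * 2 powr (of_int j / 2))
             (if k = 0 then haar_row c A 0 x0 - c j k * 2 powr (of_int j / 2) else haar_row c A 0 x0)
             (haar_square_sum c A x0 + (c j k * 2 powr (of_int j / 2))\<^sup>2)
             - W (haar_sum c A x0) (haar_row c A 0 x0) (haar_square_sum c A x0))"
    proof (cases "dyadic_index j x = int k")
      case True
      have eq: "haar_sum c A x = haar_sum c A x0" "haar_row c A 0 x = haar_row c A 0 x0"
          "haar_square_sum c A x = haar_square_sum c A x0"
        unfolding haar_sum_def haar_row_def haar_square_sum_def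
        by (auto intro!: sum.cong simp: const[OF _ True])
      have "dyadic_index (j + 1) x = 2 * int k \<or> dyadic_index (j + 1) x = 2 * int k + 1"
        using True dyadic_index_div_2[of j x] by presburger
      then show ?thesis
        unfolding * eq
        by (auto simp: haar_eq[of j] dyadic_interval_iff indicator_def haar_state_def eq)
    next
      case False
      then have "dyadic_index (j + 1) x \<noteq> 2 * int k" "dyadic_index (j + 1) x \<noteq> 2 * int k + 1"
        using dyadic_index_div_2[of j x] by auto
      then show ?thesis
        unfolding * by (auto simp: haar_eq[of j] haar_state_def dyadic_interval_iff indicator_def)
    qed
  qed
qed

text \<open>Each added Haar function changes the composite by multiples of two interval indicators,
  and \<open>W 0 0 0 = 0\<close> makes the initial composite vanish; the result is a finite
  combination of indicators of bounded intervals.\<close>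

lemma haar_state_integrable:
  assumes "finite A" and W0: "W 0 0 0 = 0"
  shows "integrable rplus (haar_state W c A)"
  using assms(1)
\<comment> \<open>Functions are added from coarse to fine, as \<open>haar_state_insert\<close>
  demands. The induction does not say that the inserted pair is new, hence the case
  distinction.\<close>
proof (induction rule: finite_ranking_induct[where f = fst])
  case empty
  then show ?case
    by (simp add: haar_state_def[abs_def] haar_sum_def haar_row_def haar_square_sum_def W0)
next
  case (insert jk A)
  obtain j k where jk: "jk = (j, k)" by fastforce
  show ?case
  proof (cases "jk \<in> A")
    case False
    have le: "\<forall>a\<in>A. fst a \<le> j"
      using insert.hyps(2) jk by auto
    obtain a b q where
      eq: "\<forall>W x. haar_state W c (insert (j, k) A) x = haar_state W c A x
      + indicator (dyadic_interval (j + 1) (2 * k)) x *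
          (W (a + c j k * 2 powr (of_int j / 2))
             (if k = 0 then b + c j k * 2 powr (of_int j / 2) else b)
             (q + (c j k * 2 powr (of_int j / 2))\<^sup>2) - W a b q)
      + indicator (dyadic_interval (j + 1) (2 * k + 1)) x *
          (W (a - c j k * 2 powr (of_int j / 2))
             (if k = 0 then b - c j k * 2 powr (of_int j / 2) else b)
             (q + (c j k * 2 powr (of_int j / 2))\<^sup>2) - W a b q)"
      using haar_state_insert[OF insert.hyps(1) False[unfolded jk] le, where c = c] by (elim exE conjE) (rule that)
    have ind: "integrable rplus (indicator (dyadic_interval i l) :: real \<Rightarrow> real)" for i l
      using has_integral_dyadic_indicator[of i l] by (simp add: has_bochner_integral_iff)
    show ?thesis
      unfolding jk eq[rule_format, abs_def]
      by (intro Bochner_Integration.integrable_add integrable_mult_left ind insert.IH)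
  qed (use insert in \<open>simp add: insert_absorb\<close>)
qed

text \<open>The two halves of the support have equal length, so adding a Haar function changes the
  integral by that length times the second difference of \<open>W\<close> along the jump.
  \<open>step0\<close> serves row 0, where the first two arguments coincide and move
  together.\<close>

lemma haar_state_integral_nonpos:
  assumes "finite A" and W0: "W 0 0 0 = 0"
    and step: "\<And>x y q d. 0 \<le> q \<Longrightarrow> W (x + d) y (q + d\<^sup>2) + W (x - d) y (q + d\<^sup>2) \<le> 2 * W x y q"
    and step0: "\<And>x q d. 0 \<le> q \<Longrightarrow>
      W (x + d) (x + d) (q + d\<^sup>2) + W (x - d) (x - d) (q + d\<^sup>2) \<le> 2 * W x x q"
  shows "(LINT x|rplus. haar_state W c A x) \<le> 0"
  using assms(1)
proof (induction rule: finite_ranking_induct[where f = fst])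
  case empty
  then show ?case
    by (simp add: haar_state_def haar_sum_def haar_row_def haar_square_sum_def W0)
next
  case (insert jk A)
  obtain j k where jk: "jk = (j, k)" by fastforce
  show ?case
  proof (cases "jk \<in> A")
    case False
    have le: "\<forall>a\<in>A. fst a \<le> j"
      using insert.hyps(2) jk by auto
    define d where "d = c j k * 2 powr (of_int j / 2)"
    obtain a b q where ab: "k = 0 \<longrightarrow> a = b" and q: "0 \<le> q" and
      eq: "\<forall>W x. haar_state W c (insert (j, k) A) x = haar_state W c A x
      + indicator (dyadic_interval (j + 1) (2 * k)) x *
          (W (a + d) (if k = 0 then b + d else b) (q + d\<^sup>2) - W a b q)
      + indicator (dyadic_interval (j + 1) (2 * k + 1)) x *
          (W (a - d) (if k = 0 then b - d else b) (q + d\<^sup>2) - W a b q)"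
      using haar_state_insert[OF insert.hyps(1) False[unfolded jk] le, where c = c, folded d_def] by (elim exE conjE) (rule that)
    have "has_bochner_integral rplus (haar_state W c A) (LINT x|rplus. haar_state W c A x)"
      by (intro has_bochner_integral_integrable haar_state_integrable insert.hyps(1) W0)
    then have "has_bochner_integral rplus (haar_state W c (insert (j, k) A))
        ((LINT x|rplus. haar_state W c A x)
        + 2 powi (- (j + 1)) * (W (a + d) (if k = 0 then b + d else b) (q + d\<^sup>2) - W a b q)
        + 2 powi (- (j + 1)) * (W (a - d) (if k = 0 then b - d else b) (q + d\<^sup>2) - W a b q))"
      unfolding eq[rule_format, abs_def]
      by (intro has_bochner_integral_add has_bochner_integral_mult_left has_integral_dyadic_indicator)
    then have "(LINT x|rplus. haar_state W c (insert (j, k) A) x) =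
        (LINT x|rplus. haar_state W c A x) + 2 powi (- (j + 1)) *
          (W (a + d) (if k = 0 then b + d else b) (q + d\<^sup>2)
            + W (a - d) (if k = 0 then b - d else b) (q + d\<^sup>2) - 2 * W a b q)"
      by (simp add: has_bochner_integral_integral_eq algebra_simps)
    also have "\<dots> \<le> (LINT x|rplus. haar_state W c A x) + 0"
      using step[OF q, of a d b] step0[OF q, of a d] ab
      by (intro add_left_mono mult_nonneg_nonpos) auto
    finally show ?thesis
      using insert.IH jk by simp
  qed (use insert in \<open>simp add: insert_absorb\<close>)
qed

subsection \<open>Bellman functions for the square function\<close>

text \<open>The power lies above its tangent at \<open>b\<close>. The case \<open>a = 0\<close> is
  computed directly because the tangent argument runs on the open half line.\<close>

lemma powr_convex_at:
  fixes a b r :: real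
  assumes "1 \<le> r" "0 \<le> a" "0 < b"
  shows "b powr r - a powr r \<le> r * (b - a) * b powr (r - 1)"
proof (cases "a = 0")
  case True
  have "b powr r = b * b powr (r - 1)"
    using assms by (simp add: powr_mult_base)
  then show ?thesis
    using assms True by (simp add: mult_right_mono)
next
  case False
  have "((\<lambda>x. x powr r) has_real_derivative r * x powr (r - 1)) (at x within {0<..})" if "0 < x" for x
    using that by (auto intro!: derivative_eq_intros)
  moreover have "convex_on {0<..} (\<lambda>x. x powr r)"
    using assms(1) by (rule powr_convex)
  ultimately show ?thesis
    using convex_on_imp_above_tangent[of "{0<..}" "\<lambda>x. x powr r" b a "r * b powr (r - 1)"]
      assms False
    by (simp add: algebra_simps interior_open)
qed

text \<open>
  The function comes from the continuous analogue: with \<open>L = \<partial>\<^sub>q + \<partial>\<^sub>x\<^sub>x / 2\<close> the term \<open>L (q powr r)\<close>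
  is cancelled by the \<open>\<partial>\<^sub>x\<^sub>x\<close> part of the second term, and what remains is nonpositive.
\<close>

lemma square_function_step_ge_2:
  fixes r x d q :: real
  assumes r: "1 < r" and q: "0 \<le> q"
  defines "U \<equiv> \<lambda>x q. q powr r - r * x\<^sup>2 * q powr (r - 1)"
  shows "U (x + d) (q + d\<^sup>2) + U (x - d) (q + d\<^sup>2) \<le> 2 * U x q"
proof (cases "q + d\<^sup>2 = 0")
  case True
  then have "q = 0" "d = 0"
    using q by (auto simp: add_nonneg_eq_0_iff)
  then show ?thesis by simp
next
  case False
  then have pos: "0 < q + d\<^sup>2"
    using q by (simp add: order_less_le)
  have "(q + d\<^sup>2) powr r - q powr r \<le> r * d\<^sup>2 * (q + d\<^sup>2) powr (r - 1)"
    using powr_convex_at[of r q "q + d\<^sup>2"] r q pos by simp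
  moreover have "r * x\<^sup>2 * q powr (r - 1) \<le> r * x\<^sup>2 * (q + d\<^sup>2) powr (r - 1)"
    using r q by (intro mult_left_mono powr_mono2) auto
  \<comment> \<open>The mixed terms of \<open>(x + d)\<^sup>2\<close> and
    \<open>(x - d)\<^sup>2\<close> cancel, leaving \<open>x\<^sup>2 + d\<^sup>2\<close>; the
    \<open>d\<^sup>2\<close> part pays for the growth of \<open>q powr r\<close>.\<close>
  moreover have "U (x + d) (q + d\<^sup>2) + U (x - d) (q + d\<^sup>2) =
      2 * ((q + d\<^sup>2) powr r - r * d\<^sup>2 * (q + d\<^sup>2) powr (r - 1) - r * x\<^sup>2 * (q + d\<^sup>2) powr (r - 1))"
    by (simp add: U_def power2_eq_square algebra_simps)
  ultimately show ?thesis
    by (simp add: U_def algebra_simps)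
qed

text \<open>After rearranging, \<open>2 * r * x\<^sup>2 * q powr (r - 1)\<close> has to be bounded
  by \<open>q powr r\<close> plus a multiple of \<open>(x\<^sup>2) powr r\<close>. The threshold
  \<open>q = 2 * r * x\<^sup>2\<close> decides which of the two terms suffices.\<close>

lemma square_function_majorant_ge_2:
  fixes r x q :: real
  assumes r: "1 < r" and q: "0 \<le> q"
  shows "q powr r \<le> 2 * (q powr r - r * x\<^sup>2 * q powr (r - 1)) + 2 * r * (2 * r) powr (r - 1) * (x\<^sup>2) powr r"
proof (cases "q \<le> 2 * r * x\<^sup>2")
  case True
  have "q powr (r - 1) \<le> (2 * r) powr (r - 1) * (x\<^sup>2) powr (r - 1)"
    using powr_mono2[of "r - 1" q "2 * r * x\<^sup>2"] True r q by (simp add: powr_mult)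
  then have "2 * r * x\<^sup>2 * q powr (r - 1) \<le> 2 * r * x\<^sup>2 * ((2 * r) powr (r - 1) * (x\<^sup>2) powr (r - 1))"
    using r by (intro mult_left_mono) auto
  also have "x\<^sup>2 * (x\<^sup>2) powr (r - 1) = (x\<^sup>2) powr r"
    by (simp add: powr_mult_base)
  then have "2 * r * x\<^sup>2 * ((2 * r) powr (r - 1) * (x\<^sup>2) powr (r - 1)) = 2 * r * (2 * r) powr (r - 1) * (x\<^sup>2) powr r"
    by simp
  finally have "2 * r * x\<^sup>2 * q powr (r - 1) \<le> 2 * r * (2 * r) powr (r - 1) * (x\<^sup>2) powr r" .
  moreover have "0 \<le> q powr r"
    by simp
  ultimately show ?thesis
    by (simp add: right_diff_distrib mult.assoc)
next
  case False
  have "2 * r * x\<^sup>2 * q powr (r - 1) \<le> q * q powr (r - 1)"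
    using False by (intro mult_right_mono) auto
  also have "\<dots> = q powr r"
    using q by (simp add: powr_mult_base)
  finally have "2 * r * x\<^sup>2 * q powr (r - 1) \<le> q powr r" .
  moreover have "0 \<le> 2 * r * (2 * r) powr (r - 1) * (x\<^sup>2) powr r"
    using r by simp
  ultimately show ?thesis
    by (simp add: algebra_simps)
qed

text \<open>The function \<open>g t = f (x + t) + f (x - t) - m * t\<^sup>2\<close> has derivative 0
  at 0 and a nonnegative second derivative up to \<open>\<bar>d\<bar>\<close>, so it grows from
  \<open>g 0 = 2 * f x\<close>.\<close>

lemma second_difference_lower_bound:
  fixes f f' f'' :: "real \<Rightarrow> real"
  assumes f': "\<And>t. (f has_real_derivative f' t) (at t)"
    and f'': "\<And>t. (f' has_real_derivative f'' t) (at t)"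
    and m: "\<And>t. \<bar>t - x\<bar> \<le> \<bar>d\<bar> \<Longrightarrow> m \<le> f'' t"
  shows "m * d\<^sup>2 \<le> f (x + d) + f (x - d) - 2 * f x"
proof -
  have *: "m * h\<^sup>2 \<le> f (x + h) + f (x - h) - 2 * f x" if h: "0 < h" "h \<le> \<bar>d\<bar>" for h
  proof -
    define g where "g t = f (x + t) + f (x - t) - m * t\<^sup>2" for t
    define g' where "g' t = f' (x + t) - f' (x - t) - 2 * m * t" for t
    have plus: "((\<lambda>t. \<phi> (x + t)) has_real_derivative \<phi>' (x + t)) (at t)"
      and minus: "((\<lambda>t. \<phi> (x - t)) has_real_derivative - \<phi>' (x - t)) (at t)"
      if "\<And>t. (\<phi> has_real_derivative \<phi>' t) (at t)" for \<phi> \<phi>' :: "real \<Rightarrow> real" and t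
    proof -
      have "((\<lambda>t. \<phi> (x + t)) has_real_derivative \<phi>' (x + t) * 1) (at t)"
        by (rule DERIV_chain2[OF that]) (auto intro!: derivative_eq_intros)
      then show "((\<lambda>t. \<phi> (x + t)) has_real_derivative \<phi>' (x + t)) (at t)" by simp
      have "((\<lambda>t. \<phi> (x - t)) has_real_derivative \<phi>' (x - t) * (- 1)) (at t)"
        by (rule DERIV_chain2[OF that]) (auto intro!: derivative_eq_intros)
      then show "((\<lambda>t. \<phi> (x - t)) has_real_derivative - \<phi>' (x - t)) (at t)" by simp
    qed
    have g: "(g has_real_derivative g' t) (at t)" for t
    proof -
      have "(g has_real_derivative f' (x + t) + - f' (x - t) - m * (real 2 * t ^ (2 - Suc 0))) (at t)"
        unfolding g_def
        by (intro DERIV_add DERIV_diff DERIV_cmult plus minus f' DERIV_pow)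
      then show ?thesis
        by (simp add: g'_def algebra_simps)
    qed
    have g2: "(g' has_real_derivative (f'' (x + t) + f'' (x - t) - 2 * m)) (at t)" for t
    proof -
      have "(g' has_real_derivative f'' (x + t) - - f'' (x - t) - (2 * m) * 1) (at t)"
        unfolding g'_def
        by (intro DERIV_diff DERIV_cmult plus minus f'' DERIV_ident)
      then show ?thesis
        by simp
    qed
    have "g' 0 \<le> g' t" if "0 \<le> t" "t \<le> h" for t
    proof (rule DERIV_nonneg_imp_nondecreasing[OF that(1)])
      fix u assume u: "0 \<le> u" "u \<le> t"
      show "\<exists>y. (g' has_real_derivative y) (at u) \<and> 0 \<le> y"
      proof (intro exI conjI)
        show "(g' has_real_derivative (f'' (x + u) + f'' (x - u) - 2 * m)) (at u)"
          by (rule g2)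
        show "0 \<le> f'' (x + u) + f'' (x - u) - 2 * m"
          using m[of "x + u"] m[of "x - u"] u that h by simp
      qed
    qed
    then have "0 \<le> g' t" if "0 \<le> t" "t \<le> h" for t
      using that by (simp add: g'_def)
    then have "g 0 \<le> g h"
      using g h by (intro DERIV_nonneg_imp_nondecreasing[of 0 h g]) (auto intro!: exI[of _ "g' _"])
    then show ?thesis
      by (simp add: g_def algebra_simps)
  qed
  show ?thesis
    using *[of "\<bar>d\<bar>"] by (cases "d = 0"; cases "d < 0") (auto simp: algebra_simps)
qed

text \<open>
  Adding \<open>e > 0\<close> makes \<open>\<bar>x\<bar> powr (2 * r)\<close> twice differentiable at 0; \<open>e\<close> tends to 0 in
  \<open>square_function_step_le_2\<close>.
\<close>

lemma regularized_power_second_difference: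
  fixes r e x d :: real
  assumes r: "1/2 < r" "r \<le> 1" and e: "0 < e"
  defines "v \<equiv> \<lambda>x. (x\<^sup>2 + e) powr r"
  shows "2 * r * (2 * r - 1) * (2 * (x\<^sup>2 + d\<^sup>2) + e) powr (r - 1) * d\<^sup>2 \<le> v (x + d) + v (x - d) - 2 * v x"
proof (rule second_difference_lower_bound)
  define v1 where "v1 t = 2 * r * t * (t\<^sup>2 + e) powr (r - 1)" for t
  define v2 where "v2 t = 2 * r * (t\<^sup>2 + e) powr (r - 1)
    + 2 * r * t * ((r - 1) * (t\<^sup>2 + e) powr (r - 2) * (2 * t))" for t
  have pos: "0 < t\<^sup>2 + e" for t :: real
    using e by (simp add: add_nonneg_pos)
  show "(v has_real_derivative v1 t) (at t)" for t
    unfolding v_def v1_def using pos[of t] by (auto intro!: derivative_eq_intros)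
  show "(v1 has_real_derivative v2 t) (at t)" for t
    unfolding v1_def v2_def using pos[of t] by (auto intro!: derivative_eq_intros)
  fix t assume t: "\<bar>t - x\<bar> \<le> \<bar>d\<bar>"
  \<comment> \<open>The exponent \<open>r - 1\<close> is nonpositive, so an upper bound for
    \<open>t\<^sup>2\<close> on the whole interval yields a lower bound for the second
    derivative.\<close>
  have "t\<^sup>2 \<le> (\<bar>x\<bar> + \<bar>d\<bar>)\<^sup>2"
    using t by (intro abs_le_square_iff[THEN iffD1]) auto
  also have "\<dots> \<le> 2 * (x\<^sup>2 + d\<^sup>2)"
    using sum_squares_bound[of "\<bar>x\<bar>" "\<bar>d\<bar>"] by (simp add: power2_sum)
  finally have "(2 * (x\<^sup>2 + d\<^sup>2) + e) powr (r - 1) \<le> (t\<^sup>2 + e) powr (r - 1)"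
    using r pos[of t] by (intro powr_mono2') auto
  then have "2 * r * (2 * r - 1) * (2 * (x\<^sup>2 + d\<^sup>2) + e) powr (r - 1) \<le> 2 * r * (2 * r - 1) * (t\<^sup>2 + e) powr (r - 1)"
    using r by (intro mult_left_mono) auto
  also have "\<dots> \<le> v2 t"
  proof -
    have E: "(t\<^sup>2 + e) powr (r - 1) = (t\<^sup>2 + e) * (t\<^sup>2 + e) powr (r - 2)"
      using pos[of t] by (simp add: powr_mult_base)
    \<comment> \<open>With \<open>(t\<^sup>2 + e) powr (r - 2)\<close> factored out, the multiples
      of \<open>t\<^sup>2\<close> cancel and only a multiple of \<open>e\<close> remains,
      nonnegative since \<open>r \<le> 1\<close>.\<close>
    have "v2 t - 2 * r * (2 * r - 1) * (t\<^sup>2 + e) powr (r - 1) =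
        4 * r * (1 - r) * e * (t\<^sup>2 + e) powr (r - 2)"
      unfolding v2_def E by (simp add: algebra_simps power2_eq_square)
    moreover have "0 \<le> 4 * r * (1 - r) * e * (t\<^sup>2 + e) powr (r - 2)"
      using r e by simp
    ultimately show ?thesis by linarith
  qed
  finally show "2 * r * (2 * r - 1) * (2 * (x\<^sup>2 + d\<^sup>2) + e) powr (r - 1) \<le> v2 t" .
qed

text \<open>Convexity is used at positive arguments; zero arguments are reached by shifting both by
  \<open>e\<close> and letting \<open>e\<close> tend to 0 from the right.\<close>

lemma powr_convex_midpoint:
  fixes a b p :: real
  assumes p: "1 \<le> p" and ab: "0 \<le> a" "0 \<le> b"
  shows "2 * ((a + b) / 2) powr p \<le> a powr p + b powr p"
proof -
  have "2 * (((a + 0) + (b + 0)) / 2) powr p \<le> (a + 0) powr p + (b + 0) powr p"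
  proof (rule tendsto_le)
  show "((\<lambda>e. 2 * (((a + e) + (b + e)) / 2) powr p) \<longlongrightarrow> 2 * (((a + 0) + (b + 0)) / 2) powr p) (at_right 0)"
    using assms by (intro tendsto_powr' tendsto_intros) (auto simp: eventually_at_filter)
  show "((\<lambda>e. (a + e) powr p + (b + e) powr p) \<longlongrightarrow> (a + 0) powr p + (b + 0) powr p) (at_right 0)"
    using assms by (intro tendsto_powr' tendsto_intros) (auto simp: eventually_at_filter)
  have *: "2 * ((u + w) / 2) powr p \<le> u powr p + w powr p" if "0 < u" "0 < w" for u w :: real
  proof -
    have "((1 - 1/2) *\<^sub>R u + (1/2) *\<^sub>R w) powr p \<le> (1 - 1/2) * u powr p + (1/2) * w powr p"
      using that by (intro convex_onD[OF powr_convex[OF p]]) auto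
    then show ?thesis by (simp add: field_simps)
  qed
  show "\<forall>\<^sub>F e in at_right 0. 2 * (((a + e) + (b + e)) / 2) powr p \<le> (a + e) powr p + (b + e) powr p"
    using eventually_at_right_less[of 0]
    by eventually_elim (rule *; use ab in simp)
  qed simp
  then show ?thesis by simp
qed

text \<open>Midpoint convexity for the exponent \<open>1 / r\<close>, applied to
  \<open>a powr r\<close> and \<open>b powr r\<close>.\<close>

lemma powr_concave_midpoint:
  fixes a b r :: real
  assumes "0 < r" "r \<le> 1" "0 \<le> a" "0 \<le> b"
  shows "a powr r + b powr r \<le> 2 * ((a + b) / 2) powr r"
proof -
  have "2 * ((a powr r + b powr r) / 2) powr (1 / r) \<le> a + b"
    using powr_convex_midpoint[of "1 / r" "a powr r" "b powr r"] assms by (simp add: powr_powr)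
  then have "(((a powr r + b powr r) / 2) powr (1 / r)) powr r \<le> ((a + b) / 2) powr r"
    using assms by (intro powr_mono2) auto
  then show ?thesis
    using assms by (simp add: powr_powr)
qed

text \<open>Concavity averages the first terms to \<open>(w + 2 * d\<^sup>2) powr r\<close>. The
  excess over \<open>w powr r\<close> is absorbed by the second difference of
  \<open>(x\<^sup>2 + e) powr r\<close>; \<open>C\<close> is chosen so that the two estimates match,
  and it blows up as \<open>r\<close> approaches 1/2.\<close>

lemma square_function_step_regularized:
  fixes r e x d q :: real
  assumes r: "1/2 < r" "r \<le> 1" and e: "0 < e" and q: "0 \<le> q"
  defines "C \<equiv> 2 * 2 powr (1 - r) / (r * (2 * r - 1))"
  defines "U \<equiv> \<lambda>x q. (x\<^sup>2 + e + q) powr r - C * (x\<^sup>2 + e) powr r"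
  shows "U (x + d) (q + d\<^sup>2) + U (x - d) (q + d\<^sup>2) \<le> 2 * U x q"
proof -
  define w where "w = x\<^sup>2 + e + q"
  have w: "0 < w"
    using e q by (simp add: w_def add_nonneg_pos add_pos_nonneg)
  have wd: "0 < w + 2 * d\<^sup>2"
    using w by (simp add: add_pos_nonneg)
  have "((x + d)\<^sup>2 + e + (q + d\<^sup>2)) powr r + ((x - d)\<^sup>2 + e + (q + d\<^sup>2)) powr r
      \<le> 2 * ((((x + d)\<^sup>2 + e + (q + d\<^sup>2)) + ((x - d)\<^sup>2 + e + (q + d\<^sup>2))) / 2) powr r"
    using r e q by (intro powr_concave_midpoint) auto
  also have "(((x + d)\<^sup>2 + e + (q + d\<^sup>2)) + ((x - d)\<^sup>2 + e + (q + d\<^sup>2))) / 2 = w + 2 * d\<^sup>2"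
    by (simp add: w_def power2_eq_square algebra_simps)
  finally have 1: "((x + d)\<^sup>2 + e + (q + d\<^sup>2)) powr r + ((x - d)\<^sup>2 + e + (q + d\<^sup>2)) powr r
      \<le> 2 * (w + 2 * d\<^sup>2) powr r" .
  \<comment> \<open>The power is taken at the far end \<open>w + 2 * d\<^sup>2\<close>, which
    dominates half of \<open>2 * (x\<^sup>2 + d\<^sup>2) + e\<close>; \<open>w\<close> alone need
    not.\<close>
  have 2: "(w + 2 * d\<^sup>2) powr r - w powr r \<le> 2 * d\<^sup>2 * (w + 2 * d\<^sup>2) powr (r - 1)"
  proof -
    have "(w + 2 * d\<^sup>2) powr (r - 1) \<le> w powr (r - 1)"
      using r w by (intro powr_mono2') auto
    then have "w * (w + 2 * d\<^sup>2) powr (r - 1) \<le> w powr r"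
      using w by (metis diff_add_cancel add.commute mult_left_mono less_imp_le powr_mult_base)
    moreover have "(w + 2 * d\<^sup>2) powr r = (w + 2 * d\<^sup>2) * (w + 2 * d\<^sup>2) powr (r - 1)"
      using wd by (simp add: powr_mult_base)
    ultimately show ?thesis
      by (simp add: algebra_simps)
  qed
  have 3: "(w + 2 * d\<^sup>2) powr (r - 1) \<le> 2 powr (1 - r) * (2 * (x\<^sup>2 + d\<^sup>2) + e) powr (r - 1)"
  proof -
    have p: "0 < 2 * (x\<^sup>2 + d\<^sup>2) + e"
      using e by (simp add: add_nonneg_pos)
    have "(w + 2 * d\<^sup>2) powr (r - 1) \<le> ((2 * (x\<^sup>2 + d\<^sup>2) + e) / 2) powr (r - 1)"
      using r e q p by (intro powr_mono2') (auto simp: w_def field_simps)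
    also have "\<dots> = 2 powr (1 - r) * (2 * (x\<^sup>2 + d\<^sup>2) + e) powr (r - 1)"
      using p powr_minus[of 2 "r - 1"] by (simp add: powr_divide field_simps)
    finally show ?thesis .
  qed
  define v where "v x = (x\<^sup>2 + e) powr r" for x
  have C0: "0 \<le> C"
    using r by (simp add: C_def)
  have "2 * ((w + 2 * d\<^sup>2) powr r - w powr r) \<le> 2 * (2 * d\<^sup>2 * (2 powr (1 - r) * (2 * (x\<^sup>2 + d\<^sup>2) + e) powr (r - 1)))"
    using 2 mult_left_mono[OF 3, of "2 * d\<^sup>2"] by (simp add: algebra_simps)
  also have "\<dots> = C * (2 * r * (2 * r - 1) * (2 * (x\<^sup>2 + d\<^sup>2) + e) powr (r - 1) * d\<^sup>2)"
    using r by (simp add: C_def field_simps)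
  also have "\<dots> \<le> C * (v (x + d) + v (x - d) - 2 * v x)"
    unfolding v_def using regularized_power_second_difference[OF r e] C0 by (intro mult_left_mono) auto
  finally have "2 * (w + 2 * d\<^sup>2) powr r - 2 * w powr r \<le> C * v (x + d) + C * v (x - d) - 2 * (C * v x)"
    by (simp add: algebra_simps)
  then show ?thesis
    using 1 by (simp add: U_def v_def w_def algebra_simps)
qed

text \<open>\<open>C\<close> does not involve \<open>e\<close>, so the regularised inequality passes
  to the limit; powers with positive exponent are continuous at 0 as well.\<close>

lemma square_function_step_le_2:
  fixes r x d q :: real
  assumes r: "1/2 < r" "r \<le> 1" and q: "0 \<le> q"
  defines "C \<equiv> 2 * 2 powr (1 - r) / (r * (2 * r - 1))"
  defines "U \<equiv> \<lambda>x q. (x\<^sup>2 + q) powr r - C * (x\<^sup>2) powr r"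
  shows "U (x + d) (q + d\<^sup>2) + U (x - d) (q + d\<^sup>2) \<le> 2 * U x q"
proof -
  define Ue where "Ue e x q = (x\<^sup>2 + e + q) powr r - C * (x\<^sup>2 + e) powr r" for e x q :: real
  have lim: "((\<lambda>e. Ue e x q) \<longlongrightarrow> U x q) (at_right 0)" if "0 \<le> q" for x q
  proof -
    have 1: "((\<lambda>e. (a + e) powr r) \<longlongrightarrow> (a + 0) powr r) (at_right 0)" if "0 \<le> a" for a :: real
      using r that
      by (intro tendsto_powr' tendsto_intros) (auto simp: eventually_at_filter)
    have "((\<lambda>e. (x\<^sup>2 + q + e) powr r - C * (x\<^sup>2 + e) powr r)
        \<longlongrightarrow> (x\<^sup>2 + q + 0) powr r - C * (x\<^sup>2 + 0) powr r) (at_right 0)"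
      using that by (intro tendsto_intros 1) auto
    then show ?thesis
      by (simp add: Ue_def U_def add.commute add.left_commute)
  qed
  show ?thesis
  proof (rule tendsto_le)
    show "((\<lambda>e. Ue e (x + d) (q + d\<^sup>2) + Ue e (x - d) (q + d\<^sup>2)) \<longlongrightarrow>
        U (x + d) (q + d\<^sup>2) + U (x - d) (q + d\<^sup>2)) (at_right 0)"
      using q by (intro tendsto_add lim) auto
    show "((\<lambda>e. 2 * Ue e x q) \<longlongrightarrow> 2 * U x q) (at_right 0)"
      using q by (intro tendsto_mult lim tendsto_const) auto
    show "\<forall>\<^sub>F e in at_right 0. Ue e (x + d) (q + d\<^sup>2) + Ue e (x - d) (q + d\<^sup>2) \<le> 2 * Ue e x q"
      unfolding Ue_def C_def using eventually_at_right_less[of 0]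
      by eventually_elim (rule square_function_step_regularized[OF r _ q])
  qed simp
qed

lemma powr_abs_midpoint:
  fixes p x d :: real
  assumes "1 \<le> p"
  shows "2 * \<bar>x\<bar> powr p \<le> \<bar>x + d\<bar> powr p + \<bar>x - d\<bar> powr p"
proof -
  have "\<bar>x\<bar> \<le> (\<bar>x + d\<bar> + \<bar>x - d\<bar>) / 2"
    using abs_triangle_ineq[of "x + d" "x - d"] by simp
  then have "\<bar>x\<bar> powr p \<le> ((\<bar>x + d\<bar> + \<bar>x - d\<bar>) / 2) powr p"
    using assms by (intro powr_mono2) auto
  then show ?thesis
    using powr_convex_midpoint[OF assms, of "\<bar>x + d\<bar>" "\<bar>x - d\<bar>"] by simp
qed

subsection \<open>Orthonormality of the Haar system\<close>

lemma abs_powr_2: "\<bar>x :: real\<bar> powr 2 = x\<^sup>2"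
  by simp

lemma Lp_2_iff: "f \<in> Lp 2 \<longleftrightarrow> f \<in> borel_measurable rplus \<and> integrable rplus (\<lambda>x. (f x)\<^sup>2)"
  unfolding Lp_def abs_powr_2 by simp

lemma Lp_norm_2: "Lp_norm 2 f = sqrt (LINT x|rplus. (f x)\<^sup>2)"
  unfolding Lp_norm_def abs_powr_2 by (simp add: powr_half_sqrt)

lemma abs_mult_le_sum_squares: "\<bar>a * b\<bar> \<le> a\<^sup>2 + (b :: real)\<^sup>2"
  using sum_squares_bound[of a b] sum_squares_bound[of a "- b"] sum_power2_ge_zero[of a b] by auto

lemma integrable_mult_L2:
  assumes "f \<in> Lp 2" "g \<in> Lp 2"
  shows "integrable rplus (\<lambda>x. f x * g x)"
proof (rule Bochner_Integration.integrable_bound)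
  show "integrable rplus (\<lambda>x. (f x)\<^sup>2 + (g x)\<^sup>2)"
    using assms by (simp add: Lp_2_iff)
  show "(\<lambda>x. f x * g x) \<in> borel_measurable rplus"
    using assms by (auto simp: Lp_2_iff)
  show "AE x in rplus. norm (f x * g x) \<le> norm ((f x)\<^sup>2 + (g x)\<^sup>2)"
    using abs_mult_le_sum_squares by simp
qed

lemma Lp_2_scale: "f \<in> Lp 2 \<Longrightarrow> (\<lambda>x. a * f x) \<in> Lp 2"
  by (auto simp: Lp_2_iff power_mult_distrib)

lemma Lp_2_add:
  assumes "f \<in> Lp 2" "g \<in> Lp 2"
  shows "(\<lambda>x. f x + g x) \<in> Lp 2"
  using assms integrable_mult_L2[OF assms] by (auto simp: Lp_2_iff power2_sum mult.assoc)

lemma Lp_2_diff: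
  assumes "f \<in> Lp 2" "g \<in> Lp 2"
  shows "(\<lambda>x. f x - g x) \<in> Lp 2"
  using Lp_2_add[OF assms(1) Lp_2_scale[OF assms(2), of "- 1"]] by simp

lemma Lp_2_sum: "(\<And>a. a \<in> A \<Longrightarrow> f a \<in> Lp 2) \<Longrightarrow> (\<lambda>x. \<Sum>a\<in>A. f a x) \<in> Lp 2"
proof (induction A rule: infinite_finite_induct)
  case (insert a A)
  then show ?case
    by (simp add: Lp_2_add)
qed (simp_all add: Lp_2_iff)

lemma L2_inner_sum_left:
  assumes "\<And>a. a \<in> A \<Longrightarrow> f a \<in> Lp 2" "g \<in> Lp 2"
  shows "L2_inner (\<lambda>x. \<Sum>a\<in>A. c a * f a x) g = (\<Sum>a\<in>A. c a * L2_inner (f a) g)"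
proof -
  have "L2_inner (\<lambda>x. \<Sum>a\<in>A. c a * f a x) g = (LINT x|rplus. (\<Sum>a\<in>A. c a * (f a x * g x)))"
    by (simp add: L2_inner_def sum_distrib_right mult.assoc)
  also have "\<dots> = (\<Sum>a\<in>A. c a * L2_inner (f a) g)"
    using assms by (subst Bochner_Integration.integral_sum)
      (auto simp: L2_inner_def integrable_mult_L2 simp del: integrable_mult_left_iff integrable_mult_right_iff)
  finally show ?thesis .
qed

lemma L2_inner_commute: "L2_inner f g = L2_inner g f"
  by (simp add: L2_inner_def mult.commute)

text \<open>The squared norm of \<open>t * f + g\<close> is a nonnegative quadratic polynomial in
  \<open>t\<close>, which bounds its discriminant.\<close>

lemma Cauchy_Schwarz_L2:
  assumes "f \<in> Lp 2" "g \<in> Lp 2"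
  shows "\<bar>L2_inner f g\<bar> \<le> Lp_norm 2 f * Lp_norm 2 g"
proof -
  define a b c where "a = (LINT x|rplus. (f x)\<^sup>2)" and "b = L2_inner f g"
    and "c = (LINT x|rplus. (g x)\<^sup>2)"
  have "0 \<le> a * t\<^sup>2 + 2 * b * t + c" for t
  proof -
    have "0 \<le> (LINT x|rplus. (t * f x + g x)\<^sup>2)"
      by simp
    also have "\<dots> = (LINT x|rplus. t\<^sup>2 * (f x)\<^sup>2 + (2 * t) * (f x * g x) + (g x)\<^sup>2)"
      by (simp add: power2_eq_square algebra_simps)
    also have "\<dots> = t\<^sup>2 * a + (2 * t) * b + c"
      using assms integrable_mult_L2[OF assms] by (simp add: a_def b_def c_def Lp_2_iff L2_inner_def)
    finally show ?thesis
      by (simp add: algebra_simps)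
  qed
  note quad = this
  have ac: "0 \<le> a" "0 \<le> c"
    by (simp_all add: a_def c_def)
  have "b\<^sup>2 \<le> a * c"
  proof (cases "a = 0")
    case True
    have "b = 0"
    proof (rule ccontr)
      assume "b \<noteq> 0"
      then show False
        \<comment> \<open>For \<open>a = 0\<close> the polynomial is affine, and at this point it
          equals -1.\<close>
        using quad[of "- (c + 1) / (2 * b)"] True by simp
    qed
    then show ?thesis
      using ac by simp
  next
    case False
    then have "0 \<le> a * (a * (- b / a)\<^sup>2 + 2 * b * (- b / a) + c)"
      using quad[of "- b / a"] ac by (intro mult_nonneg_nonneg) auto
    also have "\<dots> = a * c - b\<^sup>2"
      using False by (simp add: field_simps power2_eq_square)
    finally show ?thesis by simp
  qed
  then have "sqrt (b\<^sup>2) \<le> sqrt (a * c)"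
    by (rule real_sqrt_le_mono)
  then show ?thesis
    by (simp add: Lp_norm_2 real_sqrt_mult a_def b_def c_def)
qed

text \<open>Both \<open>x\<^sup>2 - q\<close> and \<open>q - x\<^sup>2\<close> satisfy the jump
  conditions, with equality, so the squared sum and the sum of squares have the same integral. The
  latter is evaluated term by term.\<close>

lemma haar_sum_square_integral:
  assumes "finite A"
  shows "(LINT x|rplus. (haar_sum c A x)\<^sup>2) = (\<Sum>(j, k)\<in>A. (c j k)\<^sup>2)"
    and "integrable rplus (\<lambda>x. (haar_sum c A x)\<^sup>2)"
proof -
  let ?W = "\<lambda>x y q :: real. x\<^sup>2 - q" and ?W' = "\<lambda>x y q :: real. q - x\<^sup>2"
  have le: "(LINT x|rplus. haar_state ?W c A x) \<le> 0"
    using assms by (rule haar_state_integral_nonpos) (auto simp: power2_eq_square algebra_simps)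
  have ge: "(LINT x|rplus. haar_state ?W' c A x) \<le> 0"
    using assms by (rule haar_state_integral_nonpos) (auto simp: power2_eq_square algebra_simps)
  show int: "integrable rplus (\<lambda>x. (haar_sum c A x)\<^sup>2)"
    using haar_state_integrable[OF assms, of "\<lambda>x y q. x\<^sup>2" c] by (simp add: haar_state_def[abs_def])
  have sq: "has_bochner_integral rplus (haar_square_sum c A) (\<Sum>(j, k)\<in>A. (c j k)\<^sup>2)"
  proof -
    have "(c j k * haar j k x)\<^sup>2 = ((c j k)\<^sup>2 * 2 powi j) * indicator (dyadic_interval j k) x" for j k x
      by (simp add: power_mult_distrib haar_square dyadic_interval_iff indicator_def)
    moreover have "has_bochner_integral rplus
        (\<lambda>x. ((c j k)\<^sup>2 * 2 powi j) * indicator (dyadic_interval j k) x) ((c j k)\<^sup>2)" for j k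
      using has_bochner_integral_mult_right[OF has_integral_dyadic_indicator[of j k], of "(c j k)\<^sup>2 * 2 powi j"]
      by (simp add: power_int_minus field_simps)
    ultimately have "has_bochner_integral rplus (\<lambda>x. (c j k * haar j k x)\<^sup>2) ((c j k)\<^sup>2)" for j k
      by (simp only:)
    then show ?thesis
      unfolding haar_square_sum_def[abs_def] case_prod_beta
      by (intro has_bochner_integral_sum) simp
  qed
  show "(LINT x|rplus. (haar_sum c A x)\<^sup>2) = (\<Sum>(j, k)\<in>A. (c j k)\<^sup>2)"
    using le ge int sq
    by (simp add: haar_state_def has_bochner_integral_iff)
qed

lemma haar_in_L2 [simp]: "haar j k \<in> Lp 2"
  using haar_sum_square_integral(2)[of "{(j, k)}" "\<lambda>_ _. 1"]
  by (simp add: Lp_2_iff haar_sum_def borel_measurable_lebesgue_on)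

lemma haar_sum_in_L2: "haar_sum c A \<in> Lp 2"
  unfolding haar_sum_def[abs_def] case_prod_beta by (intro Lp_2_sum Lp_2_scale haar_in_L2)

text \<open>Polarisation: the norms of single Haar functions and of the sum of two distinct ones are
  known from \<open>haar_sum_square_integral\<close>.\<close>

lemma haar_orthonormal: "L2_inner (haar j k) (haar i l) = (if j = i \<and> k = l then 1 else 0)"
proof (cases "(j, k) = (i, l)")
  case True
  then show ?thesis
    using haar_sum_square_integral(1)[of "{(j, k)}" "\<lambda>_ _. 1"]
    by (simp add: haar_sum_def L2_inner_def power2_eq_square)
next
  case False
  have one: "(LINT x|rplus. (haar a b x)\<^sup>2) = 1" for a b
    using haar_sum_square_integral(1)[of "{(a, b)}" "\<lambda>_ _. 1"] by (simp add: haar_sum_def)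
  have "2 = (LINT x|rplus. (haar j k x + haar i l x)\<^sup>2)"
    using haar_sum_square_integral(1)[of "{(j, k), (i, l)}" "\<lambda>_ _. 1"] False
    by (simp add: haar_sum_def)
  also have "\<dots> = (LINT x|rplus. (haar j k x)\<^sup>2 + (haar i l x)\<^sup>2 + 2 * (haar j k x * haar i l x))"
    by (simp add: power2_sum mult.assoc)
  also have "\<dots> = 1 + 1 + 2 * L2_inner (haar j k) (haar i l)"
    using integrable_mult_L2[of "haar j k" "haar i l"] haar_in_L2[of j k] haar_in_L2[of i l]
    by (simp add: one L2_inner_def Lp_2_iff)
  finally show ?thesis
    using False by simp
qed

lemma L2_inner_haar_sum:
  assumes "finite A"
  shows "L2_inner (haar_sum c A) (haar j k) = (if (j, k) \<in> A then c j k else 0)"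
proof -
  have "L2_inner (haar_sum c A) (haar j k) = (\<Sum>a\<in>A. c (fst a) (snd a) * L2_inner (haar (fst a) (snd a)) (haar j k))"
    unfolding haar_sum_def[abs_def]
    using L2_inner_sum_left[of A "\<lambda>a. haar (fst a) (snd a)" "haar j k" "\<lambda>a. c (fst a) (snd a)"]
    by (simp add: case_prod_beta)
  also have "\<dots> = (\<Sum>a\<in>A. if a = (j, k) then c j k else 0)"
    by (intro sum.cong) (auto simp: haar_orthonormal prod_eq_iff)
  finally show ?thesis
    using assms by simp
qed

lemma Bessel_inequality:
  assumes "finite A" "g \<in> Lp 2"
  shows "(\<Sum>(j, k)\<in>A. (L2_inner g (haar j k))\<^sup>2) \<le> (LINT x|rplus. (g x)\<^sup>2)"
proof -
  define c where "c = (\<lambda>j k. L2_inner g (haar j k))"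
  let ?s = "\<Sum>(j, k)\<in>A. (c j k)\<^sup>2"
  have "L2_inner (haar_sum c A) g = ?s"
    unfolding haar_sum_def[abs_def]
    using L2_inner_sum_left[of A "\<lambda>a. haar (fst a) (snd a)" g "\<lambda>a. c (fst a) (snd a)"] assms(2)
    by (simp add: case_prod_beta L2_inner_commute[of "haar _ _" g] c_def power2_eq_square)
  moreover have "0 \<le> (LINT x|rplus. (g x - haar_sum c A x)\<^sup>2)"
    by simp
  moreover have "(LINT x|rplus. (g x - haar_sum c A x)\<^sup>2) =
      (LINT x|rplus. (g x)\<^sup>2 + (haar_sum c A x)\<^sup>2 - 2 * (haar_sum c A x * g x))"
    by (simp add: power2_diff algebra_simps)
  moreover have "\<dots> = (LINT x|rplus. (g x)\<^sup>2) + ?s - 2 * L2_inner (haar_sum c A) g"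
    using assms integrable_mult_L2[OF haar_sum_in_L2 assms(2), of c A] haar_sum_square_integral[OF assms(1), of c]
    by (simp add: L2_inner_def Lp_2_iff)
  ultimately have "?s \<le> (LINT x|rplus. (g x)\<^sup>2)"
    by linarith
  then show ?thesis
    by (simp add: c_def)
qed

subsection \<open>The gradient inequality\<close>

text \<open>For this \<open>W\<close> a jump outside row 0 moves only the first argument, where
  convexity of the power applies; in row 0 both arguments stay equal and \<open>W\<close> stays
  0.\<close>

lemma haar_row0_Lp_bound:
  assumes "finite A" "1 \<le> p"
  shows "(LINT x|rplus. \<bar>haar_row c A 0 x\<bar> powr p) \<le> (LINT x|rplus. \<bar>haar_sum c A x\<bar> powr p)"
proof -
  have "(LINT x|rplus. haar_state (\<lambda>x y q. \<bar>y\<bar> powr p - \<bar>x\<bar> powr p) c A x) \<le> 0"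
  proof (rule haar_state_integral_nonpos[OF assms(1)])
    fix x y q d :: real
    show "\<bar>y\<bar> powr p - \<bar>x + d\<bar> powr p + (\<bar>y\<bar> powr p - \<bar>x - d\<bar> powr p)
        \<le> 2 * (\<bar>y\<bar> powr p - \<bar>x\<bar> powr p)"
      using powr_abs_midpoint[OF assms(2), of x d] by simp
  qed auto
  moreover have "integrable rplus (\<lambda>x. \<bar>haar_sum c A x\<bar> powr p)"
    using haar_state_integrable[OF assms(1), of "\<lambda>x y q. \<bar>x\<bar> powr p" c]
    by (simp add: haar_state_def[abs_def])
  moreover have "integrable rplus (\<lambda>x. \<bar>haar_row c A 0 x\<bar> powr p)"
    using haar_state_integrable[OF assms(1), of "\<lambda>x y q. \<bar>y\<bar> powr p" c]
    by (simp add: haar_state_def[abs_def])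
  ultimately show ?thesis
    by (simp add: haar_state_def)
qed

lemma square_powr_half: "(x\<^sup>2) powr (p / 2) = \<bar>x :: real\<bar> powr p"
proof -
  have "(x\<^sup>2) powr (p / 2) = (\<bar>x\<bar> powr 2) powr (p / 2)"
    by simp
  then show ?thesis
    by (simp only: powr_powr) simp
qed

lemma haar_square_sum_nonneg: "0 \<le> haar_square_sum c A x"
  by (auto simp: haar_square_sum_def intro!: sum_nonneg)

lemma haar_square_function_Lp_bound:
  assumes "1 < p"
  shows "\<exists>C\<ge>0. \<forall>c A. finite A \<longrightarrow>
    (LINT x|rplus. haar_square_sum c A x powr (p / 2)) \<le> C * (LINT x|rplus. \<bar>haar_sum c A x\<bar> powr p)"
proof -
  define r where "r = p / 2"
  \<comment> \<open>The scheme common to both ranges of \<open>p\<close>: the jump inequality makes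
    the integral of \<open>W\<close> nonpositive, and the majorisation turns this into the estimate.
    The row 0 argument does not enter \<open>W\<close>.\<close>
  have *: "(LINT x|rplus. haar_square_sum c A x powr r) \<le> C * (LINT x|rplus. \<bar>haar_sum c A x\<bar> powr p)"
    if A: "finite A" and W0: "W 0 0 = 0"
      and step: "\<And>x q d. 0 \<le> q \<Longrightarrow> W (x + d) (q + d\<^sup>2) + W (x - d) (q + d\<^sup>2) \<le> 2 * W x q"
      and maj: "\<And>x q. 0 \<le> q \<Longrightarrow> q powr r \<le> W x q + C * (x\<^sup>2) powr r"
    for c A W and C :: real
  proof -
    have int: "integrable rplus (\<lambda>x. \<bar>haar_sum c A x\<bar> powr p)"
        "integrable rplus (\<lambda>x. haar_square_sum c A x powr r)"
      using haar_state_integrable[OF A, of "\<lambda>x y q. \<bar>x\<bar> powr p" c]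
        haar_state_integrable[OF A, of "\<lambda>x y q. q powr r" c]
      by (simp_all add: haar_state_def[abs_def])
    have W: "integrable rplus (haar_state (\<lambda>x y. W x) c A)"
        "(LINT x|rplus. haar_state (\<lambda>x y. W x) c A x) \<le> 0"
      using A W0 step by (auto intro!: haar_state_integrable haar_state_integral_nonpos)
    have "(LINT x|rplus. haar_square_sum c A x powr r)
        \<le> (LINT x|rplus. haar_state (\<lambda>x y. W x) c A x + C * \<bar>haar_sum c A x\<bar> powr p)"
    proof (rule integral_mono)
      fix x
      show "haar_square_sum c A x powr r
          \<le> haar_state (\<lambda>x y. W x) c A x + C * \<bar>haar_sum c A x\<bar> powr p"
        using maj[OF haar_square_sum_nonneg, of c A x "haar_sum c A x"]
        by (simp add: haar_state_def r_def square_powr_half)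
    qed (use int W in auto)
    also have "\<dots> \<le> C * (LINT x|rplus. \<bar>haar_sum c A x\<bar> powr p)"
      using int W by simp
    finally show ?thesis .
  qed
  show ?thesis
  proof (cases "p \<le> 2")
    case True
    then have r: "1/2 < r" "r \<le> 1"
      using assms by (auto simp: r_def)
    define C where "C = 2 * 2 powr (1 - r) / (r * (2 * r - 1))"
    have "0 \<le> C"
      using r by (simp add: C_def)
    moreover have "(LINT x|rplus. haar_square_sum c A x powr r) \<le> C * (LINT x|rplus. \<bar>haar_sum c A x\<bar> powr p)"
      if "finite A" for c A
    proof (rule *[OF that, where W = "\<lambda>x q. (x\<^sup>2 + q) powr r - C * (x\<^sup>2) powr r"])
      fix x q :: real assume q: "0 \<le> q"
      show "((x + d)\<^sup>2 + (q + d\<^sup>2)) powr r - C * ((x + d)\<^sup>2) powr r +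
          (((x - d)\<^sup>2 + (q + d\<^sup>2)) powr r - C * ((x - d)\<^sup>2) powr r)
          \<le> 2 * ((x\<^sup>2 + q) powr r - C * (x\<^sup>2) powr r)" for d
        unfolding C_def by (rule square_function_step_le_2[OF r q])
      have "q powr r \<le> (x\<^sup>2 + q) powr r"
        using r q by (intro powr_mono2) auto
      then show "q powr r \<le> (x\<^sup>2 + q) powr r - C * (x\<^sup>2) powr r + C * (x\<^sup>2) powr r"
        by simp
    qed simp
    ultimately show ?thesis
      unfolding r_def by blast
  next
    case False
    then have r: "1 < r"
      by (simp add: r_def)
    define C where "C = 2 * r * (2 * r) powr (r - 1)"
    have "0 \<le> C"
      using r by (simp add: C_def)
    moreover have "(LINT x|rplus. haar_square_sum c A x powr r) \<le> C * (LINT x|rplus. \<bar>haar_sum c A x\<bar> powr p)"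
      if "finite A" for c A
    proof (rule *[OF that, where W = "\<lambda>x q. 2 * (q powr r - r * x\<^sup>2 * q powr (r - 1))"])
      fix x q :: real assume q: "0 \<le> q"
      show "2 * ((q + d\<^sup>2) powr r - r * (x + d)\<^sup>2 * (q + d\<^sup>2) powr (r - 1)) +
          2 * ((q + d\<^sup>2) powr r - r * (x - d)\<^sup>2 * (q + d\<^sup>2) powr (r - 1))
          \<le> 2 * (2 * (q powr r - r * x\<^sup>2 * q powr (r - 1)))" for d
        using mult_left_mono[OF square_function_step_ge_2[OF r q, where x = x and d = d], of 2]
        by (simp only: distrib_left)
      show "q powr r \<le> 2 * (q powr r - r * x\<^sup>2 * q powr (r - 1)) + C * (x\<^sup>2) powr r"
        unfolding C_def by (rule square_function_majorant_ge_2[OF r q])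
    qed simp
    ultimately show ?thesis
      unfolding r_def by blast
  qed
qed

lemma square_sum_at_most_one:
  fixes g :: "'a \<Rightarrow> real"
  assumes "finite A" and "\<And>a b. a \<in> A \<Longrightarrow> b \<in> A \<Longrightarrow> g a \<noteq> 0 \<Longrightarrow> g b \<noteq> 0 \<Longrightarrow> a = b"
  shows "(\<Sum>a\<in>A. g a)\<^sup>2 = (\<Sum>a\<in>A. (g a)\<^sup>2)"
proof (cases "\<exists>a\<in>A. g a \<noteq> 0")
  case True
  then obtain a where a: "a \<in> A" "g a \<noteq> 0" by blast
  then have "g b = 0" if "b \<in> A - {a}" for b
    using assms(2) that by blast
  then show ?thesis
    using a assms(1) by (simp add: sum.remove)
qed simp

text \<open>Row 0 is excluded because its intervals are nested at 0. In any other row at most one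
  term is nonzero at a given point, so there are no cross terms.\<close>

lemma haar_row_square:
  assumes "finite A" "i \<noteq> 0"
  shows "(haar_row c A i x)\<^sup>2 = (\<Sum>(j, k)\<in>A. if k = i then (c j k * haar j k x)\<^sup>2 else 0)"
proof -
  have "(haar_row c A i x)\<^sup>2 = (\<Sum>a\<in>A. (if snd a = i then c (fst a) (snd a) * haar (fst a) (snd a) x else 0)\<^sup>2)"
    unfolding haar_row_def case_prod_beta
  proof (rule square_sum_at_most_one[OF assms(1)])
    fix a b
    assume "(if snd a = i then c (fst a) (snd a) * haar (fst a) (snd a) x else 0) \<noteq> 0"
      "(if snd b = i then c (fst b) (snd b) * haar (fst b) (snd b) x else 0) \<noteq> 0"
    then have "snd a = i" "snd b = i" "dyadic_index (fst a) x = int i" "dyadic_index (fst b) x = int i"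
      using haar_eq_0 by (auto split: if_splits)
    then show "a = b"
      using dyadic_index_unique_scale[of "fst a" x "int i" "fst b"] assms(2) by (simp add: prod_eq_iff)
  qed
  then show ?thesis
    by (simp add: case_prod_beta if_distrib[of "\<lambda>x. x\<^sup>2"] cong: if_cong)
qed

lemma haar_rows_l2:
  assumes "finite A"
  shows "(\<lambda>i. haar_row c A i x) \<in> l2"
    and "(l2_norm (\<lambda>i. haar_row c A i x))\<^sup>2 = (\<Sum>i\<in>snd ` A. (haar_row c A i x)\<^sup>2)"
    and "(l2_norm (\<lambda>i. haar_row c A i x))\<^sup>2 \<le> (haar_row c A 0 x)\<^sup>2 + haar_square_sum c A x"
proof -
  have z: "haar_row c A i x = 0" if "i \<notin> snd ` A" for i
    using that unfolding haar_row_def by (intro sum.neutral) force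
  have sums: "(\<lambda>i. (haar_row c A i x)\<^sup>2) sums (\<Sum>i\<in>snd ` A. (haar_row c A i x)\<^sup>2)"
    using assms z by (intro sums_finite) auto
  then show "(\<lambda>i. haar_row c A i x) \<in> l2"
    by (auto simp: l2_def sums_iff)
  show eq: "(l2_norm (\<lambda>i. haar_row c A i x))\<^sup>2 = (\<Sum>i\<in>snd ` A. (haar_row c A i x)\<^sup>2)"
    using sums by (simp add: l2_norm_def sums_iff sum_nonneg)
  have "(\<Sum>i\<in>snd ` A. (haar_row c A i x)\<^sup>2)
      \<le> (\<Sum>i\<in>insert 0 (snd ` A). (haar_row c A i x)\<^sup>2)"
    using assms by (intro sum_mono2) auto
  also have "\<dots> = (haar_row c A 0 x)\<^sup>2 + (\<Sum>i\<in>snd ` A - {0}. (haar_row c A i x)\<^sup>2)"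
    using assms by (simp add: sum.insert_remove)
  \<comment> \<open>Interchanging the sums shows that each pair of \<open>A\<close> is counted in at
    most one row.\<close>
  also have "(\<Sum>i\<in>snd ` A - {0}. (haar_row c A i x)\<^sup>2) =
      (\<Sum>a\<in>A. \<Sum>i\<in>snd ` A - {0}. if snd a = i then (c (fst a) (snd a) * haar (fst a) (snd a) x)\<^sup>2 else 0)"
    using assms by (subst sum.swap) (simp add: haar_row_square case_prod_beta)
  also have "\<dots> \<le> haar_square_sum c A x"
    unfolding haar_square_sum_def case_prod_beta
    using assms by (intro sum_mono) (simp add: sum.delta')
  finally show "(l2_norm (\<lambda>i. haar_row c A i x))\<^sup>2 \<le> (haar_row c A 0 x)\<^sup>2 + haar_square_sum c A x"
    unfolding eq by simp
qed

section \<open>The differential operators on finite Haar sums\<close>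

lemma haar_span_iff: "u \<in> haar_span \<longleftrightarrow> (\<exists>c A. finite A \<and> u = haar_sum c A)"
  by (auto simp: haar_span_def haar_sum_def[abs_def])

text \<open>By orthonormality the coefficients outside \<open>A\<close> vanish, so the infinite sum
  is finite; the length \<open>2 powi (- j)\<close> to the power \<open>- s\<close> is the
  multiplier \<open>2 powr (s * j)\<close>.\<close>

lemma dyadic_frac_laplacian_haar_sum:
  assumes "finite A"
  shows "dyadic_frac_laplacian s (haar_sum c A) = haar_sum (\<lambda>j k. 2 powr (s * of_int j) * c j k) A"
proof
  fix x
  have "dyadic_frac_laplacian s (haar_sum c A) x =
      (\<Sum>\<^sub>\<infinity>(j, k)\<in>A. 2 powr (s * of_int j) * c j k * haar j k x)"
    unfolding dyadic_frac_laplacian_def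
  proof (rule infsum_cong_neutral)
    fix a assume "a \<in> UNIV \<inter> A"
    moreover have "(2 powi (- j)) powr (- s) = (2::real) powr (s * of_int j)" for j
      by (simp add: powr_real_of_int'[symmetric] powr_powr mult.commute)
    ultimately show "(case a of (j, k) \<Rightarrow> measure lebesgue (dyadic_interval j k) powr - s
        * L2_inner (haar_sum c A) (haar j k) * haar j k x)
      = (case a of (j, k) \<Rightarrow> 2 powr (s * of_int j) * c j k * haar j k x)"
      by (cases a) (auto simp: L2_inner_haar_sum[OF assms] measure_dyadic_interval)
  qed (auto simp: L2_inner_haar_sum[OF assms])
  then show "dyadic_frac_laplacian s (haar_sum c A) x = haar_sum (\<lambda>j k. 2 powr (s * of_int j) * c j k) A x"
    using assms by (simp add: haar_sum_def)
qed

lemma dyadic_gradient_haar_sum: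
  assumes "finite A"
  shows "dyadic_gradient s (haar_sum c A) x = (\<lambda>i. haar_row (\<lambda>j k. 2 powr (s * of_int j) * c j k) A i x)"
proof
  fix i
  define B where "B = {j. (j, i) \<in> A}"
  have B: "finite B"
    using assms finite_surj[of A B fst] by (force simp: B_def)
  have "dyadic_partial s i (haar_sum c A) x = (\<Sum>\<^sub>\<infinity>j\<in>B. 2 powr (s * of_int j) * c j i * haar j i x)"
    unfolding dyadic_partial_def
    by (rule infsum_cong_neutral) (auto simp: L2_inner_haar_sum[OF assms] B_def)
  also have "\<dots> = (\<Sum>j\<in>B. 2 powr (s * of_int j) * c j i * haar j i x)"
    using B by simp
  also have "\<dots> = (\<Sum>a\<in>{a \<in> A. snd a = i}. 2 powr (s * of_int (fst a)) * c (fst a) (snd a) * haar (fst a) (snd a) x)"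
    by (rule sum.reindex_bij_witness[where i = fst and j = "\<lambda>j. (j, i)"]) (auto simp: B_def)
  also have "\<dots> = haar_row (\<lambda>j k. 2 powr (s * of_int j) * c j k) A i x"
    using assms by (auto simp: haar_row_def case_prod_beta sum.inter_filter intro!: sum.cong)
  finally show "dyadic_gradient s (haar_sum c A) x i = haar_row (\<lambda>j k. 2 powr (s * of_int j) * c j k) A i x"
    by (simp add: dyadic_gradient_def)
qed

lemma powr_sum_le:
  fixes a b r :: real
  assumes "0 \<le> a" "0 \<le> b" "0 \<le> r"
  shows "(a + b) powr r \<le> 2 powr r * (a powr r + b powr r)"
proof -
  have "(a + b) powr r \<le> (2 * max a b) powr r"
    using assms by (intro powr_mono2) auto
  also have "\<dots> = 2 powr r * max a b powr r"
    using assms by (simp add: powr_mult)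
  also have "\<dots> \<le> 2 powr r * (a powr r + b powr r)"
    by (intro mult_left_mono) (auto simp: max_def)
  finally show ?thesis .
qed

lemma haar_rows_Lp_bound:
  assumes "1 < p"
  shows "\<exists>C. \<forall>c A. finite A \<longrightarrow> (\<lambda>x i. haar_row c A i x) \<in> Lp_l2 p \<and>
    Lp_l2_norm p (\<lambda>x i. haar_row c A i x) \<le> C * Lp_norm p (haar_sum c A)"
proof -
  obtain C where C: "0 \<le> C" and sq: "\<And>c A. finite A \<Longrightarrow>
    (LINT x|rplus. haar_square_sum c A x powr (p / 2)) \<le> C * (LINT x|rplus. \<bar>haar_sum c A x\<bar> powr p)"
    using haar_square_function_Lp_bound[OF assms] by blast
  \<comment> \<open>\<open>2 powr (p / 2)\<close> comes from splitting the power of a sum, 1 from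
    row 0 and \<open>C\<close> from the square function.\<close>
  define D where "D = 2 powr (p / 2) * (1 + C)"
  have "(\<lambda>x i. haar_row c A i x) \<in> Lp_l2 p \<and>
      Lp_l2_norm p (\<lambda>x i. haar_row c A i x) \<le> D powr (1 / p) * Lp_norm p (haar_sum c A)"
    if A: "finite A" for c A
  proof
    define N where "N x = l2_norm (\<lambda>i. haar_row c A i x)" for x
    define R where "R x = 2 powr (p / 2) * (\<bar>haar_row c A 0 x\<bar> powr p + haar_square_sum c A x powr (p / 2))" for x
    have int: "integrable rplus (\<lambda>x. \<bar>haar_row c A 0 x\<bar> powr p)"
        "integrable rplus (\<lambda>x. haar_square_sum c A x powr (p / 2))"
      using haar_state_integrable[OF A, of "\<lambda>x y q. \<bar>y\<bar> powr p" c]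
        haar_state_integrable[OF A, of "\<lambda>x y q. q powr (p / 2)" c]
      by (simp_all add: haar_state_def[abs_def])
    have meas_row: "haar_row c A i \<in> borel_measurable borel" for i
      unfolding haar_row_def[abs_def] by (intro borel_measurable_sum) (auto simp: case_prod_beta)
    have N_eq: "N x = sqrt (\<Sum>i\<in>snd ` A. (haar_row c A i x)\<^sup>2)" for x
    proof -
      have "N x = sqrt ((N x)\<^sup>2)"
        using haar_rows_l2(1)[OF A, of c x]
        by (simp add: N_def l2_norm_def l2_def suminf_nonneg)
      then show ?thesis
        unfolding N_def haar_rows_l2(2)[OF A] .
    qed
    have meas: "N \<in> borel_measurable borel"
      unfolding N_eq[abs_def] using meas_row by measurable
    have le: "\<bar>N x\<bar> powr p \<le> R x" for x
    proof -
      have "\<bar>N x\<bar> powr p = ((N x)\<^sup>2) powr (p / 2)"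
        by (simp add: square_powr_half)
      also have "\<dots> \<le> ((haar_row c A 0 x)\<^sup>2 + haar_square_sum c A x) powr (p / 2)"
        using assms haar_rows_l2(3)[OF A, of c x] by (intro powr_mono2) (auto simp: N_def)
      also have "\<dots> \<le> R x"
        using assms powr_sum_le[of "(haar_row c A 0 x)\<^sup>2" "haar_square_sum c A x" "p / 2"]
        by (simp add: R_def square_powr_half haar_square_sum_nonneg)
      finally show ?thesis .
    qed
    have intR: "integrable rplus R"
      unfolding R_def[abs_def] using int by simp
    have "R x \<ge> 0" for x
      by (simp add: R_def)
    then have intN: "integrable rplus (\<lambda>x. \<bar>N x\<bar> powr p)"
      using le meas by (intro Bochner_Integration.integrable_bound[OF intR] borel_measurable_lebesgue_on) auto
    show "(\<lambda>x i. haar_row c A i x) \<in> Lp_l2 p"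
      using haar_rows_l2(1)[OF A] meas_row intN borel_measurable_lebesgue_on[OF meas]
      by (auto simp: Lp_l2_def Lp_def N_def[abs_def] borel_measurable_lebesgue_on)
    have "(LINT x|rplus. \<bar>N x\<bar> powr p) \<le> (LINT x|rplus. R x)"
      using intN intR le by (rule integral_mono)
    also have "\<dots> = 2 powr (p / 2) * ((LINT x|rplus. \<bar>haar_row c A 0 x\<bar> powr p)
        + (LINT x|rplus. haar_square_sum c A x powr (p / 2)))"
      using int by (simp add: R_def)
    also have "\<dots> \<le> 2 powr (p / 2) * ((LINT x|rplus. \<bar>haar_sum c A x\<bar> powr p)
        + C * (LINT x|rplus. \<bar>haar_sum c A x\<bar> powr p))"
      using sq[OF A, of c] haar_row0_Lp_bound[OF A, of p c] assms by (intro mult_left_mono add_mono) auto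
    also have "\<dots> = D * (LINT x|rplus. \<bar>haar_sum c A x\<bar> powr p)"
      by (simp add: D_def algebra_simps)
    finally have "(LINT x|rplus. \<bar>N x\<bar> powr p) powr (1 / p)
        \<le> (D * (LINT x|rplus. \<bar>haar_sum c A x\<bar> powr p)) powr (1 / p)"
      using assms by (intro powr_mono2) auto
    also have "\<dots> = D powr (1 / p) * Lp_norm p (haar_sum c A)"
      using C by (simp add: D_def Lp_norm_def powr_mult)
    finally show "Lp_l2_norm p (\<lambda>x i. haar_row c A i x) \<le> D powr (1 / p) * Lp_norm p (haar_sum c A)"
      by (simp add: Lp_l2_norm_def Lp_norm_def N_def)
  qed
  then show ?thesis by blast
qed

lemma dyadic_gradient_Lp_bound:
  assumes "1 < p"
  shows "\<exists>C. \<forall>u\<in>haar_span. dyadic_gradient s u \<in> Lp_l2 p \<and>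
    Lp_l2_norm p (dyadic_gradient s u) \<le> C * Lp_norm p (dyadic_frac_laplacian s u)"
proof -
  obtain C where C: "\<forall>c A. finite A \<longrightarrow> (\<lambda>x i. haar_row c A i x) \<in> Lp_l2 p \<and>
    Lp_l2_norm p (\<lambda>x i. haar_row c A i x) \<le> C * Lp_norm p (haar_sum c A)"
    using haar_rows_Lp_bound[OF assms] by blast
  have "dyadic_gradient s u \<in> Lp_l2 p \<and>
      Lp_l2_norm p (dyadic_gradient s u) \<le> C * Lp_norm p (dyadic_frac_laplacian s u)"
    if "u \<in> haar_span" for u
  proof -
    obtain c A where A: "finite A" and u: "u = haar_sum c A"
      using \<open>u \<in> haar_span\<close> by (auto simp: haar_span_iff)
    show ?thesis
      unfolding u dyadic_frac_laplacian_haar_sum[OF A] dyadic_gradient_haar_sum[OF A, abs_def]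
      using C A by simp
  qed
  then show ?thesis by blast
qed

subsection \<open>Convergence of the row series\<close>

lemma Lp_norm_2_nonneg: "0 \<le> Lp_norm 2 f"
  by (simp add: Lp_norm_2)

lemma Lp_norm_2_square: "(Lp_norm 2 f)\<^sup>2 = (LINT x|rplus. (f x)\<^sup>2)"
  by (simp add: Lp_norm_2)

lemma Lp_norm_2_triangle:
  assumes "f \<in> Lp 2" "g \<in> Lp 2"
  shows "Lp_norm 2 (\<lambda>x. f x + g x) \<le> Lp_norm 2 f + Lp_norm 2 g"
proof (rule power2_le_imp_le)
  have "(Lp_norm 2 (\<lambda>x. f x + g x))\<^sup>2 = (LINT x|rplus. (f x)\<^sup>2 + (g x)\<^sup>2 + 2 * (f x * g x))"
    by (simp add: Lp_norm_2_square power2_sum mult.assoc)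
  also have "\<dots> = (Lp_norm 2 f)\<^sup>2 + (Lp_norm 2 g)\<^sup>2 + 2 * L2_inner f g"
    using assms integrable_mult_L2[OF assms] by (simp add: Lp_2_iff Lp_norm_2_square L2_inner_def)
  also have "\<dots> \<le> (Lp_norm 2 f)\<^sup>2 + (Lp_norm 2 g)\<^sup>2 + 2 * (Lp_norm 2 f * Lp_norm 2 g)"
    using Cauchy_Schwarz_L2[OF assms] by simp
  finally show "(Lp_norm 2 (\<lambda>x. f x + g x))\<^sup>2 \<le> (Lp_norm 2 f + Lp_norm 2 g)\<^sup>2"
    by (simp add: power2_sum)
qed (simp add: Lp_norm_2_nonneg)

lemma Lp_norm_2_uminus: "Lp_norm 2 (\<lambda>x. g x - f x) = Lp_norm 2 (\<lambda>x. f x - g x)"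
  by (simp add: Lp_norm_2 power2_commute)

lemma has_L2_sum_unique:
  assumes "has_L2_sum f F" "has_L2_sum f G"
  shows "AE x in rplus. F x = G x"
proof -
  let ?S = "\<lambda>J x. \<Sum>j\<in>J. f j x"
  have L2: "F \<in> Lp 2" "G \<in> Lp 2" "\<And>j. f j \<in> Lp 2"
    using assms by (auto simp: has_L2_sum_def)
  have "((\<lambda>J. Lp_norm 2 (\<lambda>x. ?S J x - F x) + Lp_norm 2 (\<lambda>x. ?S J x - G x)) \<longlongrightarrow> 0 + 0)
      (finite_subsets_at_top UNIV)"
    using assms by (intro tendsto_add) (auto simp: has_L2_sum_def)
  then have "Lp_norm 2 (\<lambda>x. F x - G x) \<le> 0 + 0"
  proof (rule tendsto_lowerbound)
    have "Lp_norm 2 (\<lambda>x. F x - G x) \<le> Lp_norm 2 (\<lambda>x. ?S J x - F x) + Lp_norm 2 (\<lambda>x. ?S J x - G x)" for J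
      using Lp_norm_2_triangle[of "\<lambda>x. F x - ?S J x" "\<lambda>x. ?S J x - G x"] L2
      by (simp add: Lp_2_diff Lp_2_sum Lp_norm_2_uminus[of F])
    then show "\<forall>\<^sub>F J in finite_subsets_at_top UNIV. Lp_norm 2 (\<lambda>x. F x - G x)
        \<le> Lp_norm 2 (\<lambda>x. ?S J x - F x) + Lp_norm 2 (\<lambda>x. ?S J x - G x)"
      by simp
  qed simp
  then have "Lp_norm 2 (\<lambda>x. F x - G x) = 0"
    using Lp_norm_2_nonneg[of "\<lambda>x. F x - G x"] by simp
  then have "(LINT x|rplus. (F x - G x)\<^sup>2) = 0"
    using Lp_norm_2_square[of "\<lambda>x. F x - G x"] by simp
  then have "AE x in rplus. (F x - G x)\<^sup>2 = 0"
    using Lp_2_diff[OF L2(1,2)] by (subst (asm) integral_nonneg_eq_0_iff_AE) (auto simp: Lp_2_iff)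
  then show ?thesis
    by simp
qed

text \<open>Carries norm bounds for late partial sums over to their pointwise limit, which can then
  be recognised as the L^2 limit.\<close>

lemma Fatou_L2:
  assumes u: "\<And>n. u n \<in> Lp 2" and v: "v \<in> borel_measurable rplus"
    and lim: "AE x in rplus. (\<lambda>n. u n x) \<longlonglongrightarrow> v x"
    and B: "\<And>n. N \<le> n \<Longrightarrow> (LINT x|rplus. (u n x)\<^sup>2) \<le> B"
  shows "v \<in> Lp 2" "(LINT x|rplus. (v x)\<^sup>2) \<le> B"
proof -
  have B0: "0 \<le> B"
  proof -
    have "0 \<le> (LINT x|rplus. (u N x)\<^sup>2)"
      by simp
    then show ?thesis
      using B[of N] by linarith
  qed
  have meas: "u n \<in> borel_measurable rplus" for n
    using u by (simp add: Lp_2_iff)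
  have "(\<integral>\<^sup>+x. ennreal ((v x)\<^sup>2) \<partial>rplus) = (\<integral>\<^sup>+x. liminf (\<lambda>n. ennreal ((u n x)\<^sup>2)) \<partial>rplus)"
  proof (rule nn_integral_cong_AE)
    show "AE x in rplus. ennreal ((v x)\<^sup>2) = liminf (\<lambda>n. ennreal ((u n x)\<^sup>2))"
      using lim
    proof eventually_elim
      case (elim x)
      then have "(\<lambda>n. ennreal ((u n x)\<^sup>2)) \<longlonglongrightarrow> ennreal ((v x)\<^sup>2)"
        by (intro tendsto_intros)
      then show ?case
        by (intro lim_imp_Liminf[symmetric]) auto
    qed
  qed
  also have "\<dots> \<le> liminf (\<lambda>n. \<integral>\<^sup>+x. ennreal ((u n x)\<^sup>2) \<partial>rplus)"
    using meas by (intro nn_integral_liminf) auto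
  also have "\<dots> \<le> ennreal B"
    unfolding liminf_SUP_INF
  proof (rule SUP_least)
    fix n
    have "(\<integral>\<^sup>+x. ennreal ((u (max n N) x)\<^sup>2) \<partial>rplus) \<le> ennreal B"
      using u[of "max n N"] B[of "max n N"]
      by (subst nn_integral_eq_integral) (auto simp: Lp_2_iff ennreal_leI)
    then show "(INF k\<in>{n..}. \<integral>\<^sup>+x. ennreal ((u k x)\<^sup>2) \<partial>rplus) \<le> ennreal B"
      by (rule INF_lower2[rotated]) simp
  qed
  finally have le: "(\<integral>\<^sup>+x. ennreal ((v x)\<^sup>2) \<partial>rplus) \<le> ennreal B" .
  then have int: "integrable rplus (\<lambda>x. (v x)\<^sup>2)"
    using v by (intro integrableI_nonneg) (auto simp: le_less_trans[OF le])
  then show "v \<in> Lp 2"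
    using v by (simp add: Lp_2_iff)
  show "(LINT x|rplus. (v x)\<^sup>2) \<le> B"
    using le int B0 by (subst (asm) nn_integral_eq_integral) auto
qed

text \<open>Everything below the largest exponent \<open>b\<close> sums to at most
  \<open>2 powi b\<close>, so the whole sum is at most twice that.\<close>

lemma sum_two_powi_le_top:
  assumes "finite J" "\<And>j. j \<in> J \<Longrightarrow> j \<le> m"
  shows "(\<Sum>j\<in>J. (2::real) powi j) \<le> 2 * 2 powi m"
  using assms
proof (induction J arbitrary: m rule: finite_linorder_max_induct)
  case (insert b A)
  have "(\<Sum>j\<in>A. (2::real) powi j) \<le> 2 * 2 powi (b - 1)"
    using insert.hyps by (intro insert.IH) force
  also have "\<dots> = 2 powi b"
    by (simp add: power_int_diff)
  finally have "(\<Sum>j\<in>insert b A. (2::real) powi j) \<le> 2 * 2 powi b"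
    using insert.hyps by (subst sum.insert) auto
  also have "\<dots> \<le> 2 * 2 powi m"
    using insert.prems by (intro mult_left_mono power_int_increasing) auto
  finally show ?case .
qed simp

lemma sum_two_powi_le:
  assumes "finite J" "\<And>j. j \<in> J \<Longrightarrow> (2::real) powi j \<le> M" "0 \<le> M"
  shows "(\<Sum>j\<in>J. (2::real) powi j) \<le> 2 * M"
proof (cases "J = {}")
  case False
  then have "(\<Sum>j\<in>J. (2::real) powi j) \<le> 2 * 2 powi (Max J)"
    using assms(1) by (intro sum_two_powi_le_top) auto
  also have "\<dots> \<le> 2 * M"
    using assms(2)[of "Max J"] assms(1) False by simp
  finally show ?thesis .
qed (use assms in simp)

text \<open>\<open>int_decode\<close> enumerates the scales, so that sums over integers become
  partial sums of ordinary series.\<close>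

lemma sum_int_decode: "(\<Sum>n<N. f (int_decode n)) = (\<Sum>j\<in>int_decode ` {..<N}. f j)"
  by (simp add: sum.reindex inj_int_decode)

lemma finite_subset_int_decode:
  assumes "finite J"
  obtains N where "J \<subseteq> int_decode ` {..<N}"
proof -
  obtain N where "\<And>j. j \<in> J \<Longrightarrow> int_encode j < N"
    using finite_nat_bounded[of "int_encode ` J"] assms by auto
  then have "J \<subseteq> int_decode ` {..<N}"
    by (metis image_eqI int_encode_inverse lessThan_iff subsetI)
  then show ?thesis
    by (rule that)
qed

section \<open>Haar coefficients along a row\<close>

lemma haar_row_sum_square_integral:
  assumes "finite D"
  shows "(LINT x|rplus. (\<Sum>j\<in>D. b j * haar j i x)\<^sup>2) = (\<Sum>j\<in>D. (b j)\<^sup>2)"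
proof -
  have inj: "inj_on (\<lambda>j. (j, i)) D"
    by (auto simp: inj_on_def)
  show ?thesis
    using haar_sum_square_integral(1)[of "(\<lambda>j. (j, i)) ` D" "\<lambda>j k. b j"] assms
    by (simp add: haar_sum_def sum.reindex[OF inj])
qed

lemma haar_row_sum_in_L2: "(\<lambda>x. \<Sum>j\<in>D. b j * haar j i x) \<in> Lp 2"
  by (intro Lp_2_sum Lp_2_scale haar_in_L2)

lemma Bessel_rows:
  assumes "g \<in> Lp 2"
  shows "(\<Sum>n<N. \<Sum>i<M. (L2_inner g (haar (int_decode n) i))\<^sup>2) \<le> (LINT x|rplus. (g x)\<^sup>2)"
proof -
  have "(\<Sum>n<N. \<Sum>i<M. (L2_inner g (haar (int_decode n) i))\<^sup>2) =
      (\<Sum>(j, k)\<in>int_decode ` {..<N} \<times> {..<M}. (L2_inner g (haar j k))\<^sup>2)"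
    unfolding sum_int_decode[of "\<lambda>j. \<Sum>i<M. (L2_inner g (haar j i))\<^sup>2"] by (rule sum.cartesian_product)
  also have "\<dots> \<le> (LINT x|rplus. (g x)\<^sup>2)"
    using assms by (intro Bessel_inequality) auto
  finally show ?thesis .
qed

lemma summable_haar_coeff_square:
  assumes "g \<in> Lp 2"
  shows "summable (\<lambda>n. (L2_inner g (haar (int_decode n) i))\<^sup>2)"
proof (rule summableI_nonneg_bounded)
  fix N
  have "(\<Sum>n<N. (L2_inner g (haar (int_decode n) i))\<^sup>2) \<le>
      (\<Sum>n<N. \<Sum>k<Suc i. (L2_inner g (haar (int_decode n) k))\<^sup>2)"
    by (intro sum_mono) (simp add: sum_nonneg)
  also have "\<dots> \<le> (LINT x|rplus. (g x)\<^sup>2)"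
    using assms by (rule Bessel_rows)
  finally show "(\<Sum>n<N. (L2_inner g (haar (int_decode n) i))\<^sup>2) \<le> (LINT x|rplus. (g x)\<^sup>2)" .
qed simp

text \<open>A concrete pointwise sum along a fixed enumeration of the scales, with which the
  function chosen by \<open>L2_sum\<close> is compared later.\<close>

definition haar_row_limit :: "(real \<Rightarrow> real) \<Rightarrow> nat \<Rightarrow> real \<Rightarrow> real" where
  "haar_row_limit g i x = (\<Sum>n. L2_inner g (haar (int_decode n) i) * haar (int_decode n) i x)"

text \<open>For \<open>x > 0\<close> the scales of the intervals of a row containing \<open>x\<close> are bounded above.\<close>

lemma summable_haar_row:
  assumes g: "g \<in> Lp 2" and x: "0 < x"
  shows "summable (\<lambda>n. L2_inner g (haar (int_decode n) i) * haar (int_decode n) i x)"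
proof -
  \<comment> \<open>The coefficients are square summable by Bessel's inequality, so square
    summability of the Haar values at \<open>x\<close> is enough.\<close>
  have "summable (\<lambda>n. (haar (int_decode n) i x)\<^sup>2)"
  proof (rule summableI_nonneg_bounded)
    fix N
    define J where "J = {j \<in> int_decode ` {..<N}. dyadic_index j x = int i}"
    have "(\<Sum>n<N. (haar (int_decode n) i x)\<^sup>2) = (\<Sum>j\<in>int_decode ` {..<N}. (haar j i x)\<^sup>2)"
      by (rule sum_int_decode[of "\<lambda>j. (haar j i x)\<^sup>2"])
    also have "\<dots> = (\<Sum>j\<in>J. 2 powi j)"
      unfolding J_def by (subst sum.inter_filter) (auto simp: haar_square)
    also have "\<dots> \<le> 2 * ((real i + 1) / x)"
    proof (rule sum_two_powi_le)
      fix j assume "j \<in> J"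
      then have "2 powi j * x < real i + 1"
        by (simp add: J_def dyadic_index_def floor_eq_iff)
      then show "2 powi j \<le> (real i + 1) / x"
        using x by (simp add: field_simps)
    qed (use x in \<open>auto simp: J_def\<close>)
    finally show "(\<Sum>n<N. (haar (int_decode n) i x)\<^sup>2) \<le> 2 * ((real i + 1) / x)" .
  qed simp
  then have "summable (\<lambda>n. (L2_inner g (haar (int_decode n) i))\<^sup>2 + (haar (int_decode n) i x)\<^sup>2)"
    by (intro summable_add summable_haar_coeff_square g)
  moreover note abs_mult_le_sum_squares
  ultimately show ?thesis
    by (intro summable_comparison_test'[where N = 0 and f = "\<lambda>n. _ n * _ n"]) auto
qed

lemma AE_rplus_pos: "AE x in rplus. 0 < x"
proof -
  have "AE x in lebesgue. x \<notin> {0::real}"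
    by (rule AE_not_in) simp
  then have "AE x in rplus. x \<noteq> 0"
    by (auto simp: AE_restrict_space_iff elim: eventually_mono)
  moreover have "AE x in rplus. 0 \<le> x"
    by (rule AE_I2) simp
  ultimately show ?thesis
    by eventually_elim simp
qed

lemma borel_measurable_haar_row_limit [measurable]: "haar_row_limit g i \<in> borel_measurable borel"
  unfolding haar_row_limit_def[abs_def] by measurable

text \<open>The partial sum over \<open>J\<close> is compared with those over long initial segments
  containing \<open>J\<close>. By orthonormality the squared distance is a sum of squared
  coefficients outside \<open>J\<close>, at most the tail after \<open>N\<close>; Fatou's lemma
  carries this to the limit.\<close>

lemma haar_row_limit_approx:
  fixes i :: nat
  assumes g: "g \<in> Lp 2" and J: "finite J" "int_decode ` {..<N} \<subseteq> J"
  defines "c \<equiv> \<lambda>j. L2_inner g (haar j i)"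
  shows "(\<lambda>x. (\<Sum>j\<in>J. haar_row_series g i j x) - haar_row_limit g i x) \<in> Lp 2"
    and "(LINT x|rplus. ((\<Sum>j\<in>J. haar_row_series g i j x) - haar_row_limit g i x)\<^sup>2)
      \<le> (\<Sum>n. (c (int_decode n))\<^sup>2) - (\<Sum>n<N. (c (int_decode n))\<^sup>2)"
proof -
  let ?S = "\<lambda>J x. \<Sum>j\<in>J. haar_row_series g i j x"
  let ?E = "\<lambda>n. int_decode ` {..<n}"
  have S: "?S J x = (\<Sum>j\<in>J. c j * haar j i x)" for J x
    by (simp add: haar_row_series_def c_def)
  obtain m where m: "J \<subseteq> ?E m"
    using finite_subset_int_decode[OF J(1)] .
  have sm: "summable (\<lambda>n. (c (int_decode n))\<^sup>2)"
    unfolding c_def by (rule summable_haar_coeff_square[OF g])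
  have 1: "(\<lambda>x. ?S J x - ?S (?E n) x) \<in> Lp 2" for n
    unfolding S by (intro Lp_2_diff haar_row_sum_in_L2)
  have 2: "(\<lambda>x. ?S J x - haar_row_limit g i x) \<in> borel_measurable rplus"
    unfolding S by (intro borel_measurable_lebesgue_on) measurable
  have 3: "AE x in rplus. (\<lambda>n. ?S J x - ?S (?E n) x) \<longlonglongrightarrow> ?S J x - haar_row_limit g i x"
    using AE_rplus_pos
  proof eventually_elim
    case (elim x)
    have "(\<lambda>n. \<Sum>n<n. haar_row_series g i (int_decode n) x) \<longlonglongrightarrow> haar_row_limit g i x"
      using summable_LIMSEQ[OF summable_haar_row[OF g elim, of i]]
      by (simp add: haar_row_limit_def haar_row_series_def)
    then show ?case
      unfolding sum_int_decode[of "\<lambda>j. haar_row_series g i j x"] by (intro tendsto_intros)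
  qed
  have 4: "(LINT x|rplus. (?S J x - ?S (?E n) x)\<^sup>2)
      \<le> (\<Sum>n. (c (int_decode n))\<^sup>2) - (\<Sum>n<N. (c (int_decode n))\<^sup>2)" if n: "m \<le> n" for n
  proof -
    have sub: "J \<subseteq> ?E n"
      using m n by force
    have "?S J x - ?S (?E n) x = - (\<Sum>j\<in>?E n - J. c j * haar j i x)" for x
      unfolding S using sum_diff[OF _ sub, of "\<lambda>j. c j * haar j i x"] by simp
    then have "(LINT x|rplus. (?S J x - ?S (?E n) x)\<^sup>2) = (\<Sum>j\<in>?E n - J. (c j)\<^sup>2)"
      by (simp add: haar_row_sum_square_integral)
    also have "\<dots> = (\<Sum>j\<in>?E n. (c j)\<^sup>2) - (\<Sum>j\<in>J. (c j)\<^sup>2)"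
      using sub by (intro sum_diff) auto
    also have "\<dots> \<le> (\<Sum>n. (c (int_decode n))\<^sup>2) - (\<Sum>n<N. (c (int_decode n))\<^sup>2)"
      unfolding sum_int_decode[of "\<lambda>j. (c j)\<^sup>2"]
    proof (rule diff_mono)
      show "(\<Sum>j\<in>?E n. (c j)\<^sup>2) \<le> (\<Sum>n. (c (int_decode n))\<^sup>2)"
        unfolding sum_int_decode[of "\<lambda>j. (c j)\<^sup>2", symmetric]
        using sm by (intro sum_le_suminf) auto
      show "(\<Sum>j\<in>?E N. (c j)\<^sup>2) \<le> (\<Sum>j\<in>J. (c j)\<^sup>2)"
        using J by (intro sum_mono2) auto
    qed
    finally show ?thesis .
  qed
  show "(\<lambda>x. ?S J x - haar_row_limit g i x) \<in> Lp 2"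
    "(LINT x|rplus. (?S J x - haar_row_limit g i x)\<^sup>2)
      \<le> (\<Sum>n. (c (int_decode n))\<^sup>2) - (\<Sum>n<N. (c (int_decode n))\<^sup>2)"
    using Fatou_L2[OF 1 2 3 4] by blast+
qed

text \<open>The approximation estimate for an empty partial sum, where the error is the limit itself
  up to sign.\<close>

lemma haar_row_limit_L2:
  assumes g: "g \<in> Lp 2"
  shows "haar_row_limit g i \<in> Lp 2"
    and "(LINT x|rplus. (haar_row_limit g i x)\<^sup>2) \<le> (\<Sum>n. (L2_inner g (haar (int_decode n) i))\<^sup>2)"
  using haar_row_limit_approx[OF g, of "{}" 0 i] Lp_2_scale[of "\<lambda>x. - haar_row_limit g i x" "- 1"]
  by simp_all

lemma has_L2_sum_haar_row:
  assumes g: "g \<in> Lp 2"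
  shows "has_L2_sum (haar_row_series g i) (haar_row_limit g i)"
  unfolding has_L2_sum_def
proof (intro conjI allI)
  show "haar_row_series g i j \<in> Lp 2" for j
    unfolding haar_row_series_def[abs_def] by (intro Lp_2_scale haar_in_L2)
  show "haar_row_limit g i \<in> Lp 2"
    using g by (rule haar_row_limit_L2)
  let ?D = "\<lambda>J. Lp_norm 2 (\<lambda>x. (\<Sum>j\<in>J. haar_row_series g i j x) - haar_row_limit g i x)"
  let ?c = "\<lambda>n. (L2_inner g (haar (int_decode n) i))\<^sup>2"
  show "(?D \<longlongrightarrow> 0) (finite_subsets_at_top UNIV)"
  proof (rule tendstoI)
    fix e :: real assume e: "0 < e"
    have "(\<lambda>N. \<Sum>n<N. ?c n) \<longlonglongrightarrow> (\<Sum>n. ?c n)"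
      using summable_LIMSEQ[OF summable_haar_coeff_square[OF g]] .
    then have "\<forall>\<^sub>F N in sequentially. dist (\<Sum>n<N. ?c n) (\<Sum>n. ?c n) < e\<^sup>2"
      using e by (intro tendstoD) auto
    then obtain N where "dist (\<Sum>n<N. ?c n) (\<Sum>n. ?c n) < e\<^sup>2"
      by (auto simp: eventually_sequentially)
    then have N: "(\<Sum>n. ?c n) - (\<Sum>n<N. ?c n) < e\<^sup>2"
      by (simp add: dist_real_def)
    have "dist (?D J) 0 < e" if "finite J" "int_decode ` {..<N} \<subseteq> J" for J
    proof -
      have "(?D J)\<^sup>2 < e\<^sup>2"
        using haar_row_limit_approx(2)[OF g that, of i] N by (simp add: Lp_norm_2_square)
      then show ?thesis
        using e Lp_norm_2_nonneg power_less_imp_less_base[of "?D J" 2 e] by simp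
    qed
    then show "\<forall>\<^sub>F J in finite_subsets_at_top UNIV. dist (?D J) 0 < e"
      unfolding eventually_finite_subsets_at_top by (intro exI[of _ "int_decode ` {..<N}"]) auto
  qed
qed

lemma haar_row_operator_has_L2_sum:
  assumes "g \<in> Lp 2"
  shows "has_L2_sum (haar_row_series g i) (\<lambda>x. haar_row_operator g x i)"
  unfolding haar_row_operator_def L2_sum_def
  using someI[of "has_L2_sum (haar_row_series g i)", OF has_L2_sum_haar_row[OF assms]] by simp

text \<open>In each row the chosen sum agrees almost everywhere with the pointwise one by
  uniqueness; countably many rows share one null set.\<close>

lemma haar_row_operator_AE:
  assumes "g \<in> Lp 2"
  shows "AE x in rplus. \<forall>i. haar_row_operator g x i = haar_row_limit g i x"
  unfolding AE_all_countable
  using has_L2_sum_unique[OF haar_row_operator_has_L2_sum has_L2_sum_haar_row] assms by blast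

subsection \<open>The row operator\<close>

text \<open>Integrating the nonnegative series of squares term by term bounds its integral by
  \<open>B\<close>; hence the series is finite almost everywhere.\<close>

lemma Lp_l2_2I:
  assumes F: "\<And>i. (\<lambda>x. F x i) \<in> Lp 2"
    and B: "\<And>M. (\<Sum>i<M. LINT x|rplus. (F x i)\<^sup>2) \<le> B"
  shows "F \<in> Lp_l2 2" "Lp_l2_norm 2 F \<le> sqrt B"
proof -
  have B0: "0 \<le> B"
    using B[of 0] by simp
  have meas: "(\<lambda>x. F x i) \<in> borel_measurable rplus" for i
    using F by (simp add: Lp_2_iff)
  have "(\<integral>\<^sup>+x. (\<Sum>i. ennreal ((F x i)\<^sup>2)) \<partial>rplus) = (\<Sum>i. \<integral>\<^sup>+x. ennreal ((F x i)\<^sup>2) \<partial>rplus)"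
    using meas by (intro nn_integral_suminf) auto
  also have "\<dots> = (\<Sum>i. ennreal (LINT x|rplus. (F x i)\<^sup>2))"
    using F by (intro suminf_cong nn_integral_eq_integral) (auto simp: Lp_2_iff)
  also have "\<dots> \<le> ennreal B"
  proof (rule suminf_le_const)
    show "(\<Sum>i<M. ennreal (LINT x|rplus. (F x i)\<^sup>2)) \<le> ennreal B" for M
      using B[of M] by (subst sum_ennreal) (auto intro: ennreal_leI)
  qed simp
  finally have le: "(\<integral>\<^sup>+x. (\<Sum>i. ennreal ((F x i)\<^sup>2)) \<partial>rplus) \<le> ennreal B" .
  then have "AE x in rplus. (\<Sum>i. ennreal ((F x i)\<^sup>2)) \<noteq> \<infinity>"
    using meas by (intro nn_integral_PInf_AE) (auto simp: top_unique)
  then have AE: "AE x in rplus. F x \<in> l2"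
    by eventually_elim (auto simp: l2_def intro!: summable_suminf_not_top)
  have measN: "(\<lambda>x. l2_norm (F x)) \<in> borel_measurable rplus"
    unfolding l2_norm_def using meas by measurable
  have "(\<integral>\<^sup>+x. ennreal ((l2_norm (F x))\<^sup>2) \<partial>rplus) = (\<integral>\<^sup>+x. (\<Sum>i. ennreal ((F x i)\<^sup>2)) \<partial>rplus)"
  proof (rule nn_integral_cong_AE)
    show "AE x in rplus. ennreal ((l2_norm (F x))\<^sup>2) = (\<Sum>i. ennreal ((F x i)\<^sup>2))"
      using AE
    proof eventually_elim
      case (elim x)
      then show ?case
        by (simp add: l2_def l2_norm_def suminf_nonneg suminf_ennreal2)
    qed
  qed
  with le have le: "(\<integral>\<^sup>+x. ennreal ((l2_norm (F x))\<^sup>2) \<partial>rplus) \<le> ennreal B"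
    by simp
  then have int: "integrable rplus (\<lambda>x. (l2_norm (F x))\<^sup>2)"
    using measN by (intro integrableI_nonneg) (auto simp: le_less_trans[OF le])
  then show "F \<in> Lp_l2 2"
    using AE meas measN by (simp add: Lp_l2_def Lp_2_iff)
  have "(LINT x|rplus. (l2_norm (F x))\<^sup>2) \<le> B"
    using le int B0 by (subst (asm) nn_integral_eq_integral) auto
  then show "Lp_l2_norm 2 F \<le> sqrt B"
    by (simp add: Lp_l2_norm_def Lp_norm_2)
qed

lemma Lp_l2_2D:
  assumes "F \<in> Lp_l2 2"
  shows "(\<lambda>x. F x i) \<in> Lp 2"
    and "(\<Sum>i<M. LINT x|rplus. (F x i)\<^sup>2) \<le> (Lp_l2_norm 2 F)\<^sup>2"
proof -
  have meas: "(\<lambda>x. F x i) \<in> borel_measurable rplus" for i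
    using assms by (auto simp: Lp_l2_def)
  have AE: "AE x in rplus. F x \<in> l2" and N: "(\<lambda>x. l2_norm (F x)) \<in> Lp 2"
    using assms by (auto simp: Lp_l2_def)
  have le: "AE x in rplus. (\<Sum>i<M. (F x i)\<^sup>2) \<le> (l2_norm (F x))\<^sup>2" for M
    using AE
  proof eventually_elim
    case (elim x)
    then have "(\<Sum>i<M. (F x i)\<^sup>2) \<le> (\<Sum>i. (F x i)\<^sup>2)"
      by (intro sum_le_suminf) (auto simp: l2_def)
    then show ?case
      using elim by (simp add: l2_norm_def l2_def suminf_nonneg)
  qed
  show L2: "(\<lambda>x. F x i) \<in> Lp 2" for i
    unfolding Lp_2_iff
  proof
    have "AE x in rplus. (F x i)\<^sup>2 \<le> (l2_norm (F x))\<^sup>2"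
      using le[of "Suc i"]
    proof eventually_elim
      case (elim x)
      have "(F x i)\<^sup>2 \<le> (\<Sum>k<Suc i. (F x k)\<^sup>2)"
        by (simp add: sum_nonneg)
      then show ?case
        using elim by linarith
    qed
    then have "AE x in rplus. norm ((F x i)\<^sup>2) \<le> norm ((l2_norm (F x))\<^sup>2)"
      by eventually_elim simp
    moreover have "integrable rplus (\<lambda>x. (l2_norm (F x))\<^sup>2)"
      using N by (simp add: Lp_2_iff)
    moreover have "(\<lambda>x. (F x i)\<^sup>2) \<in> borel_measurable rplus"
      using meas by measurable
    ultimately show "integrable rplus (\<lambda>x. (F x i)\<^sup>2)"
      by (metis Bochner_Integration.integrable_bound)
  qed (rule meas)
  have "(\<Sum>i<M. LINT x|rplus. (F x i)\<^sup>2) = (LINT x|rplus. (\<Sum>i<M. (F x i)\<^sup>2))"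
    using L2 by (intro Bochner_Integration.integral_sum[symmetric]) (simp add: Lp_2_iff)
  also have "\<dots> \<le> (LINT x|rplus. (l2_norm (F x))\<^sup>2)"
  proof (rule integral_mono_AE[OF _ _ le])
    show "integrable rplus (\<lambda>x. \<Sum>i<M. (F x i)\<^sup>2)"
      using L2 by (intro Bochner_Integration.integrable_sum) (simp add: Lp_2_iff)
    show "integrable rplus (\<lambda>x. (l2_norm (F x))\<^sup>2)"
      using N by (simp add: Lp_2_iff)
  qed
  finally show "(\<Sum>i<M. LINT x|rplus. (F x i)\<^sup>2) \<le> (Lp_l2_norm 2 F)\<^sup>2"
    by (simp add: Lp_l2_norm_def Lp_norm_2_square)
qed

lemma L2_inner_linear:
  assumes "f \<in> Lp 2" "g \<in> Lp 2" "h \<in> Lp 2"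
  shows "L2_inner (\<lambda>x. a * f x + b * g x) h = a * L2_inner f h + b * L2_inner g h"
proof -
  have "L2_inner (\<lambda>x. a * f x + b * g x) h = (LINT x|rplus. a * (f x * h x) + b * (g x * h x))"
    by (simp add: L2_inner_def algebra_simps)
  then show ?thesis
    using integrable_mult_L2 assms by (simp add: L2_inner_def)
qed

lemma haar_row_operator_bounded_linear: "bounded_linear_L2_l2 haar_row_operator"
proof -
  have *: "haar_row_operator g \<in> Lp_l2 2 \<and> Lp_l2_norm 2 (haar_row_operator g) \<le> Lp_norm 2 g"
    if g: "g \<in> Lp 2" for g
  proof -
    have L2: "(\<lambda>x. haar_row_operator g x i) \<in> Lp 2" for i
      using haar_row_operator_has_L2_sum[OF g] by (simp add: has_L2_sum_def)
    have eq: "(LINT x|rplus. (haar_row_operator g x i)\<^sup>2) = (LINT x|rplus. (haar_row_limit g i x)\<^sup>2)" for i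
    proof (rule integral_cong_AE)
      show "AE x in rplus. (haar_row_operator g x i)\<^sup>2 = (haar_row_limit g i x)\<^sup>2"
        using haar_row_operator_AE[OF g] by eventually_elim simp
    qed (use L2[of i] haar_row_limit_L2(1)[OF g, of i] in \<open>auto simp: Lp_2_iff\<close>)
    \<comment> \<open>Bessel's inequality, applied to the first \<open>M\<close> rows together,
      gives a bound that does not grow with \<open>M\<close>, so 1 serves as the operator
      bound.\<close>
    have "(\<Sum>i<M. LINT x|rplus. (haar_row_operator g x i)\<^sup>2) \<le> (LINT x|rplus. (g x)\<^sup>2)" for M
    proof -
      have "(\<Sum>i<M. LINT x|rplus. (haar_row_operator g x i)\<^sup>2)
          \<le> (\<Sum>i<M. \<Sum>n. (L2_inner g (haar (int_decode n) i))\<^sup>2)"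
        unfolding eq by (intro sum_mono haar_row_limit_L2(2) g)
      also have "\<dots> = (\<Sum>n. \<Sum>i<M. (L2_inner g (haar (int_decode n) i))\<^sup>2)"
        by (rule suminf_sum[symmetric]) (rule summable_haar_coeff_square[OF g])
      also have "\<dots> \<le> (LINT x|rplus. (g x)\<^sup>2)"
        by (intro suminf_le_const summable_sum summable_haar_coeff_square g Bessel_rows)
      finally show ?thesis .
    qed
    from Lp_l2_2I[OF L2 this] show ?thesis
      by (simp add: Lp_norm_2)
  qed
  have lin: "AE x in rplus. haar_row_operator (\<lambda>y. a * f y + b * g y) x
      = (\<lambda>i. a * haar_row_operator f x i + b * haar_row_operator g x i)"
    if f: "f \<in> Lp 2" and g: "g \<in> Lp 2" for f g a b
  proof -
    have fg: "(\<lambda>y. a * f y + b * g y) \<in> Lp 2"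
      by (intro Lp_2_add Lp_2_scale f g)
    \<comment> \<open>Coefficients are linear in the function and the row series converge at every
      \<open>x > 0\<close>, so the pointwise sums are linear there; the operator agrees with them
      almost everywhere.\<close>
    show ?thesis
      using haar_row_operator_AE[OF f] haar_row_operator_AE[OF g] haar_row_operator_AE[OF fg] AE_rplus_pos
    proof eventually_elim
      case (elim x)
      have "haar_row_limit (\<lambda>y. a * f y + b * g y) i x = a * haar_row_limit f i x + b * haar_row_limit g i x" for i
        unfolding haar_row_limit_def L2_inner_linear[OF f g haar_in_L2]
        using sums_add[OF sums_mult[OF summable_sums[OF summable_haar_row[OF f elim(4), of i]], of a]
            sums_mult[OF summable_sums[OF summable_haar_row[OF g elim(4), of i]], of b]]
        by (simp add: sums_iff distrib_right mult.assoc)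
      then show ?case
        using elim by (simp add: fun_eq_iff)
    qed
  qed
  show ?thesis
    unfolding bounded_linear_L2_l2_def using * lin by (auto intro!: exI[of _ 1])
qed

subsection \<open>The kernel\<close>

definition haar_kernel :: "real \<Rightarrow> real \<Rightarrow> nat \<Rightarrow> real" where
  "haar_kernel x y i = (\<Sum>n. haar (int_decode n) i x * haar (int_decode n) i y)"

lemma haar_kernel_commute: "haar_kernel x y = haar_kernel y x"
  by (simp add: haar_kernel_def fun_eq_iff mult.commute)

text \<open>With \<open>J\<close> the finest common scale, only scales \<open>j \<le> J\<close>
  contribute, each through the single interval containing both points and with absolute value
  \<open>2 powi j\<close>. The geometric sum is at most \<open>2 * 2 powi J\<close>.\<close>

lemma sum_abs_haar_product_le:
  assumes "0 \<le> x" "0 \<le> y" "x \<noteq> y"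
  shows "(\<Sum>n<N. \<Sum>i<M. \<bar>haar (int_decode n) i x * haar (int_decode n) i y\<bar>) \<le> 2 / dyadic_dist x y"
proof -
  obtain J where dist: "dyadic_dist x y = 2 powi (- J)"
    and J: "\<forall>j. dyadic_index j x = dyadic_index j y \<longleftrightarrow> j \<le> J"
    by (rule dyadic_dist_scale[OF assms])
  have row: "(\<Sum>i<M. \<bar>haar j i x * haar j i y\<bar>) \<le> (if j \<le> J then 2 powi j else 0)" for j
  proof -
    define a where "a = (2::real) powr (of_int j / 2)"
    have a: "a * a = 2 powi j"
      using powr_half_square[of j] by (simp only: a_def power2_eq_square)
    have "\<bar>haar j i x * haar j i y\<bar> = (if j \<le> J \<and> i = nat (dyadic_index j x) then 2 powi j else 0)" for i
      using J[rule_format, of j] dyadic_index_nonneg[OF assms(1), of j]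
      by (auto simp: abs_mult abs_haar a_def[symmetric] a)
    then show ?thesis
      by auto
  qed
  have "(\<Sum>n<N. \<Sum>i<M. \<bar>haar (int_decode n) i x * haar (int_decode n) i y\<bar>)
      \<le> (\<Sum>j\<in>int_decode ` {..<N}. if j \<le> J then 2 powi j else 0)"
    unfolding sum_int_decode[of "\<lambda>j. \<Sum>i<M. \<bar>haar j i x * haar j i y\<bar>"] by (intro sum_mono row)
  also have "\<dots> = (\<Sum>j\<in>{j \<in> int_decode ` {..<N}. j \<le> J}. 2 powi j)"
    by (rule sum.inter_filter[symmetric]) simp
  also have "\<dots> \<le> 2 * 2 powi J"
    by (rule sum_two_powi_le_top) auto
  also have "\<dots> = 2 / dyadic_dist x y"
    by (simp add: dist power_int_minus divide_inverse)
  finally show ?thesis .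
qed

lemma summable_abs_haar_product:
  assumes "0 \<le> x" "0 \<le> y" "x \<noteq> y"
  shows "summable (\<lambda>n. \<bar>haar (int_decode n) i x * haar (int_decode n) i y\<bar>)"
proof (rule summableI_nonneg_bounded)
  fix N
  have "(\<Sum>n<N. \<bar>haar (int_decode n) i x * haar (int_decode n) i y\<bar>)
      \<le> (\<Sum>n<N. \<Sum>k<Suc i. \<bar>haar (int_decode n) k x * haar (int_decode n) k y\<bar>)"
    by (intro sum_mono) (simp add: sum_nonneg)
  also have "\<dots> \<le> 2 / dyadic_dist x y"
    using assms by (rule sum_abs_haar_product_le)
  finally show "(\<Sum>n<N. \<bar>haar (int_decode n) i x * haar (int_decode n) i y\<bar>) \<le> 2 / dyadic_dist x y" .
qed simp

lemma haar_kernel_l1_bound: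
  assumes "0 \<le> x" "0 \<le> y" "x \<noteq> y"
  shows "(\<Sum>i<M. \<bar>haar_kernel x y i\<bar>) \<le> 2 / dyadic_dist x y"
proof -
  have "(\<Sum>i<M. \<bar>haar_kernel x y i\<bar>)
      \<le> (\<Sum>i<M. \<Sum>n. \<bar>haar (int_decode n) i x * haar (int_decode n) i y\<bar>)"
    unfolding haar_kernel_def by (intro sum_mono summable_rabs summable_abs_haar_product assms)
  also have "\<dots> = (\<Sum>n. \<Sum>i<M. \<bar>haar (int_decode n) i x * haar (int_decode n) i y\<bar>)"
    by (intro suminf_sum[symmetric] summable_abs_haar_product assms)
  also have "\<dots> \<le> 2 / dyadic_dist x y"
    by (intro suminf_le_const summable_sum summable_abs_haar_product sum_abs_haar_product_le assms)
  finally show ?thesis .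
qed

text \<open>The l^2 norm of a sequence is at most its l^1 norm, for which the geometric bound is
  available.\<close>

lemma haar_kernel_size:
  assumes "0 \<le> x" "0 \<le> y" "x \<noteq> y"
  shows "haar_kernel x y \<in> l2" "l2_norm (haar_kernel x y) \<le> 2 / dyadic_dist x y"
proof -
  have bound: "(\<Sum>i<M. (haar_kernel x y i)\<^sup>2) \<le> (2 / dyadic_dist x y)\<^sup>2" for M
  proof -
    have "sqrt (\<Sum>i<M. (haar_kernel x y i)\<^sup>2) = L2_set (\<lambda>i. \<bar>haar_kernel x y i\<bar>) {..<M}"
      by (simp add: L2_set_def)
    also have "\<dots> \<le> (\<Sum>i<M. \<bar>haar_kernel x y i\<bar>)"
      by (rule L2_set_le_sum) simp
    also have "\<dots> \<le> 2 / dyadic_dist x y"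
      using assms by (rule haar_kernel_l1_bound)
    finally show ?thesis
      by (rule sqrt_le_D)
  qed
  then have "summable (\<lambda>i. (haar_kernel x y i)\<^sup>2)"
    by (intro summableI_nonneg_bounded) auto
  then show "haar_kernel x y \<in> l2"
    by (simp add: l2_def)
  have "(\<Sum>i. (haar_kernel x y i)\<^sup>2) \<le> (2 / dyadic_dist x y)\<^sup>2"
    using \<open>summable _\<close> bound by (rule suminf_le_const)
  then have "l2_norm (haar_kernel x y) \<le> sqrt ((2 / dyadic_dist x y)\<^sup>2)"
    unfolding l2_norm_def by (rule real_sqrt_le_mono)
  then show "l2_norm (haar_kernel x y) \<le> 2 / dyadic_dist x y"
    using dyadic_dist_pos[OF assms] by simp
qed

lemma dyadic_dist_commute: "dyadic_dist x y = dyadic_dist y x"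
proof -
  have "dyadic_hull x y = dyadic_hull y x"
    unfolding dyadic_hull_def by (rule arg_cong[where f = The]) blast
  then show ?thesis
    by (simp add: dyadic_dist_def)
qed

text \<open>The hypothesis puts \<open>x'\<close> into the interval of level \<open>J + 1\<close>
  around \<open>x\<close>. Haar functions of level at most \<open>J\<close> depend only on the
  position at level \<open>J + 1\<close> or coarser, hence agree at both points; at finer levels
  neither point shares an interval with \<open>y\<close>, so all products vanish.\<close>

lemma haar_kernel_locally_constant:
  assumes nn: "0 \<le> x" "0 \<le> x'" "0 \<le> y" and ne: "x \<noteq> y"
    and close: "2 * dyadic_dist x' x \<le> dyadic_dist x y"
  shows "haar_kernel x' y = haar_kernel x y"
proof (cases "x' = x")
  case False
  obtain J where dist: "dyadic_dist x y = 2 powi (- J)"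
    and J: "\<forall>j. dyadic_index j x = dyadic_index j y \<longleftrightarrow> j \<le> J"
    by (rule dyadic_dist_scale[OF nn(1,3) ne])
  obtain J' where dist': "dyadic_dist x' x = 2 powi (- J')"
    and J': "\<forall>j. dyadic_index j x' = dyadic_index j x \<longleftrightarrow> j \<le> J'"
    by (rule dyadic_dist_scale[OF nn(2,1) False])
  have "(2::real) powi (- J' + 1) = 2 powi (- J') * 2"
    by (rule power_int_add_1) simp
  then have "2 powi (- J' + 1) \<le> (2::real) powi (- J)"
    using close unfolding dist dist' by linarith
  then have "\<not> - J < - J' + 1"
    using power_int_strict_increasing[of "- J" "- J' + 1" "2::real"] by linarith
  then have "J + 1 \<le> J'"
    by linarith
  have "haar j i x' * haar j i y = haar j i x * haar j i y" for j i
  proof (cases "j \<le> J")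
    case True
    then have "dyadic_index (j + 1) x' = dyadic_index (j + 1) x"
      using \<open>J + 1 \<le> J'\<close> by (subst J'[rule_format]) linarith
    then show ?thesis
      by (simp only: haar_cong[of j x' x i])
  next
    case False
    have "dyadic_index j x \<noteq> dyadic_index j y"
      using J False by simp
    moreover have "dyadic_index j x' \<noteq> dyadic_index j y"
    proof
      assume "dyadic_index j x' = dyadic_index j y"
      then have "dyadic_index (J + 1) x' = dyadic_index (J + 1) y"
        using dyadic_index_eq_mono[of j x' y "J + 1"] False by linarith
      moreover have "dyadic_index (J + 1) x' = dyadic_index (J + 1) x"
        using \<open>J + 1 \<le> J'\<close> by (subst J'[rule_format])
      ultimately have "J + 1 \<le> J"
        by (subst J[rule_format, symmetric]) (simp only:)
      then show False
        by simp
    qed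
    ultimately have "haar j i y = 0 \<or> haar j i x = 0 \<and> haar j i x' = 0"
      using haar_eq_0[of j x i] haar_eq_0[of j y i] haar_eq_0[of j x' i] by force
    then show ?thesis
      by auto
  qed
  then show ?thesis
    unfolding haar_kernel_def by (simp only:)
qed simp

lemma borel_measurable_haar_kernel:
  "(\<lambda>(x, y). haar_kernel x y i) \<in> borel_measurable (borel :: (real \<times> real) measure)"
proof -
  have [measurable]: "(\<lambda>p. haar j i (fst p)) \<in> borel_measurable (borel :: (real \<times> real) measure)"
    "(\<lambda>p. haar j i (snd p)) \<in> borel_measurable (borel :: (real \<times> real) measure)" for j
    by (rule measurable_compose[OF _ borel_measurable_haar],
        intro borel_measurable_continuous_onI continuous_intros)+
  show ?thesis
    unfolding haar_kernel_def case_prod_beta by measurable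
qed

text \<open>On a nonempty compact set off the diagonal \<open>\<bar>x - y\<bar>\<close> has a
  positive minimum \<open>e\<close>, and the dyadic distance is no smaller, so the kernel is bounded
  by \<open>2 / e\<close> on a set of finite measure.\<close>

lemma haar_kernel_L1_loc: "L1_loc_off_diagonal haar_kernel"
  unfolding L1_loc_off_diagonal_def Let_def
proof (intro conjI allI impI)
  let ?\<Omega> = "{(x, y). 0 \<le> x \<and> 0 \<le> y \<and> x \<noteq> y} :: (real \<times> real) set"
  show "(\<lambda>(x, y). haar_kernel x y i) \<in> borel_measurable (lebesgue_on ?\<Omega>)" for i
    by (intro borel_measurable_lebesgue_on borel_measurable_haar_kernel)
  show "AE (x, y) in lebesgue_on ?\<Omega>. haar_kernel x y \<in> l2"
    by (rule AE_I2) (auto simp: space_restrict_space haar_kernel_size)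
  fix C :: "(real \<times> real) set"
  assume "compact C \<and> C \<subseteq> ?\<Omega>"
  then have C: "compact C" "C \<subseteq> ?\<Omega>" by auto
  obtain e where e: "0 < e" "\<And>x y. (x, y) \<in> C \<Longrightarrow> e \<le> \<bar>x - y\<bar>"
  proof (cases "C = {}")
    case False
    have "continuous_on C (\<lambda>p. \<bar>fst p - snd p\<bar>)"
      by (intro continuous_intros)
    from continuous_attains_inf[OF C(1) False this]
    obtain p where p: "p \<in> C" "\<forall>q\<in>C. \<bar>fst p - snd p\<bar> \<le> \<bar>fst q - snd q\<bar>"
      by (elim bexE) (rule that)
    have "0 < \<bar>fst p - snd p\<bar>"
      using p(1) C(2) by auto
    then show ?thesis
    proof (rule that)
      fix x y assume "(x, y) \<in> C"
      then show "\<bar>fst p - snd p\<bar> \<le> \<bar>x - y\<bar>"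
        using p(2) by fastforce
    qed
  qed (use that[of 1] in auto)
  interpret finite_measure "lebesgue_on C"
    using C(1) by (intro finite_measure_lebesgue_on lmeasurable_compact)
  have K: "(\<lambda>p. haar_kernel (fst p) (snd p) i) \<in> borel_measurable (lebesgue_on C)" for i
    using borel_measurable_lebesgue_on[OF borel_measurable_haar_kernel] by (simp add: split_beta')
  show "integrable (lebesgue_on C) (\<lambda>(x, y). l2_norm (haar_kernel x y))"
  proof (rule integrable_const_bound[of _ "2 / e"])
    show "(\<lambda>(x, y). l2_norm (haar_kernel x y)) \<in> borel_measurable (lebesgue_on C)"
      unfolding case_prod_beta l2_norm_def using K by measurable
    show "AE p in lebesgue_on C. norm (case p of (x, y) \<Rightarrow> l2_norm (haar_kernel x y)) \<le> 2 / e"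
    proof (rule AE_I2, clarify)
      fix x y assume "(x, y) \<in> space (lebesgue_on C)"
      then have xy: "(x, y) \<in> C" "0 \<le> x" "0 \<le> y" "x \<noteq> y"
        using C(2) by (auto simp: space_restrict_space)
      have "l2_norm (haar_kernel x y) \<le> 2 / dyadic_dist x y"
        using xy by (intro haar_kernel_size)
      also have "\<dots> \<le> 2 / e"
        using e xy abs_diff_le_dyadic_dist[of x y] by (intro divide_left_mono) (auto intro: order_trans dyadic_dist_pos)
      finally have "l2_norm (haar_kernel x y) \<le> 2 / e" .
      moreover have "0 \<le> l2_norm (haar_kernel x y)"
        using haar_kernel_size(1)[OF xy(2-4)] by (simp add: l2_norm_def l2_def suminf_nonneg)
      ultimately show "norm (l2_norm (haar_kernel x y)) \<le> 2 / e"
        by simp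
    qed
  qed
qed

lemma dyadic_dist_nonneg: "0 \<le> dyadic_dist x y"
  by (simp add: dyadic_dist_def)

lemma haar_kernel_cz: "l2_cz_kernel haar_kernel"
proof -
  have z: "l2_norm (\<lambda>i. 0) = 0"
    by (simp add: l2_norm_def)
  \<comment> \<open>The left sides of both smoothness conditions are 0, so nonnegative right sides
    suffice, and 1 serves for both \<open>C1\<close> and \<open>\<gamma>\<close>.\<close>
  have rhs: "0 \<le> 1 * (dyadic_dist a b / dyadic_dist x y powr (1 + 1))" for a b x y
    using dyadic_dist_nonneg by simp
  have 1: "\<forall>x\<ge>0. \<forall>x'\<ge>0. \<forall>y\<ge>0. x \<noteq> y \<and> 2 * dyadic_dist x' x \<le> dyadic_dist x y \<longrightarrow>
      l2_norm (\<lambda>i. haar_kernel x' y i - haar_kernel x y i)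
        \<le> 1 * (dyadic_dist x' x / dyadic_dist x y powr (1 + 1))"
  proof (intro allI impI, elim conjE)
    fix x x' y :: real
    assume *: "0 \<le> x" "0 \<le> x'" "0 \<le> y" "x \<noteq> y" "2 * dyadic_dist x' x \<le> dyadic_dist x y"
    show "l2_norm (\<lambda>i. haar_kernel x' y i - haar_kernel x y i)
        \<le> 1 * (dyadic_dist x' x / dyadic_dist x y powr (1 + 1))"
      using haar_kernel_locally_constant[OF *] rhs z by simp
  qed
  have 2: "\<forall>x\<ge>0. \<forall>y\<ge>0. \<forall>y'\<ge>0. x \<noteq> y \<and> 2 * dyadic_dist y y' \<le> dyadic_dist x y \<longrightarrow>
      l2_norm (\<lambda>i. haar_kernel x y' i - haar_kernel x y i)
        \<le> 1 * (dyadic_dist y y' / dyadic_dist x y powr (1 + 1))"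
  proof (intro allI impI, elim conjE)
    fix x y y' :: real
    assume *: "0 \<le> x" "0 \<le> y" "0 \<le> y'" "x \<noteq> y" "2 * dyadic_dist y y' \<le> dyadic_dist x y"
    \<comment> \<open>Smoothness in the second variable follows from the first by symmetry of the
      kernel.\<close>
    have "haar_kernel y' x = haar_kernel y x"
      using * dyadic_dist_commute by (intro haar_kernel_locally_constant) auto
    then show "l2_norm (\<lambda>i. haar_kernel x y' i - haar_kernel x y i)
        \<le> 1 * (dyadic_dist y y' / dyadic_dist x y powr (1 + 1))"
      using rhs z by (simp add: haar_kernel_commute[of x])
  qed
  show ?thesis
    unfolding l2_cz_kernel_def
  proof (intro conjI)
    show "\<exists>C0>0. \<forall>x\<ge>0. \<forall>y\<ge>0. x \<noteq> y \<longrightarrow> l2_norm (haar_kernel x y) \<le> C0 / dyadic_dist x y"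
      by (rule exI[of _ 2]) (auto simp: haar_kernel_size)
    show "\<forall>x\<ge>0. \<forall>y\<ge>0. x \<noteq> y \<longrightarrow> haar_kernel x y \<in> l2"
      by (auto simp: haar_kernel_size)
    show "\<exists>C1>0. \<exists>\<gamma>>0.
        (\<forall>x\<ge>0. \<forall>x'\<ge>0. \<forall>y\<ge>0. x \<noteq> y \<and> 2 * dyadic_dist x' x \<le> dyadic_dist x y \<longrightarrow>
           l2_norm (\<lambda>i. haar_kernel x' y i - haar_kernel x y i)
             \<le> C1 * (dyadic_dist x' x / dyadic_dist x y powr (1 + \<gamma>))) \<and>
        (\<forall>x\<ge>0. \<forall>y\<ge>0. \<forall>y'\<ge>0. x \<noteq> y \<and> 2 * dyadic_dist y y' \<le> dyadic_dist x y \<longrightarrow>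
           l2_norm (\<lambda>i. haar_kernel x y' i - haar_kernel x y i)
             \<le> C1 * (dyadic_dist y y' / dyadic_dist x y powr (1 + \<gamma>)))"
      using 1 2 by (intro exI[of _ "1::real"] conjI) (simp_all only: zero_less_one)
  qed (rule haar_kernel_L1_loc)
qed

subsection \<open>Dense subspaces\<close>

text \<open>Borel functions, so that products of functions of \<open>x\<close> and of \<open>y\<close> are measurable.\<close>

definition bounded_support_functions :: "(real \<Rightarrow> real) set" where
  "bounded_support_functions = {\<phi> \<in> borel_measurable borel.
     \<exists>R. \<forall>x. \<bar>\<phi> x\<bar> \<le> R \<and> (\<phi> x \<noteq> 0 \<longrightarrow> 0 \<le> x \<and> x \<le> R)}"

lemma bounded_support_functionsE:
  assumes "\<phi> \<in> bounded_support_functions"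
  obtains R where "0 \<le> R" "\<forall>x. \<bar>\<phi> x\<bar> \<le> R" "\<forall>x. \<phi> x \<noteq> 0 \<longrightarrow> 0 \<le> x \<and> x \<le> R"
proof -
  obtain R where R: "\<forall>x. \<bar>\<phi> x\<bar> \<le> R \<and> (\<phi> x \<noteq> 0 \<longrightarrow> 0 \<le> x \<and> x \<le> R)"
    using assms by (auto simp: bounded_support_functions_def)
  have "0 \<le> R"
    using R[rule_format, of 0] by linarith
  then show ?thesis
    using R by (intro that[of R]) auto
qed

lemma bounded_support_functions_zero: "(\<lambda>x. 0) \<in> bounded_support_functions"
  by (auto simp: bounded_support_functions_def)

lemma bounded_support_functions_linear:
  assumes f: "f \<in> bounded_support_functions" and g: "g \<in> bounded_support_functions"
  shows "(\<lambda>x. a * f x + b * g x) \<in> bounded_support_functions"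
proof -
  obtain R where "0 \<le> R" "\<forall>x. \<bar>f x\<bar> \<le> R" "\<forall>x. f x \<noteq> 0 \<longrightarrow> 0 \<le> x \<and> x \<le> R"
    by (rule bounded_support_functionsE[OF f])
  then have R: "0 \<le> R" "\<And>x. \<bar>f x\<bar> \<le> R" "\<And>x. f x \<noteq> 0 \<Longrightarrow> 0 \<le> x"
      "\<And>x. f x \<noteq> 0 \<Longrightarrow> x \<le> R"
    by auto
  obtain Q where "0 \<le> Q" "\<forall>x. \<bar>g x\<bar> \<le> Q" "\<forall>x. g x \<noteq> 0 \<longrightarrow> 0 \<le> x \<and> x \<le> Q"
    by (rule bounded_support_functionsE[OF g])
  then have Q: "0 \<le> Q" "\<And>x. \<bar>g x\<bar> \<le> Q" "\<And>x. g x \<noteq> 0 \<Longrightarrow> 0 \<le> x"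
      "\<And>x. g x \<noteq> 0 \<Longrightarrow> x \<le> Q"
    by auto
  have "\<bar>a * f x + b * g x\<bar> \<le> \<bar>a\<bar> * R + \<bar>b\<bar> * Q + R + Q" for x
  proof -
    have "\<bar>a * f x + b * g x\<bar> \<le> \<bar>a\<bar> * \<bar>f x\<bar> + \<bar>b\<bar> * \<bar>g x\<bar>"
      using abs_triangle_ineq[of "a * f x" "b * g x"] by (simp add: abs_mult)
    also have "\<dots> \<le> \<bar>a\<bar> * R + \<bar>b\<bar> * Q"
      using R(2)[of x] Q(2)[of x] by (intro add_mono mult_left_mono) auto
    finally show ?thesis
      using R(1) Q(1) by linarith
  qed
  moreover have "0 \<le> x \<and> x \<le> \<bar>a\<bar> * R + \<bar>b\<bar> * Q + R + Q" if "a * f x + b * g x \<noteq> 0" for x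
  proof -
    have nn: "0 \<le> \<bar>a\<bar> * R" "0 \<le> \<bar>b\<bar> * Q"
      using R(1) Q(1) by auto
    have "f x \<noteq> 0 \<or> g x \<noteq> 0"
      using that by auto
    then show ?thesis
      using R(1) R(3,4)[of x] Q(1) Q(3,4)[of x] nn by linarith
  qed
  moreover have "(\<lambda>x. a * f x + b * g x) \<in> borel_measurable borel"
    using f g by (auto simp: bounded_support_functions_def)
  ultimately show ?thesis
    unfolding bounded_support_functions_def by blast
qed

text \<open>Moves integrals to the Borel measure, on whose product Fubini's theorem is
  applied.\<close>

lemma integral_rplus_eq_lborel:
  fixes f :: "real \<Rightarrow> real"
  assumes "f \<in> borel_measurable borel" and "\<And>x. x < 0 \<Longrightarrow> f x = 0"
  shows "integrable rplus f \<longleftrightarrow> integrable lborel f" "integral\<^sup>L rplus f = integral\<^sup>L lborel f"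
proof -
  have eq: "indicator {0..} x * f x = f x" for x
    using assms(2)[of x] by (cases "x < 0") auto
  show "integrable rplus f \<longleftrightarrow> integrable lborel f"
    using assms(1) by (subst integrable_restrict_space) (auto simp: eq integrable_completion)
  show "integral\<^sup>L rplus f = integral\<^sup>L lborel f"
    using assms(1) by (subst integral_restrict_space) (auto simp: eq integral_completion)
qed

lemma integrable_lborel_bounded_support:
  fixes f :: "real \<Rightarrow> real"
  assumes "f \<in> borel_measurable borel" "\<And>x. \<bar>f x\<bar> \<le> B" "\<And>x. f x \<noteq> 0 \<Longrightarrow> 0 \<le> x \<and> x \<le> R"
  shows "integrable lborel f"
proof (rule Bochner_Integration.integrable_bound)
  show "integrable lborel (\<lambda>x. B * indicator {0..R} x :: real)"
    by (intro integrable_mult_right integrable_real_indicator) (auto simp: emeasure_lborel_Icc_eq)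
  show "AE x in lborel. norm (f x) \<le> norm (B * indicator {0..R} x :: real)"
  proof (rule AE_I2)
    fix x
    show "norm (f x) \<le> norm (B * indicator {0..R} x :: real)"
      using assms(2)[of x] assms(3)[of x] by (cases "f x = 0") auto
  qed
qed (use assms(1) in simp)

lemma bounded_support_functions_integrable:
  assumes "\<phi> \<in> bounded_support_functions" and h: "h \<in> borel_measurable borel" "\<And>x. \<bar>h x\<bar> \<le> B"
  shows "integrable lborel (\<lambda>x. h x * \<phi> x)"
proof -
  obtain R where "0 \<le> R" "\<forall>x. \<bar>\<phi> x\<bar> \<le> R" "\<forall>x. \<phi> x \<noteq> 0 \<longrightarrow> 0 \<le> x \<and> x \<le> R"
    by (rule bounded_support_functionsE[OF assms(1)])
  then have R: "0 \<le> R" "\<And>x. \<bar>\<phi> x\<bar> \<le> R" "\<And>x. \<phi> x \<noteq> 0 \<Longrightarrow> 0 \<le> x"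
      "\<And>x. \<phi> x \<noteq> 0 \<Longrightarrow> x \<le> R"
    by auto
  have B: "0 \<le> B"
    using h(2)[of 0] by linarith
  show ?thesis
  proof (rule integrable_lborel_bounded_support)
    show "(\<lambda>x. h x * \<phi> x) \<in> borel_measurable borel"
      using assms(1) h(1) by (auto simp: bounded_support_functions_def)
    show "\<bar>h x * \<phi> x\<bar> \<le> B * R" for x
      using h(2)[of x] R(2)[of x] B by (simp add: abs_mult mult_mono)
  qed (use R in auto)
qed

lemma bounded_support_functions_in_L2:
  assumes "\<phi> \<in> bounded_support_functions"
  shows "\<phi> \<in> Lp 2"
proof -
  have m: "\<phi> \<in> borel_measurable borel"
    using assms by (simp add: bounded_support_functions_def)
  obtain R where "0 \<le> R" "\<forall>x. \<bar>\<phi> x\<bar> \<le> R" "\<forall>x. \<phi> x \<noteq> 0 \<longrightarrow> 0 \<le> x \<and> x \<le> R"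
    by (rule bounded_support_functionsE[OF assms])
  then have R: "0 \<le> R" "\<And>x. \<bar>\<phi> x\<bar> \<le> R" "\<And>x. \<phi> x \<noteq> 0 \<Longrightarrow> 0 \<le> x"
      "\<And>x. \<phi> x \<noteq> 0 \<Longrightarrow> x \<le> R"
    by auto
  have "integrable lborel (\<lambda>x. \<phi> x * \<phi> x)"
    by (rule bounded_support_functions_integrable[OF assms m R(2)])
  then have "integrable rplus (\<lambda>x. (\<phi> x)\<^sup>2)"
    using m R(3) by (subst integral_rplus_eq_lborel(1)) (force simp: power2_eq_square)+
  then show ?thesis
    using m by (simp add: Lp_2_iff borel_measurable_lebesgue_on)
qed

lemma rplus_borel_representative:
  fixes f :: "real \<Rightarrow> real"
  assumes "f \<in> borel_measurable rplus"
  obtains f' where "f' \<in> borel_measurable borel" "AE x in rplus. f x = f' x"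
proof -
  have "(\<lambda>x. indicator {0..} x *\<^sub>R f x) \<in> borel_measurable lebesgue"
    using assms by (subst (asm) borel_measurable_restrict_space_iff) auto
  then obtain f' where f': "f' \<in> borel_measurable lborel" "AE x in lborel. indicator {0..} x *\<^sub>R f x = f' x"
    using completion_ex_borel_measurable_real by blast
  have "AE x in lebesgue. indicator {0..} x *\<^sub>R f x = f' x"
    using f'(2) by (rule AE_completion)
  then have "AE x in rplus. f x = f' x"
    by (auto simp: AE_restrict_space_iff elim!: eventually_mono)
  then show ?thesis
    using f'(1) that by auto
qed

text \<open>A Borel representative is truncated to arguments and values of size at most
  \<open>n\<close>; the error is dominated by \<open>f\<close> and is eventually 0 at almost every
  point.\<close>

lemma bounded_support_functions_dense:
  assumes f: "f \<in> Lp 2" and e: "0 < e"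
  shows "\<exists>\<phi>\<in>bounded_support_functions. Lp_norm 2 (\<lambda>x. f x - \<phi> x) < e"
proof -
  have "f \<in> borel_measurable rplus"
    using f by (simp add: Lp_2_iff)
  then obtain f' where f': "f' \<in> borel_measurable borel" "AE x in rplus. f x = f' x"
    by (rule rplus_borel_representative)
  define \<phi> where "\<phi> n x = (if 0 \<le> x \<and> x \<le> real n \<and> \<bar>f' x\<bar> \<le> real n then f' x else 0)" for n x
  have meas: "\<phi> n \<in> borel_measurable borel" for n
    unfolding \<phi>_def[abs_def] using f'(1) by measurable
  have "\<forall>x. \<bar>\<phi> n x\<bar> \<le> real n \<and> (\<phi> n x \<noteq> 0 \<longrightarrow> 0 \<le> x \<and> x \<le> real n)" for n
    by (simp add: \<phi>_def)
  with meas have S: "\<phi> n \<in> bounded_support_functions" for n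
    unfolding bounded_support_functions_def by blast
  have "(\<lambda>n. LINT x|rplus. (f x - \<phi> n x)\<^sup>2) \<longlonglongrightarrow> (LINT x|rplus. 0)"
  proof (rule integral_dominated_convergence)
    show "integrable rplus (\<lambda>x. (f x)\<^sup>2)"
      using f by (simp add: Lp_2_iff)
    show "(\<lambda>x. (f x - \<phi> n x)\<^sup>2) \<in> borel_measurable rplus" for n
      using f borel_measurable_lebesgue_on[OF meas] by (auto simp: Lp_2_iff)
    show "AE x in rplus. norm ((f x - \<phi> n x)\<^sup>2) \<le> (f x)\<^sup>2" for n
      using f'(2) by eventually_elim (auto simp: \<phi>_def)
    have "AE x in rplus. 0 \<le> x"
      by (rule AE_I2) simp
    then show "AE x in rplus. (\<lambda>n. (f x - \<phi> n x)\<^sup>2) \<longlonglongrightarrow> 0"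
      using f'(2)
    proof eventually_elim
      case (elim x)
      obtain N where N: "x \<le> real N" "\<bar>f' x\<bar> \<le> real N"
        using real_arch_simple[of "max x \<bar>f' x\<bar>"] by auto
      have "\<forall>\<^sub>F n in sequentially. (f x - \<phi> n x)\<^sup>2 = 0"
        unfolding eventually_sequentially
      proof (intro exI allI impI)
        fix n assume "N \<le> n"
        then have "x \<le> real n" "\<bar>f' x\<bar> \<le> real n"
          using N by linarith+
        then show "(f x - \<phi> n x)\<^sup>2 = 0"
          using elim by (simp add: \<phi>_def)
      qed
      then show ?case
        by (rule tendsto_eventually)
    qed
  qed simp
  from order_tendstoD(2)[OF this, of "e\<^sup>2"] e
  obtain n where "(LINT x|rplus. (f x - \<phi> n x)\<^sup>2) < e\<^sup>2"
    by (auto simp: eventually_sequentially)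
  then have "(Lp_norm 2 (\<lambda>x. f x - \<phi> n x))\<^sup>2 < e\<^sup>2"
    by (simp add: Lp_norm_2_square)
  then have "Lp_norm 2 (\<lambda>x. f x - \<phi> n x) < e"
    using e power_less_imp_less_base[of "Lp_norm 2 (\<lambda>x. f x - \<phi> n x)" 2 e] by simp
  then show ?thesis
    using S by blast
qed

lemma dense_subspace_bounded_support: "dense_subspace_L2 bounded_support_functions"
  unfolding dense_subspace_L2_def
proof (intro conjI ballI allI impI)
  show "bounded_support_functions \<subseteq> Lp 2"
    using bounded_support_functions_in_L2 by blast
qed (simp_all add: bounded_support_functions_zero bounded_support_functions_linear
    bounded_support_functions_dense)

text \<open>The bound \<open>M\<close> is uniform in \<open>x\<close>, so l^2 inner products with
  such a function are sums of a fixed finite number of terms.\<close>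

definition finite_bounded_support_functions :: "(real \<Rightarrow> nat \<Rightarrow> real) set" where
  "finite_bounded_support_functions = {\<psi>. (\<forall>i. (\<lambda>x. \<psi> x i) \<in> bounded_support_functions) \<and>
     (\<exists>M. \<forall>x. \<forall>i\<ge>M. \<psi> x i = 0)}"

lemma finite_bounded_support_in_L2:
  assumes "\<psi> \<in> finite_bounded_support_functions"
  shows "\<psi> \<in> Lp_l2 2"
proof -
  obtain M where M: "\<And>x i. M \<le> i \<Longrightarrow> \<psi> x i = 0"
    using assms by (auto simp: finite_bounded_support_functions_def)
  have L2: "(\<lambda>x. \<psi> x i) \<in> Lp 2" for i
    using assms by (simp add: finite_bounded_support_functions_def bounded_support_functions_in_L2)
  have "(\<Sum>i<N. LINT x|rplus. (\<psi> x i)\<^sup>2) \<le> (\<Sum>i<M. LINT x|rplus. (\<psi> x i)\<^sup>2)" for N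
  proof -
    have "(\<Sum>i<N. LINT x|rplus. (\<psi> x i)\<^sup>2) \<le> (\<Sum>i<max N M. LINT x|rplus. (\<psi> x i)\<^sup>2)"
      by (intro sum_mono2) auto
    also have "\<dots> = (\<Sum>i<M. LINT x|rplus. (\<psi> x i)\<^sup>2)"
      by (rule sum.mono_neutral_right) (auto simp: M)
    finally show ?thesis .
  qed
  from Lp_l2_2I(1)[OF L2 this] show ?thesis .
qed

lemma finite_bounded_support_linear:
  assumes "F \<in> finite_bounded_support_functions" "G \<in> finite_bounded_support_functions"
  shows "(\<lambda>x i. a * F x i + b * G x i) \<in> finite_bounded_support_functions"
proof -
  obtain M N where M: "\<And>x i. M \<le> i \<Longrightarrow> F x i = 0" and N: "\<And>x i. N \<le> i \<Longrightarrow> G x i = 0"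
    using assms unfolding finite_bounded_support_functions_def by blast
  have "\<forall>x. \<forall>i\<ge>max M N. a * F x i + b * G x i = 0"
    by (simp add: M N)
  moreover have "(\<lambda>x. a * F x i + b * G x i) \<in> bounded_support_functions" for i
    using assms by (intro bounded_support_functions_linear) (auto simp: finite_bounded_support_functions_def)
  ultimately show ?thesis
    unfolding finite_bounded_support_functions_def by blast
qed

text \<open>Dropping the components from \<open>M\<close> on costs less than
  \<open>e\<^sup>2 / 4\<close> of the squared norm; approximating the first \<open>M\<close>
  separately costs at most as much again.\<close>

lemma finite_bounded_support_dense:
  assumes F: "F \<in> Lp_l2 2" and e: "0 < e"
  shows "\<exists>G\<in>finite_bounded_support_functions. Lp_l2_norm 2 (\<lambda>x i. F x i - G x i) < e"
proof -
  let ?a = "\<lambda>i. LINT x|rplus. (F x i)\<^sup>2"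
  have L2: "(\<lambda>x. F x i) \<in> Lp 2" for i
    using F by (rule Lp_l2_2D)
  have sm: "summable ?a"
    using Lp_l2_2D(2)[OF F] by (intro summableI_nonneg_bounded) auto
  then have "\<forall>\<^sub>F M in sequentially. dist (\<Sum>i<M. ?a i) (suminf ?a) < e\<^sup>2 / 4"
    using e by (intro tendstoD summable_LIMSEQ) auto
  then obtain M where "dist (\<Sum>i<M. ?a i) (suminf ?a) < e\<^sup>2 / 4"
    by (auto simp: eventually_sequentially)
  then have M: "suminf ?a - (\<Sum>i<M. ?a i) < e\<^sup>2 / 4"
    unfolding dist_real_def by linarith
  \<comment> \<open>\<open>M\<close> copies of \<open>d\<^sup>2\<close> add up to at most
    \<open>e\<^sup>2 / 4\<close>; \<open>M + 1\<close> keeps \<open>d\<close> positive when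
    \<open>M = 0\<close>.\<close>
  define d where "d = e / (2 * sqrt (real M + 1))"
  have d: "0 < d"
    using e by (simp add: d_def add_nonneg_pos)
  have "\<forall>i. \<exists>\<phi>\<in>bounded_support_functions. Lp_norm 2 (\<lambda>x. F x i - \<phi> x) < d"
    using bounded_support_functions_dense[OF L2 d] by blast
  then obtain \<phi> where \<phi>: "\<And>i. \<phi> i \<in> bounded_support_functions"
      "\<And>i. Lp_norm 2 (\<lambda>x. F x i - \<phi> i x) < d"
    by metis
  define G where "G x i = (if i < M then \<phi> i x else 0)" for x i
  have "(\<lambda>x. G x i) \<in> bounded_support_functions" for i
    by (cases "i < M") (simp_all add: G_def \<phi>(1) bounded_support_functions_zero)
  moreover have "\<forall>x. \<forall>i\<ge>M. G x i = 0"
    by (simp add: G_def)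
  ultimately have G: "G \<in> finite_bounded_support_functions"
    unfolding finite_bounded_support_functions_def by blast
  have diff: "(\<lambda>x. F x i - G x i) \<in> Lp 2" for i
    using L2 bounded_support_functions_in_L2[OF \<open>(\<lambda>x. G x i) \<in> bounded_support_functions\<close>]
    by (rule Lp_2_diff)
  let ?b = "\<lambda>i. LINT x|rplus. (F x i - G x i)\<^sup>2"
  have small: "?b i \<le> d\<^sup>2" if "i < M" for i
  proof -
    have "(Lp_norm 2 (\<lambda>x. F x i - \<phi> i x))\<^sup>2 \<le> d\<^sup>2"
      using \<phi>(2)[of i] Lp_norm_2_nonneg by (intro power_mono) auto
    then show ?thesis
      using that by (simp add: Lp_norm_2_square G_def)
  qed
  have "(\<Sum>i<N. ?b i) \<le> e\<^sup>2 / 2" for N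
  proof -
    have "(\<Sum>i<N. ?b i) \<le> (\<Sum>i<max M N. ?b i)"
      by (intro sum_mono2) auto
    also have "\<dots> = (\<Sum>i<M. ?b i) + (\<Sum>i=M..<max M N. ?b i)"
      using sum.atLeastLessThan_concat[of 0 M "max M N" ?b] by (simp add: lessThan_atLeast0)
    also have "(\<Sum>i=M..<max M N. ?b i) = (\<Sum>i=M..<max M N. ?a i)"
      by (intro sum.cong) (auto simp: G_def)
    also have "\<dots> = (\<Sum>i<max M N. ?a i) - (\<Sum>i<M. ?a i)"
      using sum.atLeastLessThan_concat[of 0 M "max M N" ?a] by (simp add: lessThan_atLeast0)
    also have "\<dots> \<le> suminf ?a - (\<Sum>i<M. ?a i)"
      using sm by (intro diff_right_mono sum_le_suminf) auto
    also have "(\<Sum>i<M. ?b i) \<le> (\<Sum>i<M. d\<^sup>2)"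
      by (intro sum_mono small) simp
    also have "(\<Sum>i<M. d\<^sup>2) = e\<^sup>2 / 4 * (real M / (real M + 1))"
      by (simp add: d_def power_divide power_mult_distrib add_nonneg_nonneg)
    also have "\<dots> \<le> e\<^sup>2 / 4 * 1"
      by (intro mult_left_mono) auto
    finally show ?thesis
      using M by simp
  qed
  from Lp_l2_2I(2)[OF diff this] have "Lp_l2_norm 2 (\<lambda>x i. F x i - G x i) \<le> sqrt (e\<^sup>2 / 2)" .
  also have "\<dots> < sqrt (e\<^sup>2)"
    using e by (intro real_sqrt_less_mono) simp
  finally show ?thesis
    using G e by auto
qed

lemma dense_subspace_finite_bounded_support: "dense_subspace_L2_l2 finite_bounded_support_functions"
proof -
  have "(\<lambda>x i. 0) \<in> finite_bounded_support_functions"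
    by (auto simp: finite_bounded_support_functions_def bounded_support_functions_zero)
  moreover have "finite_bounded_support_functions \<subseteq> Lp_l2 2"
    using finite_bounded_support_in_L2 by blast
  ultimately show ?thesis
    unfolding dense_subspace_L2_l2_def
    by (simp add: finite_bounded_support_linear finite_bounded_support_dense)
qed

subsection \<open>Representation off the diagonal\<close>

text \<open>There are countably many dyadic intervals, so off one null set \<open>g\<close> vanishes
  at each point of an interval on which it vanishes almost everywhere. A point outside the support
  has a ball, and inside it a dyadic interval around the point, of that kind.\<close>

lemma AE_dyadic_supp: "AE x in rplus. g x \<noteq> 0 \<longrightarrow> x \<in> dyadic_supp g"
proof -
  define Q where "Q j k \<longleftrightarrow> (AE y in rplus. y \<in> dyadic_interval j k \<longrightarrow> g y = 0)" for j k
  have "AE x in rplus. \<forall>j. \<forall>k. Q j k \<longrightarrow> x \<in> dyadic_interval j k \<longrightarrow> g x = 0"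
    unfolding AE_all_countable
  proof (intro allI)
    show "AE x in rplus. Q j k \<longrightarrow> x \<in> dyadic_interval j k \<longrightarrow> g x = 0" for j k
      by (cases "Q j k") (simp_all add: Q_def)
  qed
  moreover have "AE x in rplus. 0 \<le> x"
    by (rule AE_I2) simp
  ultimately show ?thesis
  proof eventually_elim
    case (elim x)
    have "\<not> (AE y in rplus. dyadic_dist x y < r \<longrightarrow> g y = 0)" if g: "g x \<noteq> 0" and r: "0 < r" for r
    proof
      assume AE: "AE y in rplus. dyadic_dist x y < r \<longrightarrow> g y = 0"
      obtain n where n: "(1 / 2) ^ n < r"
        using real_arch_pow_inv[OF r, of "1/2"] by auto
      define k where "k = nat (dyadic_index (int n) x)"
      have k: "dyadic_index (int n) x = int k"
        using dyadic_index_nonneg[OF elim(2)] by (simp add: k_def)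
      have pos: "AE y in rplus. 0 \<le> y"
        by (rule AE_I2) simp
      have "Q (int n) k"
        unfolding Q_def using AE pos
      proof eventually_elim
        case (elim y)
        show ?case
        proof
          assume "y \<in> dyadic_interval (int n) k"
          then have "dyadic_dist x y \<le> 2 powi (- int n)"
            using \<open>0 \<le> x\<close> elim k by (intro dyadic_dist_le) (auto simp: dyadic_interval_iff)
          also have "\<dots> = (1 / 2) ^ n"
            by (simp add: power_int_minus power_one_over inverse_eq_divide)
          finally show "g y = 0"
            using elim n by simp
        qed
      qed
      then show False
        using elim(1) k g by (auto simp: dyadic_interval_iff)
    qed
    then show ?case
      using elim(2) by (auto simp: dyadic_supp_def)
  qed
qed

section \<open>Null sets and integrals on the product space\<close>

lemma AE_rplus_iff: "(AE x in rplus. P x) \<longleftrightarrow> (AE x in lborel. 0 \<le> x \<longrightarrow> P x)"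
  by (simp add: AE_restrict_space_iff AE_completion_iff)

lemma AE_lborel_fst:
  assumes "AE x in lborel. P (x :: real)"
  shows "AE p in (lborel :: (real \<times> real) measure). P (fst p)"
proof -
  obtain N where N: "{x. \<not> P x} \<subseteq> N" "N \<in> null_sets lborel"
    using assms by (auto elim!: AE_E simp: null_sets_def)
  have "N \<times> (UNIV :: real set) \<in> null_sets (lborel \<Otimes>\<^sub>M lborel)"
    using N(2) by (auto simp: null_sets_def lborel.emeasure_pair_measure_Times)
  then have "AE p in (lborel :: (real \<times> real) measure). p \<notin> N \<times> UNIV"
    unfolding lborel_prod by (rule AE_not_in)
  then show ?thesis
    using N(1) by (auto elim!: eventually_mono simp: mem_Times_iff)
qed

lemma AE_lborel_snd:
  assumes "AE x in lborel. P (x :: real)"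
  shows "AE p in (lborel :: (real \<times> real) measure). P (snd p)"
proof -
  obtain N where N: "{x. \<not> P x} \<subseteq> N" "N \<in> null_sets lborel"
    using assms by (auto elim!: AE_E simp: null_sets_def)
  have "(UNIV :: real set) \<times> N \<in> null_sets (lborel \<Otimes>\<^sub>M lborel)"
    using N(2) by (auto simp: null_sets_def lborel.emeasure_pair_measure_Times)
  then have "AE p in (lborel :: (real \<times> real) measure). p \<notin> UNIV \<times> N"
    unfolding lborel_prod by (rule AE_not_in)
  then show ?thesis
    using N(1) by (auto elim!: eventually_mono simp: mem_Times_iff)
qed

lemma borel_measurable_fst_snd:
  fixes f g :: "real \<Rightarrow> real"
  assumes f: "f \<in> borel_measurable borel" and g: "g \<in> borel_measurable borel"
  shows "(\<lambda>p. f (fst p)) \<in> borel_measurable (borel :: (real \<times> real) measure)"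
    and "(\<lambda>p. g (snd p)) \<in> borel_measurable (borel :: (real \<times> real) measure)"
  by (rule measurable_compose[OF _ f] measurable_compose[OF _ g],
      intro borel_measurable_continuous_onI continuous_intros)+

lemma has_bochner_integral_lborel_product:
  fixes f g :: "real \<Rightarrow> real"
  assumes f: "integrable lborel f" and g: "integrable lborel g"
  shows "has_bochner_integral lborel (\<lambda>p. f (fst p) * g (snd p)) (integral\<^sup>L lborel f * integral\<^sup>L lborel g)"
proof -
  have "(\<lambda>p. f (fst p) * g (snd p)) \<in> borel_measurable (borel :: (real \<times> real) measure)"
    using f g by (intro borel_measurable_times borel_measurable_fst_snd) auto
  then have int: "integrable (lborel \<Otimes>\<^sub>M lborel) (\<lambda>p. f (fst p) * g (snd p))"
  proof (intro lborel_pair.Fubini_integrable)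
    show "integrable lborel (\<lambda>x. \<integral>y. norm (f (fst (x, y)) * g (snd (x, y))) \<partial>lborel)"
      using f g by (simp add: abs_mult)
    show "AE x in lborel. integrable lborel (\<lambda>y. f (fst (x, y)) * g (snd (x, y)))"
      using g by simp
  qed (simp add: lborel_prod)
  have "integral\<^sup>L (lborel \<Otimes>\<^sub>M lborel) (\<lambda>p. f (fst p) * g (snd p)) = integral\<^sup>L lborel f * integral\<^sup>L lborel g"
    using lborel_pair.integral_fst'[OF int] by simp
  then show ?thesis
    using int by (simp add: has_bochner_integral_iff lborel_prod)
qed

lemma has_bochner_integral_lebesgue_on:
  fixes f :: "'a::euclidean_space \<Rightarrow> real"
  assumes f: "has_bochner_integral lborel f I" and S: "S \<in> sets lebesgue" and out: "\<And>x. x \<notin> S \<Longrightarrow> f x = 0"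
  shows "has_bochner_integral (lebesgue_on S) f I"
proof -
  have eq: "indicator S x * f x = f x" for x
    using out by (cases "x \<in> S") auto
  have m: "f \<in> borel_measurable lborel"
    using f by (rule borel_measurable_has_bochner_integral)
  have "integrable (lebesgue_on S) f"
    using f m S by (subst integrable_restrict_space) (simp_all add: eq integrable_completion has_bochner_integral_iff)
  moreover have "integral\<^sup>L (lebesgue_on S) f = I"
    using f m S by (subst integral_restrict_space) (simp_all add: eq integral_completion has_bochner_integral_iff)
  ultimately show ?thesis
    by (simp add: has_bochner_integral_iff)
qed

text \<open>By the Cauchy-Schwarz inequality the inner product with \<open>g\<close> is continuous
  and passes through the unordered sum.\<close>

lemma L2_inner_has_L2_sum:
  assumes f: "has_L2_sum f F" and g: "g \<in> Lp 2"
  shows "((\<lambda>j. L2_inner (f j) g) has_sum L2_inner F g) UNIV"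
  unfolding has_sum_def
proof (rule Lim_transform)
  have L2: "\<And>j. f j \<in> Lp 2" "F \<in> Lp 2"
    using f by (auto simp: has_L2_sum_def)
  let ?S = "\<lambda>J x. \<Sum>j\<in>J. f j x"
  have "((\<lambda>J. Lp_norm 2 (\<lambda>x. ?S J x - F x) * Lp_norm 2 g) \<longlongrightarrow> 0 * Lp_norm 2 g) (finite_subsets_at_top UNIV)"
    using f by (intro tendsto_mult tendsto_const) (simp add: has_L2_sum_def)
  then have lim: "((\<lambda>J. Lp_norm 2 (\<lambda>x. ?S J x - F x) * Lp_norm 2 g) \<longlongrightarrow> 0) (finite_subsets_at_top UNIV)"
    by simp
  have "norm ((\<Sum>j\<in>J. L2_inner (f j) g) - L2_inner F g) \<le> Lp_norm 2 (\<lambda>x. ?S J x - F x) * Lp_norm 2 g" for J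
  proof -
    have "(\<Sum>j\<in>J. L2_inner (f j) g) = L2_inner (?S J) g"
      using L2_inner_sum_left[of J f g "\<lambda>_. 1"] L2 g by simp
    moreover have "L2_inner (\<lambda>x. 1 * ?S J x + (- 1) * F x) g = 1 * L2_inner (?S J) g + (- 1) * L2_inner F g"
      using L2 g by (intro L2_inner_linear Lp_2_sum)
    moreover have "?S J \<in> Lp 2"
      by (intro Lp_2_sum L2)
    from Cauchy_Schwarz_L2[OF Lp_2_diff[OF this L2(2)] g]
    have "\<bar>L2_inner (\<lambda>x. ?S J x - F x) g\<bar> \<le> Lp_norm 2 (\<lambda>x. ?S J x - F x) * Lp_norm 2 g" .
    ultimately show ?thesis
      by simp
  qed
  then show "((\<lambda>J. (\<Sum>j\<in>J. L2_inner (f j) g) - L2_inner F g) \<longlongrightarrow> 0) (finite_subsets_at_top UNIV)"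
    by (intro tendsto_norm_zero_cancel[OF tendsto_sandwich[OF _ _ tendsto_const lim]]) simp_all
qed simp

lemma haar_row_operator_inner_sums:
  assumes f: "f \<in> Lp 2" and g: "g \<in> Lp 2"
  shows "(\<lambda>n. L2_inner f (haar (int_decode n) i) * L2_inner g (haar (int_decode n) i))
    sums L2_inner (\<lambda>x. haar_row_operator f x i) g"
proof -
  have "L2_inner (haar_row_series f i j) g = L2_inner f (haar j i) * L2_inner g (haar j i)" for j
    using L2_inner_sum_left[of "{()}" "\<lambda>_. haar j i" g "\<lambda>_. L2_inner f (haar j i)"] g
    by (simp add: haar_row_series_def[abs_def] L2_inner_commute[of "haar j i"])
  then have "((\<lambda>j. L2_inner f (haar j i) * L2_inner g (haar j i)) has_sum
      L2_inner (\<lambda>x. haar_row_operator f x i) g) UNIV"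
    using L2_inner_has_L2_sum[OF haar_row_operator_has_L2_sum[OF f, of i] g] by simp
  then have "((\<lambda>n. L2_inner f (haar (int_decode n) i) * L2_inner g (haar (int_decode n) i)) has_sum
      L2_inner (\<lambda>x. haar_row_operator f x i) g) UNIV"
    using has_sum_reindex_bij_betw[OF bij_int_decode,
        of "\<lambda>j. L2_inner f (haar j i) * L2_inner g (haar j i)"] by simp
  then show ?thesis
    by (rule has_sum_imp_sums)
qed

lemma L2_inner_lborel:
  assumes "\<phi> \<in> bounded_support_functions"
  shows "integrable lborel (\<lambda>x. haar j i x * \<phi> x)" "(LINT x|lborel. haar j i x * \<phi> x) = L2_inner \<phi> (haar j i)"
proof -
  have m: "\<phi> \<in> borel_measurable borel"
    using assms by (simp add: bounded_support_functions_def)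
  show "integrable lborel (\<lambda>x. haar j i x * \<phi> x)"
    by (rule bounded_support_functions_integrable[OF assms borel_measurable_haar, where B = "2 powr (of_int j / 2)"])
      (simp add: abs_haar)
  have "haar j i x = 0" if "x < 0" for x
    using that dyadic_index_neg[of x j] by (intro haar_eq_0) auto
  then show "(LINT x|lborel. haar j i x * \<phi> x) = L2_inner \<phi> (haar j i)"
    unfolding L2_inner_def using m
    by (subst integral_rplus_eq_lborel(2)) (auto simp: mult.commute)
qed

text \<open>Off the diagonal the partial sums of the kernel are dominated by \<open>2 / \<delta>(x, y)\<close>, so the
  double integral is the limit of the integrals of the partial sums, which are inner products of the
  partial Haar sums.\<close>

lemma haar_kernel_represents:
  assumes \<phi>: "\<phi> \<in> bounded_support_functions" and \<psi>: "\<psi> \<in> finite_bounded_support_functions"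
    and sep: "0 < dyadic_setdist (dyadic_supp \<phi>) (dyadic_supp (\<lambda>x. l2_norm (\<psi> x)))"
  shows "has_bochner_integral (lebesgue_on ({0..} \<times> {0..}))
    (\<lambda>(x, y). l2_inner (\<lambda>i. haar_kernel x y i * \<phi> y) (\<psi> x)) (L2_l2_inner (haar_row_operator \<phi>) \<psi>)"
proof -
  obtain M where M: "\<And>x i. M \<le> i \<Longrightarrow> \<psi> x i = 0"
    using \<psi> unfolding finite_bounded_support_functions_def by blast
  have \<psi>i: "(\<lambda>x. \<psi> x i) \<in> bounded_support_functions" for i
    using \<psi> by (simp add: finite_bounded_support_functions_def)
  obtain R where R: "0 \<le> R" "\<forall>y. \<bar>\<phi> y\<bar> \<le> R" "\<forall>y. \<phi> y \<noteq> 0 \<longrightarrow> 0 \<le> y \<and> y \<le> R"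
    by (rule bounded_support_functionsE[OF \<phi>])
  have "\<exists>Q. 0 \<le> Q \<and> (\<forall>x. \<bar>\<psi> x i\<bar> \<le> Q) \<and> (\<forall>x. \<psi> x i \<noteq> 0 \<longrightarrow> 0 \<le> x \<and> x \<le> Q)" for i
    by (rule bounded_support_functionsE[OF \<psi>i[of i]]) (intro exI conjI)
  then have "\<forall>i. \<exists>Q. 0 \<le> Q \<and> (\<forall>x. \<bar>\<psi> x i\<bar> \<le> Q) \<and> (\<forall>x. \<psi> x i \<noteq> 0 \<longrightarrow> 0 \<le> x \<and> x \<le> Q)"
    by (rule allI)
  from choice[OF this] obtain Q where "\<forall>i. 0 \<le> Q i \<and> (\<forall>x. \<bar>\<psi> x i\<bar> \<le> Q i) \<and>
      (\<forall>x. \<psi> x i \<noteq> 0 \<longrightarrow> 0 \<le> x \<and> x \<le> Q i)"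
    by (elim exE) (rule that)
  then have Q: "\<And>i. 0 \<le> Q i" "\<And>i x. \<bar>\<psi> x i\<bar> \<le> Q i" "\<And>i x. \<psi> x i \<noteq> 0 \<Longrightarrow> 0 \<le> x \<and> x \<le> Q i"
    by simp_all
  \<comment> \<open>A single bound for size and support of all components, possible since only the
    first \<open>M\<close> are nonzero.\<close>
  define P where "P = (\<Sum>i<M. Q i)"
  have P: "0 \<le> P" "\<bar>\<psi> x i\<bar> \<le> P" "\<psi> x i \<noteq> 0 \<Longrightarrow> 0 \<le> x \<and> x \<le> P" for x i
  proof -
    show P0: "0 \<le> P"
      unfolding P_def by (intro sum_nonneg Q)
    have le: "Q i \<le> P" if "i < M"
      unfolding P_def using that Q(1) by (intro member_le_sum) auto
    show "\<bar>\<psi> x i\<bar> \<le> P"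
      using Q(2)[of x i] le M[of i x] P0 by (cases "i < M") auto
    show "0 \<le> x \<and> x \<le> P" if "\<psi> x i \<noteq> 0"
      using Q(3)[OF that] le M[of i x] that by (cases "i < M") auto
  qed
  \<comment> \<open>The distance is infinite if a support is empty, so a positive real below it is
    taken.\<close>
  obtain e where e: "0 < e" "ennreal e \<le> dyadic_setdist (dyadic_supp \<phi>) (dyadic_supp (\<lambda>x. l2_norm (\<psi> x)))"
  proof -
    obtain z where z: "0 < z" "z < dyadic_setdist (dyadic_supp \<phi>) (dyadic_supp (\<lambda>x. l2_norm (\<psi> x)))"
      using dense[OF sep] by blast
    then have "z < top"
      by (intro order.strict_trans2[OF z(2)]) simp
    then show ?thesis
      using that[of "enn2real z"] z by (simp add: enn2real_positive_iff)
  qed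
  have far: "e \<le> dyadic_dist y x" if "y \<in> dyadic_supp \<phi>" "x \<in> dyadic_supp (\<lambda>x. l2_norm (\<psi> x))" for x y
  proof -
    have "dyadic_setdist (dyadic_supp \<phi>) (dyadic_supp (\<lambda>x. l2_norm (\<psi> x))) \<le> ennreal (dyadic_dist y x)"
      unfolding dyadic_setdist_def by (rule INF_lower2[OF that(1)], rule INF_lower[OF that(2)])
    with e(2) have "ennreal e \<le> ennreal (dyadic_dist y x)"
      by (rule order_trans)
    then show ?thesis
      using dyadic_dist_nonneg by simp
  qed
  have l2_norm_\<psi>: "l2_norm (\<psi> x) \<noteq> 0" if "\<psi> x i \<noteq> 0" for x i
  proof -
    have "(\<lambda>i. (\<psi> x i)\<^sup>2) sums (\<Sum>i<M. (\<psi> x i)\<^sup>2)"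
      by (rule sums_finite) (auto simp: M)
    moreover have "i < M"
      using that M[of i x] by linarith
    then have "0 < (\<Sum>i<M. (\<psi> x i)\<^sup>2)"
      using that by (intro sum_pos2[of _ i]) auto
    ultimately show ?thesis
      by (simp add: l2_norm_def sums_iff)
  qed
  define G where "G N p = (\<Sum>n<N. \<Sum>i<M. (haar (int_decode n) i (fst p) * \<psi> (fst p) i) * (haar (int_decode n) i (snd p) * \<phi> (snd p)))" for N p
  define H where "H p = (\<Sum>i<M. haar_kernel (fst p) (snd p) i * (\<phi> (snd p) * \<psi> (fst p) i))" for p
  \<comment> \<open>The integrand is nonzero only where both functions are, and almost every such
    pair lies in the product of the supports, at distance at least \<open>e\<close>.\<close>
  have AE: "AE p in (lborel :: (real \<times> real) measure).
      \<phi> (snd p) \<noteq> 0 \<and> (\<exists>i. \<psi> (fst p) i \<noteq> 0) \<longrightarrow> 0 \<le> fst p \<and> 0 \<le> snd p \<and> e \<le> dyadic_dist (fst p) (snd p)"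
  proof -
    have "AE x in lborel. 0 \<le> x \<longrightarrow> l2_norm (\<psi> x) \<noteq> 0 \<longrightarrow> x \<in> dyadic_supp (\<lambda>x. l2_norm (\<psi> x))"
      using AE_dyadic_supp[of "\<lambda>x. l2_norm (\<psi> x)"] unfolding AE_rplus_iff .
    note A = AE_lborel_fst[OF this]
    have "AE y in lborel. 0 \<le> y \<longrightarrow> \<phi> y \<noteq> 0 \<longrightarrow> y \<in> dyadic_supp \<phi>"
      using AE_dyadic_supp[of \<phi>] unfolding AE_rplus_iff .
    note B = AE_lborel_snd[OF this]
    show ?thesis
      using A B
    proof eventually_elim
      case (elim p)
      show ?case
      proof (intro impI, elim conjE exE)
        fix i assume "\<phi> (snd p) \<noteq> 0" "\<psi> (fst p) i \<noteq> 0"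
        moreover from this have "0 \<le> fst p" "0 \<le> snd p" "l2_norm (\<psi> (fst p)) \<noteq> 0"
          using R(3)[rule_format, of "snd p"] P(3)[of "fst p" i] l2_norm_\<psi>[of "fst p" i] by simp_all
        ultimately show "0 \<le> fst p \<and> 0 \<le> snd p \<and> e \<le> dyadic_dist (fst p) (snd p)"
          using elim far[of "snd p" "fst p"] dyadic_dist_commute[of "fst p"] by simp
      qed
    qed
  qed
  have m\<phi>: "\<phi> \<in> borel_measurable borel" and m\<psi>: "(\<lambda>x. \<psi> x i) \<in> borel_measurable borel" for i
    using \<phi> \<psi>i by (auto simp: bounded_support_functions_def)
  have measG: "G N \<in> borel_measurable lborel" for N
    unfolding G_def[abs_def]
    using borel_measurable_fst_snd[OF borel_measurable_haar borel_measurable_haar]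
      borel_measurable_fst_snd[OF m\<psi> m\<phi>]
    by (simp add: borel_measurable_sum borel_measurable_times)
  have measH: "H \<in> borel_measurable lborel"
    unfolding H_def[abs_def]
    using borel_measurable_haar_kernel borel_measurable_fst_snd[OF m\<psi> m\<phi>]
    by (simp add: split_beta' borel_measurable_sum borel_measurable_times)
  \<comment> \<open>\<open>2 / e\<close> bounds the absolute partial sums of the kernel and
    \<open>P * R\<close> the two functions; the indicators make the majorant integrable.\<close>
  define w where "w p = (2 / e * P * R) * (indicator {0..P} (fst p) * indicator {0..R} (snd p) :: real)" for p :: "real \<times> real"
  have w: "integrable lborel w"
  proof -
    have "integrable lborel (indicator {0..a} :: real \<Rightarrow> real)" for a :: real
      by (intro integrable_real_indicator) (auto simp: emeasure_lborel_Icc_eq)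
    from has_bochner_integral_lborel_product[OF this this] show ?thesis
      unfolding w_def[abs_def] by (intro integrable_mult_right) (simp add: has_bochner_integral_iff)
  qed
  have bound: "AE p in lborel. norm (G N p) \<le> w p" for N
    using AE
  proof eventually_elim
    case (elim p)
    obtain x y where p: "p = (x, y)" by fastforce
    show ?case
    proof (cases "\<phi> y \<noteq> 0 \<and> (\<exists>i. \<psi> x i \<noteq> 0)")
      case True
      then have *: "0 \<le> x" "0 \<le> y" "e \<le> dyadic_dist x y" "x \<le> P" "y \<le> R"
        using elim p P(3) R(3) by auto
      then have "x \<noteq> y"
        using e(1) by (auto simp: dyadic_dist_def)
      have "\<bar>G N p\<bar> \<le> (\<Sum>n<N. \<Sum>i<M. \<bar>haar (int_decode n) i x * haar (int_decode n) i y\<bar> * (P * R))"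
        unfolding G_def p fst_conv snd_conv
      proof (intro order_trans[OF sum_abs] sum_mono)
        fix n i
        have "\<bar>\<psi> x i\<bar> * \<bar>\<phi> y\<bar> \<le> P * R"
          using P(1,2) R(1,2) by (intro mult_mono) auto
        then have "\<bar>haar (int_decode n) i x * haar (int_decode n) i y\<bar> * (\<bar>\<psi> x i\<bar> * \<bar>\<phi> y\<bar>)
            \<le> \<bar>haar (int_decode n) i x * haar (int_decode n) i y\<bar> * (P * R)"
          by (rule mult_left_mono) simp
        then show "\<bar>haar (int_decode n) i x * \<psi> x i * (haar (int_decode n) i y * \<phi> y)\<bar>
            \<le> \<bar>haar (int_decode n) i x * haar (int_decode n) i y\<bar> * (P * R)"
          by (simp add: abs_mult ac_simps)
      qed
      also have "\<dots> = (\<Sum>n<N. \<Sum>i<M. \<bar>haar (int_decode n) i x * haar (int_decode n) i y\<bar>) * (P * R)"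
        by (simp add: sum_distrib_right)
      also have "\<dots> \<le> 2 / dyadic_dist x y * (P * R)"
        using * \<open>x \<noteq> y\<close> P(1) R(1) by (intro mult_right_mono sum_abs_haar_product_le) auto
      also have "\<dots> \<le> 2 / e * (P * R)"
      proof (rule mult_right_mono)
        have "0 < dyadic_dist x y"
          using *(3) e(1) by linarith
        then show "2 / dyadic_dist x y \<le> 2 / e"
          using *(3) e(1) by (intro divide_left_mono) auto
        show "0 \<le> P * R"
          using P(1) R(1) by simp
      qed
      also have "\<dots> = w p"
        using * by (simp add: w_def p)
      finally show ?thesis by simp
    next
      case False
      then have "G N p = 0"
        by (auto simp: G_def p intro!: sum.neutral)
      moreover have "0 \<le> w p"
        using e P(1) R(1) by (simp add: w_def)
      ultimately show ?thesis by simp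
    qed
  qed
  have lim: "AE p in lborel. (\<lambda>N. G N p) \<longlonglongrightarrow> H p"
    using AE
  proof eventually_elim
    case (elim p)
    obtain x y where p: "p = (x, y)" by fastforce
    show ?case
    proof (cases "\<phi> y \<noteq> 0 \<and> (\<exists>i. \<psi> x i \<noteq> 0)")
      case True
      then have *: "0 \<le> x" "0 \<le> y" "e \<le> dyadic_dist x y"
        using elim p by auto
      then have "x \<noteq> y"
        using e(1) by (auto simp: dyadic_dist_def)
      have "(\<lambda>n. haar (int_decode n) i x * haar (int_decode n) i y) sums haar_kernel x y i" for i
        unfolding haar_kernel_def
        by (rule summable_sums[OF summable_rabs_cancel[OF summable_abs_haar_product[OF *(1,2) \<open>x \<noteq> y\<close>]]])
      then have "(\<lambda>n. \<Sum>i<M. haar (int_decode n) i x * haar (int_decode n) i y * (\<phi> y * \<psi> x i)) sums H p"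
        unfolding H_def p fst_conv snd_conv by (intro sums_sum sums_mult2)
      then show ?thesis
        by (simp add: sums_def G_def p ac_simps)
    next
      case False
      then have "G N p = 0" "H p = 0" for N
        by (auto simp: G_def H_def p intro!: sum.neutral)
      then show ?thesis by simp
    qed
  qed
  \<comment> \<open>Each term separates into a function of \<open>x\<close> times a function of
    \<open>y\<close>, so its double integral is a product of two Haar coefficients.\<close>
  have intG: "has_bochner_integral lborel (G N)
      (\<Sum>n<N. \<Sum>i<M. L2_inner (\<lambda>x. \<psi> x i) (haar (int_decode n) i) * L2_inner \<phi> (haar (int_decode n) i))" for N
    unfolding G_def[abs_def]
  proof (intro has_bochner_integral_sum)
    fix n i
    show "has_bochner_integral lborel
        (\<lambda>p. haar (int_decode n) i (fst p) * \<psi> (fst p) i * (haar (int_decode n) i (snd p) * \<phi> (snd p)))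
        (L2_inner (\<lambda>x. \<psi> x i) (haar (int_decode n) i) * L2_inner \<phi> (haar (int_decode n) i))"
      using has_bochner_integral_lborel_product[OF L2_inner_lborel(1)[OF \<psi>i[of i], of "int_decode n" i]
          L2_inner_lborel(1)[OF \<phi>, of "int_decode n" i]]
      unfolding L2_inner_lborel(2)[OF \<phi>] L2_inner_lborel(2)[OF \<psi>i] .
  qed
  have "(\<lambda>n. \<Sum>i<M. L2_inner \<phi> (haar (int_decode n) i) * L2_inner (\<lambda>x. \<psi> x i) (haar (int_decode n) i))
      sums (\<Sum>i<M. L2_inner (\<lambda>x. haar_row_operator \<phi> x i) (\<lambda>x. \<psi> x i))"
    by (intro sums_sum haar_row_operator_inner_sums bounded_support_functions_in_L2 \<phi> \<psi>i)
  then have lim1: "(\<lambda>N. integral\<^sup>L lborel (G N)) \<longlonglongrightarrow> (\<Sum>i<M. L2_inner (\<lambda>x. haar_row_operator \<phi> x i) (\<lambda>x. \<psi> x i))"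
    by (simp add: sums_def has_bochner_integral_integral_eq[OF intG] mult.commute)
  \<comment> \<open>The same integrals also converge to the kernel integral by dominated
    convergence, so the two limits coincide.\<close>
  have lim2: "(\<lambda>N. integral\<^sup>L lborel (G N)) \<longlonglongrightarrow> integral\<^sup>L lborel H"
    by (rule integral_dominated_convergence[OF measH measG w lim bound])
  have intH: "integrable lborel H"
    by (rule integrable_dominated_convergence[OF measH measG w lim bound])
  have inner: "l2_inner a (\<psi> x) = (\<Sum>i<M. a i * \<psi> x i)" for a x
    unfolding l2_inner_def by (rule suminf_finite) (auto simp: M)
  have "L2_l2_inner (haar_row_operator \<phi>) \<psi> = (LINT x|rplus. (\<Sum>i<M. haar_row_operator \<phi> x i * \<psi> x i))"
    by (simp add: L2_l2_inner_def inner)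
  also have "\<dots> = (\<Sum>i<M. L2_inner (\<lambda>x. haar_row_operator \<phi> x i) (\<lambda>x. \<psi> x i))"
    unfolding L2_inner_def
  proof (rule Bochner_Integration.integral_sum)
    have "\<phi> \<in> Lp 2"
      using \<phi> by (rule bounded_support_functions_in_L2)
    then show "integrable rplus (\<lambda>x. haar_row_operator \<phi> x i * \<psi> x i)" for i
      using haar_row_operator_has_L2_sum[of \<phi> i] bounded_support_functions_in_L2[OF \<psi>i]
      by (intro integrable_mult_L2) (auto simp: has_L2_sum_def)
  qed
  also have "\<dots> = integral\<^sup>L lborel H"
    using lim1 lim2 by (rule LIMSEQ_unique)
  finally have "has_bochner_integral lborel H (L2_l2_inner (haar_row_operator \<phi>) \<psi>)"
    using intH by (simp add: has_bochner_integral_iff)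
  then have "has_bochner_integral (lebesgue_on ({0..} \<times> {0..})) H (L2_l2_inner (haar_row_operator \<phi>) \<psi>)"
  proof (rule has_bochner_integral_lebesgue_on)
    have "closed ({0..} \<times> {0..} :: (real \<times> real) set)"
      by (intro closed_Times) auto
    then show "({0..} \<times> {0..} :: (real \<times> real) set) \<in> sets lebesgue"
      by (intro sets_completionI_sets) simp
    fix p :: "real \<times> real" assume "p \<notin> {0..} \<times> {0..}"
    then have "\<phi> (snd p) = 0 \<or> (\<forall>i. \<psi> (fst p) i = 0)"
      using R(3) P(3) by (auto simp: mem_Times_iff)
    then show "H p = 0"
      by (auto simp: H_def)
  qed
  moreover have "H = (\<lambda>(x, y). l2_inner (\<lambda>i. haar_kernel x y i * \<phi> y) (\<psi> x))"
    by (auto simp: fun_eq_iff H_def inner mult.assoc)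
  ultimately show ?thesis by simp
qed

lemma haar_row_operator_cz: "l2_calderon_zygmund haar_row_operator"
proof -
  have "represented_off_diagonal haar_row_operator haar_kernel"
    unfolding represented_off_diagonal_def
  proof (intro exI conjI ballI impI)
    show "dense_subspace_L2 bounded_support_functions"
      by (rule dense_subspace_bounded_support)
    show "dense_subspace_L2_l2 finite_bounded_support_functions"
      by (rule dense_subspace_finite_bounded_support)
  qed (rule haar_kernel_represents)
  then show ?thesis
    unfolding l2_calderon_zygmund_def
    using haar_row_operator_bounded_linear haar_kernel_cz by blast
qed

text \<open>The first conjunct ensures that the choice in \<open>L2_sum\<close> picks a genuine sum;
  membership in \<open>Lp_l2 p\<close> ensures that the gradient norm comes from an integrable
  function and not from a default value of the integral.\<close>

theorem theorem6p1:
  fixes s :: real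
  assumes "0 < s" and "s < 1"
  shows "(\<forall>g\<in>Lp 2. \<forall>i. \<exists>F. has_L2_sum (haar_row_series g i) F)
    \<and> l2_calderon_zygmund haar_row_operator
    \<and> (\<forall>p::real. 1 < p \<longrightarrow>
         (\<exists>C::real. \<forall>u\<in>haar_span.
            dyadic_gradient s u \<in> Lp_l2 p \<and>
            Lp_l2_norm p (dyadic_gradient s u) \<le> C * Lp_norm p (dyadic_frac_laplacian s u)))"
  using has_L2_sum_haar_row haar_row_operator_cz dyadic_gradient_Lp_bound by blast

end
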